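(* Let $C$ be a superelliptic curve over $\mathbb{F}_p$ satisfying the standing assumptions below, with affine model $y^a=x^b(m_cx^c+\dots+m_1x+m_0)$. With respect to the basis $\{\omega_{i,j}:(i,j)\in\mathcal{N}\}$ of regular differentials, the Hasse-Witt matrix of $C$ is $[a_{(i,j),(i',j')}]$, where \[ a_{(i,j),(i',j')}=\sum_{\substack{k_0+k_1+\dots+k_c=v_j=(j-a+p(a-j'))/a,\\ pi'=bv_j+ck_c+(c-1)k_{c-1}+\dots+k_1+i}}\begin{bmatrix}(j-a+p(a-j'))/a\\ k_0,\dots,k_c\end{bmatrix}m_0^{k_0}m_1^{k_1}\cdots m_c^{k_c}. \]
   Context: Standing assumptions: $p\neq 2,3$ is a prime; $f(x)=m_cx^c+\dots+m_0\in\mathbb{F}_p[x]$ with $m_c\neq0$, $m_0\neq0$; $a,c\ge2$, $b\ge0$; $p>a$ and $p>b+c$; $y^a-x^bf(x)$ is irreducible; $C$ is the smooth projective curve with affine model $y^a=x^bf(x)$; the curves defined by this equation over $\mathbb{Z}$ and over $\mathbb{F}_p$ have the same genus; and for each side of the convex hull $P$ of the lattice points in the interior of the Newton polygon of $y^a-x^bf(x)$, the "side polynomial" (whose coefficient of $t^i$ is the coefficient of the monomial corresponding to the $i$-th lattice point $0,1,\dots,s$ on that side) is square-free. $\mathcal{N}$ is the set \[ \mathcal{N}=\Big\{(i,j):\ \big(1\le i\le b,\ \lfloor -\tfrac{a}{b}i+a\rfloor+1\le j\le\lceil -\tfrac{a}{b+c}i+a\rceil-1\big)\ \text{or}\ \big(b+1\le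 i\le b+c-1,\ 1\le j\le\lceil -\tfrac{a}{b+c}i+a\rceil-1\big)\Big\}, \] and $\omega_{i,j}=\dfrac{x^{i-1}y^{j-1}}{y^{a-1}}\,dx$; these form a basis of the space $\Omega(C)$ of regular differentials. The Cartier operator $\mathscr{C}$ on $\Omega(C)$ is defined by $\mathscr{C}(\omega)=a_{p-1}\,dx$ when $\omega=(a_0^p+a_1^px+\dots+a_{p-1}^px^{p-1})\,dx$; the Hasse-Witt matrix has entries $a_{(i,j),(i',j')}$ defined by $\mathscr{C}(\omega_{i,j})=\sum_{(i',j')\in\mathcal{N}}a_{(i,j),(i',j')}\omega_{i',j'}$ (over $\mathbb{F}_p$, $a^{1/p}=a$). The bracket $\begin{bmatrix}n\\ b_1,\dots,b_k\end{bmatrix}$ equals the multinomial coefficient $\binom{n}{b_1,\dots,b_k}$ if $n,b_i$ are nonnegative integers with $\sum b_i=n$, and $0$ otherwise; the sum ranges over tuples of nonnegative integers $(k_0,\dots,k_c)$ satisfying the displayed conditions (empty if $(j-a+p(a-j'))/a$ is not a nonnegative integer).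
   Formalization: The square-free side polynomials are taken along the sides of the Newton polygon of y^a-x^b f itself, not of the convex hull P of its interior lattice points, where all coefficients vanish; literally the claim is vacuous or false, e.g. for y^2=(x-1)^2(x-2). *)

theory Defs
  imports
    "Berlekamp_Zassenhaus.Finite_Field"
    "HOL-Analysis.Polytope"
    "HOL-Computational_Algebra.Squarefree"
begin

section \<open>Plane equations and function fields\<close>

text \<open>A polynomial in \<open>k[x,y]\<close> is an element of \<open>k[x][y]\<close>: the outer variable is \<open>y\<close>, so the
  coefficient of \<open>x\<^sup>i y\<^sup>j\<close> in \<open>F\<close> is \<open>coeff (coeff F j) i\<close>.\<close>

definition superelliptic_poly :: "nat \<Rightarrow> nat \<Rightarrow> 'k::field poly \<Rightarrow> 'k poly poly" where
  "superelliptic_poly a b f = monom 1 a - [: monom 1 b * f :]"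

definition eval2 :: "('k::field \<Rightarrow> 'K::field) \<Rightarrow> 'K \<Rightarrow> 'K \<Rightarrow> 'k poly poly \<Rightarrow> 'K" where
  "eval2 \<iota> x y F = poly (map_poly (\<lambda>q. poly (map_poly \<iota> q) x) F) y"

text \<open>\<open>'K\<close> is a model of the fraction field of \<open>k[x,y]/(F)\<close>, with structure map \<open>\<iota>\<close> and with
  \<open>x\<close>, \<open>y\<close> the classes of the variables. A smooth projective curve is
  handled through its function field, its closed points being the places.\<close>

definition is_function_field ::
    "'k::field poly poly \<Rightarrow> ('k \<Rightarrow> 'K::field) \<Rightarrow> 'K \<Rightarrow> 'K \<Rightarrow> bool" where
  "is_function_field F \<iota> x y \<longleftrightarrow>
     field_hom \<iota> \<and>
     (\<forall>P. eval2 \<iota> x y P = 0 \<longleftrightarrow> F dvd P) \<and>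
     (\<forall>z. \<exists>P Q. eval2 \<iota> x y Q \<noteq> 0 \<and> z = eval2 \<iota> x y P / eval2 \<iota> x y Q)"

section \<open>Places and regular differentials\<close>

text \<open>A place is a normalised discrete valuation of \<open>'K\<close> trivial on \<open>k\<close>. The value of \<open>v\<close> at
  \<open>0\<close> (mathematically \<open>\<infinity>\<close>) is irrelevant and left unconstrained.\<close>

definition is_place :: "('k::field \<Rightarrow> 'K::field) \<Rightarrow> ('K \<Rightarrow> int) \<Rightarrow> bool" where
  "is_place \<iota> v \<longleftrightarrow>
     (\<forall>z w. z \<noteq> 0 \<longrightarrow> w \<noteq> 0 \<longrightarrow> v (z * w) = v z + v w) \<and>
     (\<forall>z w. z \<noteq> 0 \<longrightarrow> w \<noteq> 0 \<longrightarrow> z + w \<noteq> 0 \<longrightarrow> min (v z) (v w) \<le> v (z + w)) \<and>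
     (\<forall>c. c \<noteq> 0 \<longrightarrow> v (\<iota> c) = 0) \<and>
     (\<exists>t. t \<noteq> 0 \<and> v t = 1)"

definition is_derivation :: "('k::field \<Rightarrow> 'K::field) \<Rightarrow> ('K \<Rightarrow> 'K) \<Rightarrow> bool" where
  "is_derivation \<iota> D \<longleftrightarrow>
     (\<forall>z w. D (z + w) = D z + D w) \<and>
     (\<forall>z w. D (z * w) = z * D w + w * D z) \<and>
     (\<forall>c. D (\<iota> c) = 0)"

text \<open>When \<open>K/k(x)\<close> is finite separable there is exactly one \<open>k\<close>-derivation of \<open>K\<close>
  with \<open>x \<mapsto> 1\<close>. In that case the rational differentials form the one-dimensional space
  \<open>K dx\<close>; from here on the differential \<open>h dx\<close> is represented by \<open>h\<close>, so that \<open>dt\<close> is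
  represented by \<open>d_dx \<iota> x t\<close>.\<close>

definition d_dx :: "('k::field \<Rightarrow> 'K::field) \<Rightarrow> 'K \<Rightarrow> 'K \<Rightarrow> 'K" where
  "d_dx \<iota> x = (THE D. is_derivation \<iota> D \<and> D x = 1)"

text \<open>\<open>h dx\<close> is regular if at every place it has the form \<open>g dt\<close> with \<open>t\<close> a uniformiser and
  \<open>g\<close> in the valuation ring.\<close>

definition regular_differentials :: "('k::field \<Rightarrow> 'K::field) \<Rightarrow> 'K \<Rightarrow> 'K set" where
  "regular_differentials \<iota> x =
     {h. \<forall>v t. is_place \<iota> v \<and> t \<noteq> 0 \<and> v t = 1 \<longrightarrow>
           (\<exists>g. (g = 0 \<or> 0 \<le> v g) \<and> h = g * d_dx \<iota> x t)}"

definition genus :: "('k::field \<Rightarrow> 'K::field) \<Rightarrow> 'K \<Rightarrow> nat" where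
  "genus \<iota> x = vector_space.dim (\<lambda>c z. \<iota> c * z) (regular_differentials \<iota> x)"

definition is_basis_family ::
    "('k::field \<Rightarrow> 'K::field) \<Rightarrow> 'K set \<Rightarrow> 'i set \<Rightarrow> ('i \<Rightarrow> 'K) \<Rightarrow> bool" where
  "is_basis_family \<iota> V I w \<longleftrightarrow>
     inj_on w I \<and>
     \<not> module.dependent (\<lambda>c z. \<iota> c * z) (w ` I) \<and>
     module.span (\<lambda>c z. \<iota> c * z) (w ` I) = V"

section \<open>Cartier operator and Hasse-Witt matrix\<close>

text \<open>In characteristic \<open>p\<close>, with \<open>x\<close> separating, \<open>1, x, \<dots>, x\<^sup>p\<^sup>-\<^sup>1\<close> is a basis of \<open>K\<close> over
  \<open>K\<^sup>p\<close>, so the \<open>u n\<close> below exist and are unique for \<open>n < p\<close>.\<close>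

definition cartier :: "nat \<Rightarrow> 'K::field \<Rightarrow> 'K \<Rightarrow> 'K" where
  "cartier p x h = (THE c. \<exists>u. h = (\<Sum>n<p. u n ^ p * x ^ n) \<and> c = u (p - 1))"

definition is_hasse_witt_matrix ::
    "nat \<Rightarrow> ('k::field \<Rightarrow> 'K::field) \<Rightarrow> 'K \<Rightarrow> 'i set \<Rightarrow> ('i \<Rightarrow> 'K) \<Rightarrow> ('i \<Rightarrow> 'i \<Rightarrow> 'k) \<Rightarrow> bool"
  where
  "is_hasse_witt_matrix p \<iota> x I w A \<longleftrightarrow>
     is_basis_family \<iota> (regular_differentials \<iota> x) I w \<and>
     (\<forall>r\<in>I. cartier p x (w r) = (\<Sum>r'\<in>I. \<iota> (A r r') * w r'))"

section \<open>Newton polygon and side polynomials\<close>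

definition newton_polygon :: "'k::field poly poly \<Rightarrow> (real \<times> real) set" where
  "newton_polygon F = convex hull {(real i, real j) | i j. coeff (coeff F j) i \<noteq> 0}"

text \<open>A side with lattice points \<open>(u, v) + n (\<alpha>, \<beta>)\<close> for \<open>0 \<le> n \<le> s\<close>, where \<open>(\<alpha>, \<beta>)\<close> is
  primitive. The two orientations of a side give mutually reciprocal polynomials.\<close>

definition squarefree_side_polys :: "'k::field poly poly \<Rightarrow> bool" where
  "squarefree_side_polys F \<longleftrightarrow>
     (\<forall>u v \<alpha> \<beta> :: int. \<forall>s :: nat.
        coprime \<alpha> \<beta> \<longrightarrow>
        closed_segment (real_of_int u, real_of_int v)
            (real_of_int (u + int s * \<alpha>), real_of_int (v + int s * \<beta>)) edge_of newton_polygon F \<longrightarrow>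
        squarefree (\<Sum>n\<le>s. monom (coeff (coeff F (nat (v + int n * \<beta>))) (nat (u + int n * \<alpha>))) n))"

section \<open>Index set, differentials and matrix entries\<close>

definition index_set :: "nat \<Rightarrow> nat \<Rightarrow> nat \<Rightarrow> (nat \<times> nat) set" where
  "index_set a b c =
     {(i, j).
        (1 \<le> i \<and> i \<le> b \<and>
         \<lfloor>- (real a / real b) * real i + real a\<rfloor> + 1 \<le> int j \<and>
         int j \<le> \<lceil>- (real a / real (b + c)) * real i + real a\<rceil> - 1) \<or>
        (b + 1 \<le> i \<and> i \<le> b + c - 1 \<and> 1 \<le> j \<and>
         int j \<le> \<lceil>- (real a / real (b + c)) * real i + real a\<rceil> - 1)}"

definition omega :: "nat \<Rightarrow> 'K::field \<Rightarrow> 'K \<Rightarrow> nat \<times> nat \<Rightarrow> 'K" where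
  "omega a x y = (\<lambda>(i, j). x ^ (i - 1) * y ^ (j - 1) / y ^ (a - 1))"

definition multinomial_bracket :: "rat \<Rightarrow> nat \<Rightarrow> (nat \<Rightarrow> nat) \<Rightarrow> nat" where
  "multinomial_bracket v c k =
     (if v = of_nat (\<Sum>l\<le>c. k l) then fact (\<Sum>l\<le>c. k l) div (\<Prod>l\<le>c. fact (k l)) else 0)"

text \<open>The tuples \<open>(k\<^sub>0, \<dots>, k\<^sub>c)\<close> are functions on \<open>{..c}\<close>, made unique by being
  \<open>undefined\<close> elsewhere.\<close>

definition hasse_witt_entry ::
    "nat \<Rightarrow> nat \<Rightarrow> nat \<Rightarrow> nat \<Rightarrow> 'k::field poly \<Rightarrow> nat \<times> nat \<Rightarrow> nat \<times> nat \<Rightarrow> 'k" where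
  "hasse_witt_entry p a b c f = (\<lambda>(i, j) (i', j').
     let v = (of_nat j - of_nat a + of_nat p * (of_nat a - of_nat j')) / of_nat a :: rat
     in \<Sum>k | k \<in> ({..c} \<rightarrow>\<^sub>E UNIV) \<and>
              of_nat (\<Sum>l\<le>c. k l) = v \<and>
              of_nat (p * i') = of_nat b * v + of_nat (\<Sum>l\<le>c. l * k l) + of_nat i.
          of_nat (multinomial_bracket v c k) * (\<Prod>l\<le>c. coeff f l ^ k l))"

end

theory Submission
  imports "HOL-Algebra.Algebraic_Closure_Type" "HOL-Computational_Algebra.Computational_Algebra" Defs
begin

text \<open>Write \<open>g = x\<^sup>b f\<close>, so that \<open>y\<^sup>a = g(x)\<close>, and let \<open>D\<close> be the derivation of \<open>K\<close> with
  \<open>D x = 1\<close>. The square-freeness of the side polynomial of the side from \<open>(b, 0)\<close> to \<open>(b + c, 0)\<close>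
  says that \<open>f\<close> has simple roots.

  Each \<open>\<omega>\<^sub>i\<^sub>j\<close> is regular at every place \<open>v\<close>: if \<open>t\<close> is a uniformiser, then
  \<open>1, t, \<dots>, t\<^sup>p\<^sup>-\<^sup>1\<close> is a basis of \<open>K\<close> over \<open>K\<^sup>p\<close>, so \<open>D z / D t\<close> can be read off the expansion
  of \<open>z\<close>. This bounds \<open>v(D t)\<close> from above by means of \<open>z = x\<close> or \<open>z = y\<close>.

  Conversely, let \<open>h dx\<close> be regular. For a point \<open>\<rho>\<close> of the affine line over the algebraic closure,
  the substitution \<open>x = \<rho> + t\<^sup>a\<close> turns \<open>g(x)\<close> into an \<open>a\<close>-th power of a Laurent series in \<open>t\<close>,
  whence one embedding of \<open>K\<close> into Laurent series for every \<open>a\<close>-th root of unity \<open>\<zeta>\<close> (with \<open>y\<close>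
  multiplied by \<open>\<zeta>\<close>), and similarly with \<open>x = t\<^sup>-\<^sup>a\<close> at infinity. The image of \<open>h dx\<close> has no pole
  in \<open>t\<close>. Letting \<open>\<zeta>\<close> vary separates the terms of \<open>h = \<Sum>\<^sub>j h\<^sub>j(x) y\<^sup>j\<^sup>-\<^sup>a\<close>, and the resulting bounds on
  the orders of the \<open>h\<^sub>j\<close> leave only the monomials of the index set.

  For the Cartier operator, choose \<open>j'\<close> with \<open>p j' \<equiv> j\<close> modulo \<open>a\<close>; then
  \<open>x\<^sup>i\<^sup>-\<^sup>1 y\<^sup>j\<^sup>-\<^sup>a = (y\<^sup>j\<^sup>'\<^sup>-\<^sup>a)\<^sup>p x\<^sup>i\<^sup>-\<^sup>1 g\<^sup>v\<close>, and \<open>f\<^sup>v\<close> is expanded by the multinomial theorem.\<close>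

section \<open>Multinomial coefficients\<close>

text \<open>Extensional functions match the index set of \<open>hasse_witt_entry\<close> and, for
  finite \<open>A\<close>, form a finite set.\<close>

definition multi_indices :: "'b set \<Rightarrow> nat \<Rightarrow> ('b \<Rightarrow> nat) set" where
  "multi_indices A v = {k \<in> A \<rightarrow>\<^sub>E UNIV. sum k A = v}"

lemma finite_multi_indices:
  assumes "finite A"
  shows "finite (multi_indices A v)"
proof (rule finite_subset)
  show "multi_indices A v \<subseteq> A \<rightarrow>\<^sub>E {..v}"
  proof
    fix k assume k: "k \<in> multi_indices A v"
    have "k l \<le> v" if "l \<in> A" for l
      using member_le_sum[of l A k] that assms k by (simp add: multi_indices_def)
    then show "k \<in> A \<rightarrow>\<^sub>E {..v}" using k by (auto simp: multi_indices_def PiE_iff)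
  qed
  show "finite (A \<rightarrow>\<^sub>E {..v})" by (simp add: finite_PiE assms)
qed

text \<open>Splitting off the exponent at the new element is the change of summation index in the
  induction for \<open>multinomial_theorem\<close>.\<close>

lemma multi_indices_insert:
  assumes "finite A" "a \<notin> A"
  shows "bij_betw (\<lambda>(i, k). k(a := i)) (SIGMA i:{..v}. multi_indices A (v - i)) (multi_indices (insert a A) v)"
proof (rule bij_betw_byWitness[where f' = "\<lambda>k. (k a, restrict k A)"])
  have s: "sum (k(a := i)) A = sum k A" for k :: "'a \<Rightarrow> nat" and i
    by (rule sum.cong) (use assms in auto)
  have s': "sum (restrict k A) A = sum k A" for k :: "'a \<Rightarrow> nat"
    by (rule sum.cong) auto
  show "\<forall>u\<in>(SIGMA i:{..v}. multi_indices A (v - i)). (\<lambda>k. (k a, restrict k A)) ((\<lambda>(i, k). k(a := i)) u) = u"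
    using assms by (auto simp: multi_indices_def fun_eq_iff PiE_iff extensional_def restrict_def)
  show "\<forall>k\<in>multi_indices (insert a A) v. (\<lambda>(i, k). k(a := i)) (k a, restrict k A) = k"
    using assms by (auto simp: multi_indices_def fun_eq_iff PiE_iff extensional_def restrict_def)
  show "(\<lambda>(i, k). k(a := i)) ` (SIGMA i:{..v}. multi_indices A (v - i)) \<subseteq> multi_indices (insert a A) v"
    using assms by (auto simp: multi_indices_def PiE_iff extensional_def s simp del: fun_upd_apply) (auto)
  show "(\<lambda>k. (k a, restrict k A)) ` multi_indices (insert a A) v \<subseteq> (SIGMA i:{..v}. multi_indices A (v - i))"
    using assms by (auto simp: multi_indices_def PiE_iff s')
qed

text \<open>It makes the natural-number division in the multinomial coefficient exact.\<close>

lemma prod_fact_dvd_fact_sum: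
  assumes "finite A"
  shows "(\<Prod>l\<in>A. fact (k l)) dvd (fact (\<Sum>l\<in>A. k l) :: nat)"
  using assms
proof (induction A)
  case (insert a A)
  have "fact (k a) * (\<Prod>l\<in>A. fact (k l)) dvd (fact (k a) * fact (sum k A) :: nat)"
    using insert.IH by (rule mult_dvd_mono[OF dvd_refl])
  also have "\<dots> dvd (fact (k a + sum k A) :: nat)"
    by (rule fact_fact_dvd_fact)
  finally show ?case using insert.hyps by simp
qed simp

text \<open>Induction on \<open>A\<close>: the binomial theorem separates \<open>z a\<close> from
  the remaining sum, whose powers are expanded by the induction hypothesis.\<close>

theorem multinomial_theorem:
  fixes z :: "'b \<Rightarrow> 'a::comm_semiring_1"
  assumes "finite A"
  shows "(\<Sum>l\<in>A. z l) ^ v =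
    (\<Sum>k\<in>multi_indices A v. of_nat (fact v div (\<Prod>l\<in>A. fact (k l))) * (\<Prod>l\<in>A. z l ^ k l))"
  using assms
proof (induction A arbitrary: v)
  case empty
  have "multi_indices ({}::'b set) v = (if v = 0 then {\<lambda>_. undefined} else {})"
    by (auto simp: multi_indices_def)
  then show ?case by (simp add: power_0_left)
next
  case (insert a A)
  have upd1: "(\<Prod>l\<in>A. fact ((k(a := i)) l) :: nat) = (\<Prod>l\<in>A. fact (k l))" for k i
    by (rule prod.cong) (use insert.hyps in auto)
  have upd2: "(\<Prod>l\<in>A. z l ^ (k(a := i)) l) = (\<Prod>l\<in>A. z l ^ k l)" for k i
    by (rule prod.cong) (use insert.hyps in auto)
  have coef: "fact v div (fact i * (\<Prod>l\<in>A. fact (k l))) = (v choose i) * (fact (v - i) div (\<Prod>l\<in>A. fact (k l)))"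
    if "i \<le> v" "k \<in> multi_indices A (v - i)" for i k
  proof -
    have d: "(\<Prod>l\<in>A. fact (k l)) dvd (fact (v - i) :: nat)"
      using prod_fact_dvd_fact_sum[OF insert.hyps(1), of k] that by (simp add: multi_indices_def)
    have "(fact v::nat) = fact i * ((v choose i) * fact (v - i))"
      using binomial_fact_lemma[OF that(1)] by (simp add: algebra_simps)
    then have "(fact v::nat) div (fact i * (\<Prod>l\<in>A. fact (k l)))
        = ((v choose i) * fact (v - i)) div (\<Prod>l\<in>A. fact (k l))"
      by (simp add: div_mult2_eq)
    also have "\<dots> = (v choose i) * (fact (v - i) div (\<Prod>l\<in>A. fact (k l)))"
      using d by (rule div_mult_swap[symmetric])
    finally show ?thesis .
  qed
  have "(\<Sum>l\<in>insert a A. z l) ^ v = (z a + (\<Sum>l\<in>A. z l)) ^ v"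
    using insert.hyps by simp
  also have "\<dots> = (\<Sum>i\<le>v. of_nat (v choose i) * z a ^ i * (\<Sum>l\<in>A. z l) ^ (v - i))"
    by (rule binomial_ring)
  also have "\<dots> = (\<Sum>i\<le>v. \<Sum>k\<in>multi_indices A (v - i).
      of_nat (fact v div (\<Prod>l\<in>insert a A. fact ((k(a := i)) l))) * (\<Prod>l\<in>insert a A. z l ^ (k(a := i)) l))"
  proof (rule sum.cong[OF refl])
    fix i assume i: "i \<in> {..v}"
    have "of_nat (v choose i) * z a ^ i * (\<Sum>l\<in>A. z l) ^ (v - i) = (\<Sum>k\<in>multi_indices A (v - i).
        of_nat (v choose i) * z a ^ i * (of_nat (fact (v - i) div (\<Prod>l\<in>A. fact (k l))) * (\<Prod>l\<in>A. z l ^ k l)))"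
      by (simp only: insert.IH sum_distrib_left)
    also have "\<dots> = (\<Sum>k\<in>multi_indices A (v - i).
      of_nat (fact v div (\<Prod>l\<in>insert a A. fact ((k(a := i)) l))) * (\<Prod>l\<in>insert a A. z l ^ (k(a := i)) l))"
    proof (rule sum.cong[OF refl])
      fix k assume k: "k \<in> multi_indices A (v - i)"
      show "of_nat (v choose i) * z a ^ i * (of_nat (fact (v - i) div (\<Prod>l\<in>A. fact (k l))) * (\<Prod>l\<in>A. z l ^ k l))
        = of_nat (fact v div (\<Prod>l\<in>insert a A. fact ((k(a := i)) l))) * (\<Prod>l\<in>insert a A. z l ^ (k(a := i)) l)"
        unfolding prod.insert[OF insert.hyps] upd1 upd2 fun_upd_same coef[OF i[unfolded atMost_iff] k]
        by (simp add: algebra_simps)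
    qed
    finally show "of_nat (v choose i) * z a ^ i * (\<Sum>l\<in>A. z l) ^ (v - i) = \<dots>" .
  qed
  also have "\<dots> = (\<Sum>u\<in>(SIGMA i:{..v}. multi_indices A (v - i)). case u of (i, k) \<Rightarrow>
      of_nat (fact v div (\<Prod>l\<in>insert a A. fact ((k(a := i)) l))) * (\<Prod>l\<in>insert a A. z l ^ (k(a := i)) l))"
    by (rule sum.Sigma) (auto intro: finite_multi_indices insert.hyps)
  also have "\<dots> = (\<Sum>k\<in>multi_indices (insert a A) v.
      of_nat (fact v div (\<Prod>l\<in>insert a A. fact (k l))) * (\<Prod>l\<in>insert a A. z l ^ k l))"
    by (subst sum.reindex_bij_betw[OF multi_indices_insert[OF insert.hyps], symmetric])
       (rule sum.cong, auto)
  finally show ?case .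
qed

section \<open>Roots of power series and roots of unity\<close>

lemma fps_power_nth_cong:
  assumes "\<And>i. i \<le> n \<Longrightarrow> fps_nth A i = fps_nth B i" "i \<le> n"
  shows "fps_nth (A ^ m) i = fps_nth (B ^ m) i"
  using assms(2)
proof (induction m arbitrary: i)
  case (Suc m)
  then show ?case using assms(1) by (auto simp: fps_mult_nth intro!: sum.cong)
qed simp

text \<open>First-order Taylor expansion: the change starts in degree \<open>Suc n\<close>, so it
  reaches that degree only when multiplied by \<open>m - 1\<close> constant terms.\<close>

lemma fps_power_nth_perturb:
  fixes A :: "'a::comm_ring_1 fps"
  shows "fps_nth ((A + fps_const c * fps_X ^ Suc n) ^ m) (Suc n)
    = fps_nth (A ^ m) (Suc n) + of_nat m * c * fps_nth A 0 ^ (m - 1)"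
proof (induction m)
  case (Suc m)
  let ?B = "A + fps_const c * fps_X ^ Suc n"
  have low: "fps_nth ?B i = fps_nth A i" if "i \<le> n" for i
    using that by (simp add: fps_X_power_mult_right_nth)
  have hi: "fps_nth ?B (Suc n) = fps_nth A (Suc n) + c"
    by (simp add: fps_X_power_mult_right_nth)
  have p: "fps_nth (?B ^ m) i = fps_nth (A ^ m) i" if "i \<le> n" for i
    by (rule fps_power_nth_cong[OF _ that]) (use low in auto)
  have "fps_nth (?B ^ Suc m) (Suc n) = (\<Sum>i=0..Suc n. fps_nth ?B i * fps_nth (?B ^ m) (Suc n - i))"
    by (simp add: fps_mult_nth)
  also have "\<dots> = fps_nth ?B 0 * fps_nth (?B ^ m) (Suc n)
      + (\<Sum>i=1..n. fps_nth ?B i * fps_nth (?B ^ m) (Suc n - i)) + fps_nth ?B (Suc n) * fps_nth (?B ^ m) 0"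
    by (simp add: sum.atLeast_Suc_atMost[of 0] del: power_Suc)
  also have "\<dots> = fps_nth A 0 * (fps_nth (A ^ m) (Suc n) + of_nat m * c * fps_nth A 0 ^ (m - 1))
      + (\<Sum>i=1..n. fps_nth A i * fps_nth (A ^ m) (Suc n - i)) + (fps_nth A (Suc n) + c) * fps_nth A 0 ^ m"
  proof -
    have "(\<Sum>i=1..n. fps_nth ?B i * fps_nth (?B ^ m) (Suc n - i)) = (\<Sum>i=1..n. fps_nth A i * fps_nth (A ^ m) (Suc n - i))"
    proof (rule sum.cong[OF refl])
      fix i assume "i \<in> {1..n}"
      then have "i \<le> n" "Suc n - i \<le> n" by auto
      then show "fps_nth ?B i * fps_nth (?B ^ m) (Suc n - i) = fps_nth A i * fps_nth (A ^ m) (Suc n - i)"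
        by (simp only: low p)
    qed
    then show ?thesis by (simp only: hi Suc low[of 0] p[of 0] le0 fps_power_zeroth)
  qed
  also have "\<dots> = (fps_nth A 0 * fps_nth (A ^ m) (Suc n)
      + (\<Sum>i=1..n. fps_nth A i * fps_nth (A ^ m) (Suc n - i)) + fps_nth A (Suc n) * fps_nth (A ^ m) 0)
      + of_nat (Suc m) * c * fps_nth A 0 ^ m"
    by (cases m) (auto simp: algebra_simps fps_power_zeroth)
  also have "fps_nth A 0 * fps_nth (A ^ m) (Suc n)
      + (\<Sum>i=1..n. fps_nth A i * fps_nth (A ^ m) (Suc n - i)) + fps_nth A (Suc n) * fps_nth (A ^ m) 0
      = fps_nth (A ^ Suc m) (Suc n)"
    by (simp add: fps_mult_nth sum.atLeast_Suc_atMost[of 0])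
  finally show ?case by simp
qed simp

text \<open>The coefficients of the root are found one after another, as in Hensel's lemma. Each is
  the solution of a linear equation with slope \<open>m * w ^ (m - 1)\<close>, which is
  nonzero.\<close>

lemma fps_nth_root_exists:
  fixes U :: "'a::alg_closed_field fps"
  assumes m: "of_nat m \<noteq> (0::'a)" and U: "fps_nth U 0 \<noteq> 0"
  obtains W where "W ^ m = U" "fps_nth W 0 \<noteq> 0"
proof -
  have "m > 0" using m by (cases m) auto
  then obtain w where w: "w ^ m = fps_nth U 0" using nth_root_exists by blast
  have w0: "w \<noteq> 0" using w U \<open>m > 0\<close> by (auto simp: power_0_left)
  \<comment> \<open>\<open>T n\<close> is correct through degree \<open>n\<close>; the correction is
    the error left in degree \<open>Suc n\<close>, divided by the slope. Later corrections leave
    lower coefficients alone, so the diagonal \<open>W\<close> is the limit.\<close>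
  define T where "T = rec_nat (fps_const w) (\<lambda>n A. A + fps_const
    ((fps_nth U (Suc n) - fps_nth (A ^ m) (Suc n)) / (of_nat m * w ^ (m - 1))) * fps_X ^ Suc n)"
  have T_0: "T 0 = fps_const w" by (simp add: T_def)
  have T_Suc: "T (Suc n) = T n + fps_const
    ((fps_nth U (Suc n) - fps_nth (T n ^ m) (Suc n)) / (of_nat m * w ^ (m - 1))) * fps_X ^ Suc n" for n
    by (simp add: T_def)
  have low: "fps_nth (T (Suc n)) i = fps_nth (T n) i" if "i \<le> n" for n i
    using that by (simp only: T_Suc) (simp add: fps_X_power_mult_right_nth)
  have stable: "fps_nth (T (i + d)) i = fps_nth (T i) i" for i d
    by (induction d) (use low in auto)
  have T0: "fps_nth (T n) 0 = w" for n
    using stable[of 0 n] by (simp add: T_0)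
  define W where "W = Abs_fps (\<lambda>n. fps_nth (T n) n)"
  have W: "fps_nth W i = fps_nth (T n) i" if "i \<le> n" for i n
    using stable[of i "n - i"] that by (simp add: W_def)
  have "fps_nth (W ^ m) n = fps_nth U n" for n
  proof (cases n)
    case 0
    then show ?thesis using w T0[of 0] by (simp add: fps_power_zeroth W_def)
  next
    case (Suc k)
    have "fps_nth (W ^ m) n = fps_nth (T n ^ m) n"
      by (rule fps_power_nth_cong[of n]) (use W in auto)
    also have "\<dots> = fps_nth U n"
      unfolding Suc T_Suc fps_power_nth_perturb T0 using m w0 by simp
    finally show ?thesis .
  qed
  then have "W ^ m = U" by (rule fps_ext)
  moreover have "fps_nth W 0 \<noteq> 0" using T0[of 0] w0 by (simp add: W_def)
  ultimately show ?thesis using that by blast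
qed

text \<open>The polynomial \<open>X^m - 1\<close> is separable: its derivative
  \<open>m X^(m-1)\<close> vanishes only at \<open>0\<close>, which is not a root.\<close>

lemma card_roots_of_unity:
  assumes m: "of_nat m \<noteq> (0::'a::alg_closed_field)"
  shows "card {z::'a. z ^ m = 1} = m"
proof -
  have "m > 0" using m by (cases m) auto
  define P where "P = monom (1::'a) m - 1"
  have degP: "degree P = m" and P0: "P \<noteq> 0"
  proof -
    have "degree (monom (1::'a) m + (-1)) = m"
      using \<open>m > 0\<close> by (subst degree_add_eq_left) (auto simp: degree_monom_eq)
    then show "degree P = m" by (simp add: P_def)
    then show "P \<noteq> 0" using \<open>m > 0\<close> by auto
  qed
  have polyP: "poly P z = z ^ m - 1" for z by (simp add: P_def poly_monom)
  have derP: "poly (pderiv P) z = of_nat m * z ^ (m - 1)" for z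
    by (simp add: P_def pderiv_diff pderiv_monom poly_monom)
  obtain A where A: "size A = degree P" "P = smult (lead_coeff P) (\<Prod>u\<in>#A. [:-u, 1:])"
    using alg_closed_imp_factorization[OF P0] by blast
  have set: "set_mset A = {z. z ^ m = 1}"
  proof -
    have "poly P z = 0 \<longleftrightarrow> z \<in># A" for z
      by (subst A(2)) (use P0 in \<open>auto simp: poly_prod_mset prod_mset_zero_iff\<close>)
    then show ?thesis by (auto simp: polyP)
  qed
  have "count A z = 1" if "z \<in># A" for z
  proof (rule ccontr)
    assume "count A z \<noteq> 1"
    with that have "2 \<le> count A z" using count_greater_eq_one_iff[of A z] by linarith
    then have "replicate_mset 2 z \<subseteq># A" by (simp add: count_le_replicate_mset_subset_eq)
    then obtain B where "A = replicate_mset 2 z + B" by (auto simp: subset_mset.le_iff_add)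
    then have B: "A = add_mset z (add_mset z B)" by (simp add: numeral_2_eq_2)
    have "P = [:-z, 1:] * ([:-z, 1:] * smult (lead_coeff P) (\<Prod>u\<in>#B. [:-u, 1:]))"
      by (subst A(2)) (simp add: B algebra_simps)
    then obtain R where R: "P = [:-z, 1:] * ([:-z, 1:] * R)" by blast
    have "poly (pderiv P) z = 0" unfolding R by (simp only: pderiv_mult poly_add poly_mult) simp
    then have "z = 0" using m \<open>m > 0\<close> by (auto simp: derP)
    moreover have "z ^ m = 1" using set that by auto
    ultimately show False using \<open>m > 0\<close> by (simp add: power_0_left)
  qed
  then have "size A = card (set_mset A)"
    by (simp add: size_multiset_overloaded_eq)
  then show ?thesis using A(1) degP set by simp
qed

text \<open>The \<open>s i\<close> are the coefficients of a polynomial of degree below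
  \<open>m\<close>, which can have \<open>m\<close> roots only if it is zero. This isolates the
  powers of \<open>y\<close> in a differential.\<close>

lemma roots_of_unity_separate:
  fixes s :: "nat \<Rightarrow> 'a::alg_closed_field"
  assumes m: "of_nat m \<noteq> (0::'a)"
    and z: "\<And>z. z ^ m = 1 \<Longrightarrow> (\<Sum>i<m. s i * z ^ i) = 0" and "i < m"
  shows "s i = 0"
proof -
  define P where "P = (\<Sum>i<m. monom (s i) i)"
  have polyP: "poly P z = (\<Sum>i<m. s i * z ^ i)" for z by (simp add: P_def poly_sum poly_monom)
  have c: "coeff P j = (if j < m then s j else 0)" for j
    by (simp add: P_def coeff_sum)
  have "P = 0"
  proof (rule ccontr)
    assume P: "P \<noteq> 0"
    have "m = card {z::'a. z ^ m = 1}" by (simp add: card_roots_of_unity m)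
    also have "\<dots> \<le> card {z. poly P z = 0}"
      by (rule card_mono) (use z polyP poly_roots_finite[OF P] in auto)
    also have "\<dots> \<le> degree P" by (rule card_poly_roots_bound[OF P])
    also have "\<dots> < m"
      using P c by (metis leading_coeff_0_iff)
    finally show False by simp
  qed
  then show ?thesis using c[of i] assms(3) by simp
qed

section \<open>Evaluation and function fields\<close>

text \<open>Coefficients may lie in any commutative ring, so that evaluation can be iterated:
  \<open>eval2\<close> is \<open>ev\<close> with \<open>ev\<close> as coefficient map.\<close>

definition ev :: "('a::comm_ring_1 \<Rightarrow> 'b::comm_ring_1) \<Rightarrow> 'b \<Rightarrow> 'a poly \<Rightarrow> 'b" where
  "ev h x q = poly (map_poly h q) x"

lemma comm_ring_hom_ev:
  assumes "comm_ring_hom h"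
  shows "comm_ring_hom (ev h x)"
proof -
  interpret h: comm_ring_hom h by fact
  interpret mp: map_poly_comm_ring_hom h ..
  show ?thesis
    by unfold_locales (auto simp: ev_def mp.hom_add mp.hom_mult)
qed

lemma ev_pCons: "comm_ring_hom h \<Longrightarrow> ev h x (pCons c q) = h c + x * ev h x q"
proof -
  assume "comm_ring_hom h"
  then interpret h: comm_ring_hom h .
  show ?thesis by (simp add: ev_def h.map_poly_pCons_hom)
qed

lemma ev_0 [simp]: "ev h x 0 = 0" by (simp add: ev_def)

lemma ev_1:
  assumes "comm_ring_hom h"
  shows "ev h x 1 = 1"
proof -
  interpret e: comm_ring_hom "ev h x" by (rule comm_ring_hom_ev[OF assms])
  show ?thesis by simp
qed

lemma ev_const: "comm_ring_hom h \<Longrightarrow> ev h x [:c:] = h c"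
  by (simp add: ev_pCons)

lemma ev_monom:
  assumes "comm_ring_hom h"
  shows "ev h x (monom c n) = h c * x ^ n"
proof -
  interpret h: comm_ring_hom h by fact
  show ?thesis by (induction n) (simp_all add: monom_0 monom_Suc ev_pCons[OF assms] mult_ac)
qed

lemma ev_altdef:
  assumes "comm_ring_hom h"
  shows "ev h x q = (\<Sum>i\<le>degree q. h (coeff q i) * x ^ i)"
proof -
  interpret e: comm_ring_hom "ev h x" by (rule comm_ring_hom_ev[OF assms])
  have "ev h x q = ev h x (\<Sum>i\<le>degree q. monom (coeff q i) i)" by (simp add: poly_as_sum_of_monoms)
  also have "\<dots> = (\<Sum>i\<le>degree q. h (coeff q i) * x ^ i)"
    by (simp add: e.hom_sum ev_monom[OF assms])
  finally show ?thesis .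
qed

lemma ev_altdef':
  assumes "comm_ring_hom h" "degree q < n"
  shows "ev h x q = (\<Sum>i<n. h (coeff q i) * x ^ i)"
proof -
  interpret h: comm_ring_hom h by fact
  show ?thesis
    unfolding ev_altdef[OF assms(1)]
    by (rule sum.mono_neutral_left) (use assms(2) in \<open>auto simp: coeff_eq_0\<close>)
qed

lemma ev_comp:
  assumes "comm_ring_hom h" "comm_ring_hom g" "comm_ring_hom k" "\<And>c. g (h c) = k c"
  shows "g (ev h x q) = ev k (g x) q"
proof -
  interpret g: comm_ring_hom g by fact
  show ?thesis
    by (induction q) (simp_all add: ev_pCons[OF assms(1)] ev_pCons[OF assms(3)] g.hom_add g.hom_mult assms(4))
qed

section \<open>Evaluation in two variables\<close>

lemma eval2_ev: "eval2 h x y P = ev (ev h x) y P"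
  by (simp add: eval2_def ev_def[abs_def])

lemma field_hom_comm_ring_hom: "field_hom h \<Longrightarrow> comm_ring_hom h"
  by (simp add: field_hom_def idom_hom_def)

lemma comm_ring_hom_eval2: "comm_ring_hom h \<Longrightarrow> comm_ring_hom (eval2 h x y)"
  unfolding eval2_ev[abs_def] by (intro comm_ring_hom_ev)

lemma eval2_const: "comm_ring_hom h \<Longrightarrow> eval2 h x y [:q:] = ev h x q"
  by (simp add: eval2_ev ev_const comm_ring_hom_ev)

lemma eval2_pCons: "comm_ring_hom h \<Longrightarrow> eval2 h x y (pCons q P) = ev h x q + y * eval2 h x y P"
  by (simp add: eval2_ev ev_pCons comm_ring_hom_ev)

lemma eval2_monom: "comm_ring_hom h \<Longrightarrow> eval2 h x y (monom q n) = ev h x q * y ^ n"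
  by (simp add: eval2_ev ev_monom comm_ring_hom_ev)

text \<open>Euclid's algorithm with denominators cleared by pseudo-division: an element of least
  degree in the ideal of \<open>F\<close> and \<open>Q\<close> divides every element of it up to a
  nonzero constant, and primality of \<open>F\<close> forces its degree to be
  \<open>0\<close>.\<close>

lemma prime_poly_elimination:
  fixes F Q :: "'a::idom poly"
  assumes F: "prime_elem F" "degree F > 0" and Q: "\<not> F dvd Q"
  obtains A B r where "r \<noteq> 0" "A * F + B * Q = [:r:]"
proof -
  define I where "I = {G. G \<noteq> 0 \<and> (\<exists>A B. G = A * F + B * Q)}"
  have comb: "\<exists>A B. u * (A1 * F + B1 * Q) - w * (A2 * F + B2 * Q) = A * F + B * Q" for u w A1 B1 A2 B2
    by (rule exI[of _ "u * A1 - w * A2"], rule exI[of _ "u * B1 - w * B2"]) (simp add: algebra_simps)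
  have selfF: "\<exists>A B. F = A * F + B * Q" by (rule exI[of _ 1], rule exI[of _ 0]) simp
  have selfQ: "\<exists>A B. Q = A * F + B * Q" by (rule exI[of _ 0], rule exI[of _ 1]) simp
  have F0: "F \<noteq> 0" using F(2) by auto
  have "F \<in> I" using selfF F0 unfolding I_def by blast
  then obtain G where G: "G \<in> I" and min: "\<And>H. H \<in> I \<Longrightarrow> degree G \<le> degree H"
    using ex_has_least_nat[of "\<lambda>G. G \<in> I" F degree] by blast
  have G0: "G \<noteq> 0" using G by (simp add: I_def)
  have div: "\<exists>u q. u \<noteq> 0 \<and> smult u H = G * q" if H: "\<exists>A B. H = A * F + B * Q" for H
  proof -
    obtain u q where u: "u \<noteq> 0" "smult u H = G * q + pseudo_mod H G"
      using pseudo_mod(1)[OF G0, of H] by blast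
    have "\<exists>A B. pseudo_mod H G = A * F + B * Q"
    proof -
      obtain A1 B1 A2 B2 where *: "H = A1 * F + B1 * Q" "G = A2 * F + B2 * Q"
        using H G by (auto simp: I_def)
      have "pseudo_mod H G = [:u:] * H - q * G" using u(2) by (simp add: algebra_simps)
      then show ?thesis using comb[of "[:u:]" A1 B1 q A2 B2] unfolding *[symmetric] by simp
    qed
    then have "pseudo_mod H G \<noteq> 0 \<Longrightarrow> pseudo_mod H G \<in> I" unfolding I_def by blast
    then have "pseudo_mod H G = 0"
      using min[of "pseudo_mod H G"] pseudo_mod(2)[OF G0, of H] by linarith
    then show ?thesis using u by auto
  qed
  have nF: "\<not> F dvd [:u:]" if "u \<noteq> 0" for u
    using that F(2) dvd_imp_degree_le[of F "[:u:]"] by auto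
  have "degree G = 0"
  proof (rule ccontr)
    assume dG: "degree G \<noteq> 0"
    obtain u q where u: "u \<noteq> 0" "smult u F = G * q"
      using div[OF selfF] by blast
    have "F dvd G * q" using u(2) by (metis dvd_smult dvd_refl)
    \<comment> \<open>If \<open>F\<close> divides \<open>G\<close>, it divides a constant multiple
      of \<open>Q\<close>, which is excluded. If it divides \<open>q\<close>, cancelling
      \<open>F\<close> shows that \<open>G\<close> divides a nonzero constant.\<close>
    then consider "F dvd G" | "F dvd q" using F(1) by (auto simp: prime_elem_dvd_mult_iff)
    then show False
    proof cases
      case 1
      obtain w q' where w: "w \<noteq> 0" "smult w Q = G * q'"
        using div[OF selfQ] by blast
      have "F dvd [:w:] * Q" using 1 w(2) by simp
      then show False using nF[OF w(1)] Q unfolding prime_elem_dvd_mult_iff[OF F(1)] by blast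
    next
      case 2
      then obtain q'' where "q = F * q''" by (rule dvdE)
      then have "F * [:u:] = F * (G * q'')" using u(2) by (simp add: algebra_simps)
      then have *: "[:u:] = G * q''" using mult_left_cancel[OF F0] by blast
      then have "q'' \<noteq> 0" using u(1) by auto
      then have "degree [:u:] = degree G + degree q''" unfolding * using G0 by (rule degree_mult_eq[rotated])
      then show False using dG by simp
    qed
  qed
  then obtain r where r: "G = [:r:]" by (rule degree_eq_zeroE)
  then have "r \<noteq> 0" using G0 by auto
  moreover obtain A B where "A * F + B * Q = [:r:]" using G r by (auto simp: I_def)
  ultimately show ?thesis using that by blast
qed

lemma function_field_induct:
  assumes K: "is_function_field F \<iota> x y"
    and gen: "\<And>c. S (\<iota> c)" "S x" "S y"
    and cl: "\<And>z w. S z \<Longrightarrow> S w \<Longrightarrow> S (z + w)" "\<And>z w. S z \<Longrightarrow> S w \<Longrightarrow> S (z * w)" "\<And>z. S z \<Longrightarrow> S (inverse z)"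
  shows "S z"
proof -
  have h: "comm_ring_hom \<iota>" using K by (simp add: is_function_field_def field_hom_comm_ring_hom)
  interpret h: comm_ring_hom \<iota> by fact
  have S0: "S 0" using gen(1)[of 0] by simp
  have 1: "S (ev \<iota> x q)" for q
    by (induction q) (auto simp: S0 ev_pCons[OF h] intro: gen cl)
  have 2: "S (eval2 \<iota> x y P)" for P
    by (induction P) (auto simp: S0 eval2_pCons[OF h] eval2_ev[of _ _ _ 0] intro: gen cl 1)
  obtain P Q where "z = eval2 \<iota> x y P / eval2 \<iota> x y Q"
    using K unfolding is_function_field_def by blast
  then show ?thesis by (auto simp: divide_inverse intro: cl 2)
qed

text \<open>Transcendence of \<open>X0\<close> is what makes the extension well defined: by elimination, a nonzero
  element of \<open>k[x,y]/(F)\<close> divides a nonzero element of \<open>k[x]\<close>.\<close>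

lemma function_field_hom_exists:
  fixes \<iota> :: "'k::field_gcd \<Rightarrow> 'K::field" and \<kappa> :: "'k \<Rightarrow> 'L::field"
  assumes K: "is_function_field F \<iota> x y"
    and F: "irreducible F" "degree F > 0"
    and \<kappa>: "comm_ring_hom \<kappa>" and XY: "eval2 \<kappa> X0 Y0 F = 0"
    and X0: "\<And>r. r \<noteq> 0 \<Longrightarrow> ev \<kappa> X0 r \<noteq> 0"
  obtains \<phi> where "field_hom \<phi>" "\<phi> x = X0" "\<phi> y = Y0" "\<And>c. \<phi> (\<iota> c) = \<kappa> c"
proof -
  have h: "comm_ring_hom \<iota>" and K0: "\<And>P. eval2 \<iota> x y P = 0 \<longleftrightarrow> F dvd P"
    and frac: "\<And>z. \<exists>P Q. eval2 \<iota> x y Q \<noteq> 0 \<and> z = eval2 \<iota> x y P / eval2 \<iota> x y Q"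
    using K unfolding is_function_field_def by (blast intro: field_hom_comm_ring_hom)+
  interpret e: comm_ring_hom "eval2 \<iota> x y" by (rule comm_ring_hom_eval2[OF h])
  interpret h: comm_ring_hom \<iota> by fact
  interpret \<kappa>: comm_ring_hom \<kappa> by fact
  interpret E: comm_ring_hom "eval2 \<kappa> X0 Y0" by (rule comm_ring_hom_eval2[OF \<kappa>])
  have iff: "eval2 \<kappa> X0 Y0 P = 0 \<longleftrightarrow> eval2 \<iota> x y P = 0" for P
  proof (cases "F dvd P")
    case True
    then have "eval2 \<kappa> X0 Y0 P = 0" using XY by (auto simp: E.hom_mult)
    with True K0 show ?thesis by simp
  next
    case False
    have "prime_elem F" using F(1) by (rule irreducible_imp_prime_elem_gcd)
    then obtain A B r where r: "r \<noteq> 0" "A * F + B * P = [:r:]"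
      by (rule prime_poly_elimination[OF _ F(2) False])
    have "eval2 \<kappa> X0 Y0 B * eval2 \<kappa> X0 Y0 P = ev \<kappa> X0 r"
      using arg_cong[OF r(2), of "eval2 \<kappa> X0 Y0"] XY by (simp add: E.hom_add E.hom_mult eval2_const[OF \<kappa>])
    then have "eval2 \<kappa> X0 Y0 P \<noteq> 0" using X0[OF r(1)] by auto
    with False K0 show ?thesis by simp
  qed
  define rep where "rep z PQ \<longleftrightarrow> (case PQ of (P, Q) \<Rightarrow> eval2 \<iota> x y Q \<noteq> 0 \<and> z = eval2 \<iota> x y P / eval2 \<iota> x y Q)" for z PQ
  define \<phi> where "\<phi> z = (case SOME PQ. rep z PQ of (P, Q) \<Rightarrow> eval2 \<kappa> X0 Y0 P / eval2 \<kappa> X0 Y0 Q)" for z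
  have \<phi>: "\<phi> z = eval2 \<kappa> X0 Y0 P / eval2 \<kappa> X0 Y0 Q" if "rep z (P, Q)" for z P Q
  proof -
    obtain P' Q' where PQ': "(SOME PQ. rep z PQ) = (P', Q')" by (cases "SOME PQ. rep z PQ")
    have "rep z (P', Q')" using someI[of "rep z", OF that] PQ' by simp
    then have "eval2 \<iota> x y (P * Q' - P' * Q) = 0"
      using that by (auto simp: rep_def e.hom_minus e.hom_mult field_simps)
    then have "eval2 \<kappa> X0 Y0 P * eval2 \<kappa> X0 Y0 Q' = eval2 \<kappa> X0 Y0 P' * eval2 \<kappa> X0 Y0 Q"
      unfolding iff[symmetric] by (simp add: E.hom_minus E.hom_mult)
    moreover have "eval2 \<kappa> X0 Y0 Q \<noteq> 0" "eval2 \<kappa> X0 Y0 Q' \<noteq> 0"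
      using that \<open>rep z (P', Q')\<close> by (auto simp: rep_def iff)
    ultimately show ?thesis by (simp add: \<phi>_def PQ' field_simps)
  qed
  have \<phi>e: "\<phi> (eval2 \<iota> x y P) = eval2 \<kappa> X0 Y0 P" for P
    using \<phi>[of _ P 1] by (simp add: rep_def)
  have hom: "\<phi> (z + w) = \<phi> z + \<phi> w \<and> \<phi> (z * w) = \<phi> z * \<phi> w" for z w
  proof -
    obtain P Q where 1: "rep z (P, Q)" using frac[of z] by (auto simp: rep_def)
    obtain P' Q' where 2: "rep w (P', Q')" using frac[of w] by (auto simp: rep_def)
    have 3: "rep (z + w) (P * Q' + P' * Q, Q * Q')" "rep (z * w) (P * P', Q * Q')"
      using 1 2 by (auto simp: rep_def e.hom_add e.hom_mult field_simps)
    have "eval2 \<kappa> X0 Y0 Q \<noteq> 0" "eval2 \<kappa> X0 Y0 Q' \<noteq> 0"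
      using 1 2 by (auto simp: rep_def iff)
    then show ?thesis
      unfolding \<phi>[OF 1] \<phi>[OF 2] \<phi>[OF 3(1)] \<phi>[OF 3(2)] by (simp add: E.hom_add E.hom_mult field_simps)
  qed
  have "field_hom \<phi>"
  proof unfold_locales
    show "\<phi> 0 = 0" using \<phi>e[of 0] by simp
    show "\<phi> 1 = 1" using \<phi>e[of 1] by simp
  qed (use hom in auto)
  moreover have "\<phi> x = X0" using \<phi>e[of "[:[:0, 1:]:]"] by (simp add: eval2_const h \<kappa> ev_pCons h.hom_zero h.hom_one \<kappa>.hom_zero \<kappa>.hom_one)
  moreover have "\<phi> y = Y0" using \<phi>e[of "[:0, 1:]"] by (simp add: eval2_pCons h \<kappa> ev_pCons ev_1 e.hom_zero E.hom_zero \<kappa>.hom_zero h.hom_zero h.hom_one \<kappa>.hom_one)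
  moreover have "\<phi> (\<iota> c) = \<kappa> c" for c using \<phi>e[of "[:[:c:]:]"] by (simp add: eval2_const h \<kappa> ev_const)
  ultimately show ?thesis using that by blast
qed

text \<open>Elimination makes the denominator a divisor of an element of \<open>k[x]\<close>, and
  pseudo-division by \<open>F\<close> lowers the degree of the numerator in \<open>y\<close>. The
  multiplier \<open>u\<close> of the pseudo-division joins the denominator.\<close>

lemma function_field_repr:
  fixes \<iota> :: "'k::field_gcd \<Rightarrow> 'K::field"
  assumes K: "is_function_field F \<iota> x y" and F: "irreducible F" "degree F > 0"
  obtains P r where "degree P < degree F" "r \<noteq> 0" "ev \<iota> x r \<noteq> 0" "z = eval2 \<iota> x y P / ev \<iota> x r"
proof -
  have h: "comm_ring_hom \<iota>" and K0: "\<And>P. eval2 \<iota> x y P = 0 \<longleftrightarrow> F dvd P"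
    and frac: "\<And>z. \<exists>P Q. eval2 \<iota> x y Q \<noteq> 0 \<and> z = eval2 \<iota> x y P / eval2 \<iota> x y Q"
    using K unfolding is_function_field_def by (blast intro: field_hom_comm_ring_hom)+
  interpret e: comm_ring_hom "eval2 \<iota> x y" by (rule comm_ring_hom_eval2[OF h])
  interpret ex: comm_ring_hom "ev \<iota> x" by (rule comm_ring_hom_ev[OF h])
  have const: "ev \<iota> x r \<noteq> 0" if "r \<noteq> 0" for r
    using that F(2) dvd_imp_degree_le[of F "[:r:]"] K0[of "[:r:]"] by (auto simp: eval2_const[OF h])
  have F0: "eval2 \<iota> x y F = 0" by (simp add: K0)
  obtain P Q where PQ: "eval2 \<iota> x y Q \<noteq> 0" "z = eval2 \<iota> x y P / eval2 \<iota> x y Q"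
    using frac by blast
  have "\<not> F dvd Q" using PQ(1) K0 by simp
  then obtain A B r where r: "r \<noteq> 0" "A * F + B * Q = [:r:]"
    by (rule prime_poly_elimination[OF irreducible_imp_prime_elem_gcd[OF F(1)] F(2)])
  have rQ: "ev \<iota> x r = eval2 \<iota> x y B * eval2 \<iota> x y Q"
    using arg_cong[OF r(2), of "eval2 \<iota> x y"] F0 by (simp add: e.hom_add e.hom_mult eval2_const[OF h])
  have Fn0: "F \<noteq> 0" using F(2) by auto
  obtain u q where u: "u \<noteq> 0" "smult u (P * B) = F * q + pseudo_mod (P * B) F"
    using pseudo_mod(1)[OF Fn0] by blast
  have "ev \<iota> x u * (eval2 \<iota> x y P * eval2 \<iota> x y B) = eval2 \<iota> x y ([:u:] * (P * B))"
    by (simp only: e.hom_mult eval2_const[OF h])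
  also have "\<dots> = eval2 \<iota> x y (pseudo_mod (P * B) F)"
    using u(2) F0 by (simp add: e.hom_add e.hom_mult)
  finally have *: "ev \<iota> x u * (eval2 \<iota> x y P * eval2 \<iota> x y B) = eval2 \<iota> x y (pseudo_mod (P * B) F)" .
  have "z = eval2 \<iota> x y (pseudo_mod (P * B) F) / ev \<iota> x (u * r)"
  proof -
    have "eval2 \<iota> x y B \<noteq> 0" using const[OF r(1)] rQ by auto
    then have "z = ev \<iota> x u * (eval2 \<iota> x y P * eval2 \<iota> x y B) / (ev \<iota> x u * (eval2 \<iota> x y B * eval2 \<iota> x y Q))"
      using PQ const[OF u(1)] by simp
    then show ?thesis using * by (simp only: ex.hom_mult rQ)
  qed
  moreover have "degree (pseudo_mod (P * B) F) < degree F"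
    using pseudo_mod(2)[OF Fn0, of "P * B"] F(2) by auto
  moreover have "u * r \<noteq> 0" using u(1) r(1) by simp
  ultimately show ?thesis using that const by blast
qed

section \<open>Derivations, characteristic \<open>p\<close> and places\<close>

lemma derivation_power:
  assumes "is_derivation \<iota> D"
  shows "D (u ^ n) = of_nat n * u ^ (n - 1) * D u"
proof -
  have m: "D (z * w) = z * D w + w * D z" for z w using assms by (simp add: is_derivation_def)
  have "D 1 = 0" using m[of 1 1] by (simp only: mult_1_left add_cancel_right_right)
  then show ?thesis
  proof (induction n)
    case (Suc n)
    then show ?case by (cases n) (simp_all add: m algebra_simps)
  qed simp
qed

lemma derivation_sum:
  assumes "is_derivation \<iota> D"
  shows "D (\<Sum>i\<in>A. z i) = (\<Sum>i\<in>A. D (z i))"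
proof -
  have a: "D (z + w) = D z + D w" for z w using assms by (simp add: is_derivation_def)
  have "D 0 = 0" using a[of 0 0] by (simp only: add_0_left add_cancel_right_right)
  then show ?thesis by (induction A rule: infinite_finite_induct) (simp_all add: a)
qed


lemma derivation_inverse:
  assumes "is_derivation \<iota> D" "z \<noteq> 0"
  shows "D (inverse z) = - (D z * inverse z ^ 2)"
proof -
  have "D 1 = 0" using derivation_power[OF assms(1), of 1 0] by simp
  then have "D (z * inverse z) = 0" using assms(2) by simp
  then have "z * D (inverse z) + inverse z * D z = 0" using assms(1) by (simp add: is_derivation_def)
  moreover have "z * (D z * inverse z ^ 2) = inverse z * D z"
    using assms(2) by (simp add: power2_eq_square)
  ultimately have "z * D (inverse z) = z * (- (D z * inverse z ^ 2))"
    by (simp only: mult_minus_right eq_neg_iff_add_eq_0)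
  then show ?thesis using assms(2) by (simp only: mult_left_cancel[OF assms(2)])
qed

lemma derivation_ev:
  assumes "is_derivation \<iota> D" "comm_ring_hom \<iota>"
  shows "D (ev \<iota> x q) = ev \<iota> x (pderiv q) * D x"
proof -
  interpret h: comm_ring_hom \<iota> by fact
  interpret e: comm_ring_hom "ev \<iota> x" by (rule comm_ring_hom_ev[OF assms(2)])
  have "D 0 = 0" using derivation_sum[OF assms(1), of "\<lambda>_. 0" "{}"] by simp
  then show ?thesis
    using assms(1) by (induction q)
      (simp_all add: ev_pCons[OF assms(2)] is_derivation_def pderiv_pCons e.hom_add algebra_simps)
qed

section \<open>Frobenius and linear algebra over \<open>K\<^sup>p\<close>\<close>

locale char_p_field =
  fixes p :: nat and ty :: "'K::field itself"
  assumes prime_p: "prime p" and CHAR_p: "CHAR('K) = p"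
begin

lemma frob_add: "((z::'K) + w) ^ p = z ^ p + w ^ p"
  by (rule freshmans_dream) (simp_all add: prime_p CHAR_p)

lemma frob_sum: "(\<Sum>i\<in>A. (z i::'K)) ^ p = (\<Sum>i\<in>A. z i ^ p)"
  by (rule freshmans_dream_sum) (simp_all add: prime_p CHAR_p)

lemma p_pos: "p > 0" using prime_p by (rule prime_gt_0_nat)

lemma frob_uminus: "(- (z::'K)) ^ p = - (z ^ p)"
proof -
  have "z ^ p + (- z) ^ p = 0" using frob_add[of z "-z"] p_pos by (simp add: power_0_left)
  then show ?thesis by (metis add_eq_0_iff)
qed

lemma frob_diff: "((z::'K) - w) ^ p = z ^ p - w ^ p"
  using frob_add[of z "-w"] by (simp add: frob_uminus)

lemma frob_of_nat: "(of_nat n :: 'K) ^ p = of_nat n"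
  by (induction n) (use p_pos in \<open>simp_all add: frob_add\<close>)

lemma of_nat_nonzero: "0 < n \<Longrightarrow> n < p \<Longrightarrow> (of_nat n :: 'K) \<noteq> 0"
  using CHAR_p by (auto simp: of_nat_eq_0_iff_char_dvd dest: dvd_imp_le)

text \<open>This is \<open>K\<close> as a vector space over \<open>K\<^sup>p\<close>, the latter
  being identified with \<open>K\<close> through the Frobenius map.\<close>

sublocale V: vector_space "\<lambda>(c::'K) z. c ^ p * z"
  by unfold_locales (simp_all add: algebra_simps frob_add power_mult_distrib)

definition powers :: "'K \<Rightarrow> 'K set" where "powers t = (\<lambda>n. t ^ n) ` {..<p}"

lemma power_in_span: "t ^ n \<in> V.span (powers t)"
proof -
  have "t ^ (n mod p) \<in> V.span (powers t)"
    using p_pos by (intro V.span_base) (auto simp: powers_def)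
  then have "(t ^ (n div p)) ^ p * t ^ (n mod p) \<in> V.span (powers t)"
    by (rule V.span_scale)
  then show ?thesis by (simp flip: power_mult power_add)
qed

text \<open>Together with \<open>span_inverse\<close> this makes the span a subfield of
  \<open>K\<close>; to see that it is all of \<open>K\<close>, it suffices to find generators in
  it.\<close>

lemma span_mult:
  assumes z: "z \<in> V.span (powers t)" and w: "w \<in> V.span (powers t)"
  shows "z * w \<in> V.span (powers t)"
proof -
  have 1: "t ^ n * w \<in> V.span (powers t)" for n
    using w
  proof (induction rule: V.span_induct_alt)
    case (step c b y)
    then obtain m where m: "b = t ^ m" by (auto simp: powers_def)
    have "c ^ p * t ^ (n + m) + t ^ n * y \<in> V.span (powers t)"
      using step by (intro V.span_add V.span_scale power_in_span)
    then show ?case by (simp add: m algebra_simps power_add)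
  qed (simp add: V.span_zero)
  show ?thesis using z
  proof (induction rule: V.span_induct_alt)
    case (step c b y)
    then obtain m where m: "b = t ^ m" by (auto simp: powers_def)
    have "c ^ p * (t ^ m * w) + y * w \<in> V.span (powers t)"
      using step 1 by (intro V.span_add V.span_scale)
    then show ?case by (simp add: m algebra_simps)
  qed (simp add: V.span_zero)
qed

lemma frob_in_span: "u ^ p \<in> V.span (powers t)"
  using V.span_scale[OF power_in_span[of t 0], of u] by simp

text \<open>The inverse of \<open>z\<close> is \<open>(1/z)^p z^(p-1)\<close>, a scalar multiple of
  a power of \<open>z\<close>.\<close>

lemma span_inverse:
  assumes "z \<in> V.span (powers t)"
  shows "inverse z \<in> V.span (powers t)"
proof (cases "z = 0")
  case False
  have "z ^ n \<in> V.span (powers t)" for n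
    by (induction n) (use power_in_span[of t 0] span_mult assms in auto)
  then have "(inverse z) ^ p * z ^ (p - 1) \<in> V.span (powers t)" by (rule V.span_scale)
  moreover have "(inverse z) ^ p * z ^ (p - 1) = inverse z"
    using False p_pos by (cases p) (simp_all add: power_inverse)
  ultimately show ?thesis by simp
qed (simp add: V.span_zero)

lemma frob_derivation:
  assumes "is_derivation \<iota> D"
  shows "D ((u::'K) ^ p) = 0"
  by (simp add: derivation_power[OF assms] flip: CHAR_p)

lemma derivation_frob_mult:
  assumes "is_derivation \<iota> (D :: 'K \<Rightarrow> 'K)"
  shows "D (u ^ p * t ^ n) = D t * (of_nat n * u ^ p * t ^ (n - 1))"
proof -
  have m: "D (z * w) = z * D w + w * D z" for z w using assms by (simp add: is_derivation_def)
  show ?thesis by (simp only: m frob_derivation[OF assms]) (simp add: derivation_power[OF assms] mult_ac)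
qed

text \<open>Differentiating a relation removes the term with \<open>n = 0\<close> and multiplies the
  others by \<open>n\<close>, which is invertible for \<open>0 < n < p\<close> and, being fixed by
  Frobenius, can be moved into the \<open>p\<close>-th power. The shorter relation falls under the
  induction hypothesis.\<close>

lemma frob_powers_independent:
  assumes D: "is_derivation \<iota> (D :: 'K \<Rightarrow> 'K)" "D x = 1"
    and "m \<le> p" "(\<Sum>n<m. u n ^ p * x ^ n) = 0" "n < m"
  shows "u n = 0"
  using assms(3-)
proof (induction m arbitrary: u n)
  case (Suc m)
  have D0: "D 0 = 0" using derivation_sum[OF D(1), of "\<lambda>_. 0" "{}"] by simp
  have "0 = D (\<Sum>n<Suc m. u n ^ p * x ^ n)" by (simp add: Suc.prems D0 del: sum.lessThan_Suc)
  also have "\<dots> = (\<Sum>n<Suc m. of_nat n * u n ^ p * x ^ (n - 1))"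
    by (simp add: derivation_sum[OF D(1)] derivation_frob_mult[OF D(1)] D(2) del: sum.lessThan_Suc)
  also have "\<dots> = (\<Sum>n<m. of_nat (Suc n) * u (Suc n) ^ p * x ^ n)"
    by (subst sum.lessThan_Suc_shift) simp
  also have "\<dots> = (\<Sum>n<m. (of_nat (Suc n) * u (Suc n)) ^ p * x ^ n)"
    by (simp add: power_mult_distrib frob_of_nat del: of_nat_Suc)
  finally have z: "(\<Sum>n<m. (of_nat (Suc n) * u (Suc n)) ^ p * x ^ n) = 0" by simp
  have S: "u (Suc n) = 0" if "n < m" for n
    using Suc.IH[OF _ z that] Suc.prems(1) that of_nat_nonzero[of "Suc n"] by (simp del: of_nat_Suc)
  moreover have "u 0 = 0"
  proof -
    have "(\<Sum>n<Suc m. u n ^ p * x ^ n) = u 0 ^ p"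
      by (subst sum.lessThan_Suc_shift) (use S p_pos in \<open>simp add: power_0_left\<close>)
    then show ?thesis using Suc.prems by simp
  qed
  ultimately show ?case using Suc.prems(3) by (cases n) auto
qed simp

text \<open>Independence of the powers of \<open>x\<close> makes the definite description in
  \<open>cartier\<close> meaningful, so any expansion of \<open>h\<close> computes it.\<close>

lemma cartier_eq:
  assumes D: "is_derivation \<iota> (D :: 'K \<Rightarrow> 'K)" "D x = 1" and h: "h = (\<Sum>n<p. u n ^ p * x ^ n)"
  shows "cartier p x h = u (p - 1)"
  unfolding cartier_def
proof (rule the_equality)
  show "\<exists>w. h = (\<Sum>n<p. w n ^ p * x ^ n) \<and> u (p - 1) = w (p - 1)" using h by blast
next
  fix c assume "\<exists>w. h = (\<Sum>n<p. w n ^ p * x ^ n) \<and> c = w (p - 1)"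
  then obtain w where w: "h = (\<Sum>n<p. w n ^ p * x ^ n)" "c = w (p - 1)" by blast
  have "(\<Sum>n<p. (w n - u n) ^ p * x ^ n) = 0"
    using w(1) h by (simp add: frob_diff algebra_simps sum_subtractf)
  then have "w (p - 1) - u (p - 1) = 0"
    by (rule frob_powers_independent[OF D order_refl]) (use p_pos in simp)
  then show "c = u (p - 1)" using w(2) by simp
qed

end

section \<open>Arithmetic of a valuation\<close>

locale place =
  fixes \<iota> :: "'k::field \<Rightarrow> 'K::field" and v :: "'K \<Rightarrow> int"
  assumes hom: "field_hom \<iota>" and place: "is_place \<iota> v"
begin

lemma v_mult: "z \<noteq> 0 \<Longrightarrow> w \<noteq> 0 \<Longrightarrow> v (z * w) = v z + v w"
  and v_add: "z \<noteq> 0 \<Longrightarrow> w \<noteq> 0 \<Longrightarrow> z + w \<noteq> 0 \<Longrightarrow> min (v z) (v w) \<le> v (z + w)"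
  and v_const: "c \<noteq> 0 \<Longrightarrow> v (\<iota> c) = 0"
  using place unfolding is_place_def by blast+

lemma v_1 [simp]: "v 1 = 0" using v_mult[of 1 1] by simp

lemma v_power: "z \<noteq> 0 \<Longrightarrow> v (z ^ n) = int n * v z"
  by (induction n) (simp_all add: v_mult algebra_simps)

lemma v_inverse: "z \<noteq> 0 \<Longrightarrow> v (inverse z) = - v z"
  using v_mult[of z "inverse z"] by simp

lemma v_divide: "z \<noteq> 0 \<Longrightarrow> w \<noteq> 0 \<Longrightarrow> v (z / w) = v z - v w"
  by (simp add: divide_inverse v_mult v_inverse)

lemma v_minus: "v (- z) = v z" if "z \<noteq> 0"
proof -
  have "2 * v (-1) = 0" using v_mult[of "-1" "-1"] by simp
  then show ?thesis using v_mult[of "-1" z] that by simp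
qed

text \<open>The alternative \<open>= 0\<close> stands for the valuation \<infinity>, because
  \<open>v 0\<close> carries no information.\<close>

lemma v_sum_ge:
  assumes "finite A" "\<And>n. n \<in> A \<Longrightarrow> w n = 0 \<or> N \<le> v (w n)"
  shows "(\<Sum>n\<in>A. w n) = 0 \<or> N \<le> v (\<Sum>n\<in>A. w n)"
  using assms
proof (induction A)
  case (insert a A)
  have 1: "w a = 0 \<or> N \<le> v (w a)" and 2: "(\<Sum>n\<in>A. w n) = 0 \<or> N \<le> v (\<Sum>n\<in>A. w n)"
    using insert by auto
  show ?case
  proof (cases "w a = 0 \<or> (\<Sum>n\<in>A. w n) = 0 \<or> w a + (\<Sum>n\<in>A. w n) = 0")
    case True then show ?thesis using 1 2 insert.hyps by auto
  next
    case False then show ?thesis using 1 2 insert.hyps v_add[of "w a" "\<Sum>n\<in>A. w n"] by auto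
  qed
qed simp

lemma v_add_less:
  assumes "z \<noteq> 0" "w \<noteq> 0" "v z < v w"
  shows "z + w \<noteq> 0" "v (z + w) = v z"
proof -
  show nz: "z + w \<noteq> 0"
  proof
    assume "z + w = 0"
    then have "w = - z" by (simp add: eq_neg_iff_add_eq_0 add.commute)
    then show False using assms v_minus by simp
  qed
  have "min (v (z + w)) (v (- w)) \<le> v z" using v_add[of "z + w" "-w"] nz assms by simp
  moreover have "min (v z) (v w) \<le> v (z + w)" using v_add[OF assms(1,2) nz] .
  ultimately show "v (z + w) = v z" using assms v_minus[of w] by simp
qed

text \<open>Terms of distinct valuation cannot cancel. The last two conjuncts together say that the
  valuation of the sum is the minimum over the nonzero terms.\<close>

lemma v_sum_distinct:
  assumes "finite A" "\<And>n m. n \<in> A \<Longrightarrow> m \<in> A \<Longrightarrow> n \<noteq> m \<Longrightarrow> w n \<noteq> 0 \<Longrightarrow> w m \<noteq> 0 \<Longrightarrow> v (w n) \<noteq> v (w m)"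
    and "\<exists>n\<in>A. w n \<noteq> 0"
  shows "(\<Sum>n\<in>A. w n) \<noteq> 0 \<and> (\<exists>n\<in>A. w n \<noteq> 0 \<and> v (\<Sum>n\<in>A. w n) = v (w n)) \<and> (\<forall>n\<in>A. w n \<noteq> 0 \<longrightarrow> v (\<Sum>n\<in>A. w n) \<le> v (w n))"
  using assms
proof (induction A)
  case (insert a A)
  let ?s = "\<Sum>n\<in>A. w n"
  show ?case
  proof (cases "\<exists>n\<in>A. w n \<noteq> 0")
    case False
    then have "?s = 0" by (intro sum.neutral) auto
    then show ?thesis using insert False by auto
  next
    case True
    then have IH: "?s \<noteq> 0" "\<exists>n\<in>A. w n \<noteq> 0 \<and> v ?s = v (w n)" "\<And>n. n \<in> A \<Longrightarrow> w n \<noteq> 0 \<Longrightarrow> v ?s \<le> v (w n)"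
      using insert.IH insert.prems by auto
    show ?thesis
    proof (cases "w a = 0")
      case True
      then show ?thesis using IH insert.hyps by auto
    next
      case False
      obtain m where m: "m \<in> A" "w m \<noteq> 0" "v ?s = v (w m)" using IH by blast
      have "v (w a) \<noteq> v (w m)" using insert.prems(1)[of a m] m False insert.hyps by auto
      then consider "v (w a) < v ?s" | "v ?s < v (w a)" using m by linarith
      then show ?thesis
      proof cases
        case 1
        from v_add_less[OF False IH(1) 1] show ?thesis
          using insert.hyps False IH(3) 1 by fastforce
      next
        case 2
        from v_add_less[OF IH(1) False 2] show ?thesis
          using insert.hyps False IH(3) 2 m by (auto simp: add.commute)
      qed
    qed
  qed
qed simp

end

section \<open>Expansions in powers of a uniformiser\<close>

locale char_p_place = char_p_field p "TYPE('K)" + place \<iota> v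
  for p and \<iota> :: "'k::field \<Rightarrow> 'K::field" and v +
  fixes x t
  assumes span_x: "V.span (powers x) = (UNIV :: 'K set)"
    and t: "t \<noteq> 0" "v t = 1"
begin

lemma v_frob_term: "u \<noteq> 0 \<Longrightarrow> v (u ^ p * t ^ n) = int p * v u + int n"
  using t by (simp add: v_mult v_power)

lemma v_frob_sum:
  assumes "\<exists>n<p. u n \<noteq> 0"
  shows "(\<Sum>n<p. u n ^ p * t ^ n) \<noteq> 0"
    and "\<And>n. n < p \<Longrightarrow> u n \<noteq> 0 \<Longrightarrow> v (\<Sum>n<p. u n ^ p * t ^ n) \<le> v (u n ^ p * t ^ n)"
proof -
  have "v (u n ^ p * t ^ n) \<noteq> v (u m ^ p * t ^ m)" if "n < p" "m < p" "n \<noteq> m" "u n \<noteq> 0" "u m \<noteq> 0" for n m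
  proof
    assume "v (u n ^ p * t ^ n) = v (u m ^ p * t ^ m)"
    then have "int p * v (u n) + int n = int p * v (u m) + int m" using that by (simp add: v_frob_term)
    then have "(int p * v (u n) + int n) mod int p = (int p * v (u m) + int m) mod int p" by simp
    then show False using that by simp
  qed
  then have "(\<Sum>n<p. u n ^ p * t ^ n) \<noteq> 0 \<and> (\<exists>n\<in>{..<p}. u n ^ p * t ^ n \<noteq> 0 \<and> v (\<Sum>n<p. u n ^ p * t ^ n) = v (u n ^ p * t ^ n))
     \<and> (\<forall>n\<in>{..<p}. u n ^ p * t ^ n \<noteq> 0 \<longrightarrow> v (\<Sum>n<p. u n ^ p * t ^ n) \<le> v (u n ^ p * t ^ n))"
    by (intro v_sum_distinct) (use assms t p_pos in auto)
  then show "(\<Sum>n<p. u n ^ p * t ^ n) \<noteq> 0"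
    and "\<And>n. n < p \<Longrightarrow> u n \<noteq> 0 \<Longrightarrow> v (\<Sum>n<p. u n ^ p * t ^ n) \<le> v (u n ^ p * t ^ n)"
    using t by auto
qed

lemma inj_powers: "inj_on (\<lambda>n. t ^ n) {..<p}"
proof (rule inj_onI)
  fix m n assume "t ^ m = t ^ n"
  then have "v (t ^ m) = v (t ^ n)" by simp
  then show "m = n" using t by (simp add: v_power)
qed

text \<open>The powers \<open>t\<^sup>n\<close>, \<open>n < p\<close>, have valuations distinct modulo \<open>p\<close>, hence are independent over
  \<open>K\<^sup>p\<close>; as \<open>[K : K\<^sup>p] \<le> p\<close>, they span.\<close>

lemma span_t: "V.span (powers t) = (UNIV :: 'K set)"
proof -
  have fin: "finite (powers x)" "finite (powers t)" by (simp_all add: powers_def)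
  have ct: "card (powers t) = p" by (simp add: powers_def card_image inj_powers)
  have cx: "card (powers x) \<le> p" unfolding powers_def using card_image_le[of "{..<p}"] by simp
  have "V.independent (powers t)"
  proof
    assume "V.dependent (powers t)"
    then obtain u where u: "\<exists>z\<in>powers t. u z \<noteq> 0" "(\<Sum>z\<in>powers t. u z ^ p * z) = 0"
      using fin(2) by (auto simp: V.dependent_finite)
    then have "(\<Sum>n<p. u (t ^ n) ^ p * t ^ n) = 0"
      by (simp add: powers_def sum.reindex[OF inj_powers])
    moreover have "\<exists>n<p. u (t ^ n) \<noteq> 0" using u(1) by (auto simp: powers_def)
    ultimately show False using v_frob_sum(1)[of "\<lambda>n. u (t ^ n)"] by simp
  qed
  \<comment> \<open>Steinitz exchange: the independent powers of \<open>t\<close> extend to a set as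
    large as \<open>powers x\<close>, hence of at most \<open>p\<close> elements. An element outside
    their span would give \<open>p + 1\<close> independent elements, against the same bound.\<close>
  then obtain T where T: "card T = card (powers x)" "finite T" "powers t \<subseteq> T" "T \<subseteq> powers t \<union> powers x"
    using V.exchange_lemma[OF fin(1), of "powers t"] span_x by auto
  have "powers t = T" using T ct cx by (intro card_seteq) auto
  then have "card (powers x) = card (powers t)" using T by simp
  show ?thesis
  proof (rule ccontr)
    assume "V.span (powers t) \<noteq> UNIV"
    then obtain z where z: "z \<notin> V.span (powers t)" by auto
    have "V.independent (insert z (powers t))"
      using \<open>V.independent (powers t)\<close> z by (rule V.independent_insertI[rotated])
    then obtain T' where T': "card T' = card (powers x)" "finite T'" "insert z (powers t) \<subseteq> T'"
      using V.exchange_lemma[OF fin(1), of "insert z (powers t)"] span_x by auto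
    have "card (insert z (powers t)) \<le> card T'" using T' by (intro card_mono) auto
    moreover have "z \<notin> powers t" using z V.span_base by auto
    ultimately show False using T' ct cx fin by simp
  qed
qed

lemma frob_expansion: obtains u where "z = (\<Sum>n<p. u n ^ p * t ^ n)"
proof -
  have "z \<in> V.span (powers t)" using span_t by simp
  then obtain u where "z = (\<Sum>w\<in>powers t. u w ^ p * w)"
    by (auto simp: V.span_finite powers_def)
  then have "z = (\<Sum>n<p. u (t ^ n) ^ p * t ^ n)"
    by (simp add: powers_def sum.reindex[OF inj_powers])
  then show ?thesis by (rule that)
qed

text \<open>The element \<open>s\<close> is the formal derivative in \<open>t\<close> of the
  expansion of \<open>z\<close>. Each term of the expansion has valuation at least
  \<open>v z\<close>, and differentiation lowers it by at most one; a term of valuation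
  \<open>0\<close> must have \<open>n = 0\<close> and disappears.\<close>

lemma derivation_bound:
  assumes D: "is_derivation \<iota> D" and z: "z \<noteq> 0"
  obtains s where "D z = D t * s" "s = 0 \<or> v z - 1 \<le> v s \<and> (0 \<le> v z \<longrightarrow> 0 \<le> v s)"
proof -
  obtain u where u: "z = (\<Sum>n<p. u n ^ p * t ^ n)" by (rule frob_expansion)
  define s where "s = (\<Sum>n<p. of_nat n * u n ^ p * t ^ (n - 1))"
  have "\<exists>n<p. u n \<noteq> 0"
  proof (rule ccontr)
    assume "\<not> ?thesis"
    then have "z = 0" unfolding u by (intro sum.neutral) (use p_pos in auto)
    with z show False by simp
  qed
  note le = v_frob_sum(2)[OF this, folded u]
  have Dz: "D z = D t * s"
    unfolding u s_def by (simp add: derivation_sum[OF D] derivation_frob_mult[OF D] sum_distrib_left)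
  have summand: "of_nat n * u n ^ p * t ^ (n - 1) = 0 \<or>
      (v z - 1 \<le> v (of_nat n * u n ^ p * t ^ (n - 1)) \<and> (0 \<le> v z \<longrightarrow> 0 \<le> v (of_nat n * u n ^ p * t ^ (n - 1))))"
    if n: "n < p" for n
  proof (cases "n = 0 \<or> u n = 0")
    case True then show ?thesis using p_pos by auto
  next
    case False
    interpret h: field_hom \<iota> by (rule hom)
    have nz: "of_nat n \<noteq> (0::'K)" using of_nat_nonzero[of n] n False by simp
    then have "of_nat n \<noteq> (0::'k)" using h.hom_of_nat[of n] by auto
    then have "v (of_nat n) = 0" using v_const[of "of_nat n"] by (simp add: h.hom_of_nat)
    then have e: "v (of_nat n * u n ^ p * t ^ (n - 1)) = int p * v (u n) + int n - 1"
      using nz False t by (simp add: v_mult v_power)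
    have b: "v z \<le> int p * v (u n) + int n" using le[OF n] False by (simp add: v_frob_term)
    have "0 \<le> int p * v (u n) + int n - 1" if "0 \<le> v z"
    proof -
      \<comment> \<open>As \<open>n < p\<close>, a negative \<open>v (u n)\<close> would make
        \<open>p * v (u n) + n\<close> negative.\<close>
      have "0 \<le> v (u n)"
      proof (rule ccontr)
        assume "\<not> 0 \<le> v (u n)"
        then have "int p * v (u n) \<le> int p * (-1)" by (intro mult_left_mono) auto
        then show False using b that n by simp
      qed
      then have "0 \<le> int p * v (u n)" by simp
      then show ?thesis using False by simp
    qed
    then show ?thesis using e b by simp
  qed
  have "s = 0 \<or> v z - 1 \<le> v s" unfolding s_def
    by (rule v_sum_ge) (use summand in auto)
  moreover have "s = 0 \<or> 0 \<le> v s" if "0 \<le> v z" unfolding s_def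
    by (rule v_sum_ge) (use summand that in auto)
  ultimately show ?thesis using that[OF Dz] by blast
qed

end

section \<open>Embeddings into Laurent series\<close>

lemma map_poly_comp_ev:
  assumes "h1 0 = 0" "h2 0 = 0"
  shows "ev (\<lambda>c. h1 (h2 c)) z q = ev h1 z (map_poly h2 q)"
  using map_poly_map_poly[of h1 h2 q] assms by (simp add: ev_def o_def)

lemma comm_ring_hom_fps_const: "comm_ring_hom (fps_const :: 'a::comm_ring_1 \<Rightarrow> 'a fps)"
  by unfold_locales simp_all

lemma comm_ring_hom_fls_const: "comm_ring_hom (fls_const :: 'a::comm_ring_1 \<Rightarrow> 'a fls)"
  by unfold_locales (simp_all add: fls_plus_const)

lemma comm_ring_hom_fps_to_fls: "comm_ring_hom (fps_to_fls :: 'a::comm_ring_1 fps \<Rightarrow> 'a fls)"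
  by unfold_locales (simp_all add: fls_times_fps_to_fls)

lemma fps_nth_0_ev: "fps_nth (ev fps_const A P) 0 = poly P (fps_nth A 0)"
  for A :: "'a::comm_ring_1 fps"
  by (induction P) (simp_all add: ev_pCons[OF comm_ring_hom_fps_const])

lemma fps_to_fls_ev: "fps_to_fls (ev fps_const A P) = ev fls_const (fps_to_fls A) P"
  for A :: "'a::comm_ring_1 fps"
  by (rule ev_comp[OF comm_ring_hom_fps_const comm_ring_hom_fps_to_fls comm_ring_hom_fls_const]) simp

text \<open>Each factor \<open>X - r\<close> becomes \<open>t^a\<close>. What remains of
  \<open>P\<close> becomes a power series whose constant term is its nonzero value at
  \<open>r\<close>.\<close>

lemma ev_fls_at_point:
  fixes P :: "'a::field poly"
  assumes "P \<noteq> 0" "a > 0"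
  obtains U where "fps_nth U 0 \<noteq> 0"
    "ev fls_const (fls_const r + fls_X ^ a) P = fps_to_fls U * fls_X ^ (a * order r P)"
proof -
  define A :: "'a fps" where "A = fps_const r + fps_X ^ a"
  have A: "fps_to_fls A = fls_const r + fls_X ^ a"
    by (simp add: A_def fps_to_fls_power)
  interpret e: comm_ring_hom "ev fls_const (fps_to_fls A)"
    by (intro comm_ring_hom_ev comm_ring_hom_fls_const)
  obtain Q where Q: "P = [:-r, 1:] ^ order r P * Q" "\<not> [:-r, 1:] dvd Q"
    using order_decomp[OF assms(1)] by blast
  have "ev fls_const (fps_to_fls A) [:-r, 1:] = fls_X ^ a"
    unfolding ev_pCons[OF comm_ring_hom_fls_const] by (simp add: A)
  then have "ev fls_const (fps_to_fls A) P = fps_to_fls (ev fps_const A Q) * fls_X ^ (a * order r P)"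
    by (subst Q(1)) (simp add: e.hom_mult e.hom_power fps_to_fls_ev power_mult del: mult_pCons_left)
  moreover have "fps_nth (ev fps_const A Q) 0 \<noteq> 0"
    using Q(2) assms(2) by (simp add: fps_nth_0_ev A_def poly_eq_0_iff_dvd)
  ultimately show ?thesis using that unfolding A by blast
qed

text \<open>Multiplication by \<open>t^(a * degree P)\<close> turns the value at
  \<open>t^(-a)\<close> into the value at \<open>t^a\<close> of the reflected polynomial, whose
  constant term is the leading coefficient of \<open>P\<close>.\<close>

lemma ev_fls_at_infinity:
  fixes P :: "'a::field poly"
  assumes "P \<noteq> 0" "a > 0"
  obtains U where "fps_nth U 0 \<noteq> 0"
    "ev fls_const (fls_X_inv ^ a) P = fps_to_fls U * fls_X_inv ^ (a * degree P)"
proof -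
  define U where "U = ev fps_const (fps_X ^ a) (reflect_poly P)"
  have "fls_X * fls_X_inv = (1 :: 'a fls)" by (simp add: fls_X_times_conv_shift)
  then have Xi: "fls_X_inv = (inverse fls_X :: 'a fls)" by (rule inverse_unique[symmetric])
  have m: "map_poly fls_const (reflect_poly P) = reflect_poly (map_poly fls_const P)"
    by (rule poly_eqI) (simp add: coeff_map_poly coeff_reflect_poly degree_map_poly)
  have "fps_to_fls U = poly (reflect_poly (map_poly fls_const P)) (fls_X ^ a)"
    unfolding U_def fps_to_fls_ev by (simp add: ev_def m fps_to_fls_power)
  also have "\<dots> = (fls_X ^ a) ^ degree P * poly (map_poly fls_const P) (inverse (fls_X ^ a))"
    by (subst poly_reflect_poly_nz) (simp_all add: degree_map_poly)
  also have "\<dots> = fls_X ^ (a * degree P) * ev fls_const (fls_X_inv ^ a) P"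
    by (simp only: ev_def power_mult Xi power_inverse)
  finally have *: "fps_to_fls U = fls_X ^ (a * degree P) * ev fls_const (fls_X_inv ^ a) P" .
  have "fps_to_fls U * fls_X_inv ^ (a * degree P)
      = (fls_X ^ (a * degree P) * inverse (fls_X ^ (a * degree P))) * ev fls_const (fls_X_inv ^ a) P"
    unfolding * Xi power_inverse by (simp only: mult_ac)
  also have "\<dots> = ev fls_const (fls_X_inv ^ a) P" by simp
  finally have "ev fls_const (fls_X_inv ^ a) P = fps_to_fls U * fls_X_inv ^ (a * degree P)" by simp
  moreover have "fps_nth U 0 \<noteq> 0"
    using assms by (simp add: U_def fps_nth_0_ev)
  ultimately show ?thesis using that by blast
qed

lemma fls_subdegree_unit: "fps_nth U 0 \<noteq> 0 \<Longrightarrow> fls_subdegree (fps_to_fls U) = 0"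
  by (simp add: fls_subdegree_fls_to_fps)

text \<open>Over the algebraic closure all points \<rho> and all \<open>a\<close>-th roots of unity
  are available.\<close>

definition ac_const :: "'p::prime_card mod_ring \<Rightarrow> 'p mod_ring alg_closure fls" where
  "ac_const c = fls_const (to_ac c)"

lemma comm_ring_hom_ac_const: "comm_ring_hom ac_const"
  by unfold_locales (simp_all add: ac_const_def fls_plus_const)

lemma ev_ac_const: "ev ac_const z q = ev fls_const z (map_poly to_ac q)"
  unfolding ac_const_def[abs_def] by (rule map_poly_comp_ev) simp_all

lemma map_poly_to_ac_eq_0_iff [simp]: "map_poly to_ac q = 0 \<longleftrightarrow> q = 0"
  by (simp add: poly_eq_iff coeff_map_poly)

lemma fls_deriv_derivation: "is_derivation ac_const fls_deriv"
  by (simp add: is_derivation_def ac_const_def mult.commute)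

text \<open>Every element is the image of a natural number. Since base-field coefficients are their
  own \<open>p\<close>-th powers, the matrix shows no Frobenius twist.\<close>

lemma frob_mod_ring: "(c :: 'p::prime_card mod_ring) ^ CARD('p) = c"
proof -
  interpret F: char_p_field "CARD('p)" "TYPE('p mod_ring)"
    by unfold_locales (simp_all add: prime_card)
  obtain n where "c = of_nat n" using surj_of_nat_mod_ring by blast
  then show ?thesis using F.frob_of_nat by simp
qed

section \<open>The function field of the curve and its derivation\<close>

locale superelliptic =
  fixes f :: "'p::prime_card mod_ring poly" and p a b c :: nat
    and \<iota> :: "'p mod_ring \<Rightarrow> 'K::field" and x y :: 'K
  assumes p: "p = CARD('p)" and a: "a \<ge> 2" "p > a"
    and f: "degree f = c" "coeff f 0 \<noteq> 0"
    and irred: "irreducible (superelliptic_poly a b f)"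
    and curve: "is_function_field (superelliptic_poly a b f) \<iota> x y"
begin

definition g where "g = monom 1 b * f"

abbreviation "F \<equiv> superelliptic_poly a b f"

lemma F_eq: "F = monom 1 a - [:g:]" by (simp add: superelliptic_poly_def g_def)

lemma degree_F: "degree F = a"
proof -
  have "degree (monom (1::'p mod_ring poly) a + (- [:g:])) = degree (monom (1::'p mod_ring poly) a)"
    by (rule degree_add_eq_left) (use a in \<open>simp add: degree_monom_eq\<close>)
  also have "monom 1 a + (- [:g:]) = F" by (simp only: F_eq diff_conv_add_uminus)
  finally show ?thesis by (simp add: degree_monom_eq)
qed

lemma hom: "field_hom \<iota>" using curve by (simp add: is_function_field_def)

sublocale h: field_hom \<iota> by (rule hom)

lemma crh: "comm_ring_hom \<iota>" by (rule field_hom_comm_ring_hom[OF hom])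

sublocale e1: comm_ring_hom "ev \<iota> x" by (rule comm_ring_hom_ev[OF crh])

sublocale e2: comm_ring_hom "eval2 \<iota> x y" by (rule comm_ring_hom_eval2[OF crh])

lemma eval2_eq_0_iff: "eval2 \<iota> x y P = 0 \<longleftrightarrow> F dvd P"
  using curve by (simp add: is_function_field_def)

lemma eval2_nonzero: "P \<noteq> 0 \<Longrightarrow> degree P < a \<Longrightarrow> eval2 \<iota> x y P \<noteq> 0"
  using dvd_imp_degree_le[of F P] by (auto simp: eval2_eq_0_iff degree_F)

lemma ev_nonzero: "q \<noteq> 0 \<Longrightarrow> ev \<iota> x q \<noteq> 0"
  using eval2_nonzero[of "[:q:]"] a by (simp add: eval2_const[OF crh])

lemma y_nonzero: "y \<noteq> 0"
  using eval2_nonzero[of "[:0, 1:]"] a by (simp add: eval2_pCons[OF crh] ev_1[OF crh])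

lemma x_nonzero: "x \<noteq> 0"
  using ev_nonzero[of "[:0, 1:]"] by (simp add: ev_pCons[OF crh])

lemma curve_eq: "y ^ a = ev \<iota> x g"
  using eval2_eq_0_iff[of F] by (simp add: F_eq e2.hom_minus eval2_monom[OF crh] eval2_const[OF crh] ev_1[OF crh])

lemma ev_g: "ev \<iota> x g = x ^ b * ev \<iota> x f"
  by (simp add: g_def e1.hom_mult ev_monom[OF crh])

lemma g_nonzero: "g \<noteq> 0" using f by (auto simp: g_def)

lemma CHAR_K: "CHAR('K) = p"
proof (rule CHAR_eqI)
  show "of_nat p = (0::'K)" using h.hom_of_nat[of p] p of_nat_CHAR[where ?'a = "'p mod_ring"] by simp
  fix n assume "of_nat n = (0::'K)"
  then have "\<iota> (of_nat n) = 0" by (simp add: h.hom_of_nat)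
  then have "of_nat n = (0 :: 'p mod_ring)" by simp
  then show "p dvd n" by (simp add: of_nat_eq_0_iff_char_dvd p)
qed

sublocale char_p_field p "TYPE('K)"
  by unfold_locales (simp_all add: CHAR_K p prime_card)

lemma frob_base: "\<iota> d ^ p = \<iota> d"
  by (simp flip: h.hom_power add: p frob_mod_ring)

lemma ev_in_span: "ev \<iota> x q \<in> V.span (powers x)"
proof (induction q)
  case (pCons d q)
  have "\<iota> d \<in> V.span (powers x)" using frob_in_span[of "\<iota> d" x] by (simp add: frob_base)
  then show ?case
    using pCons power_in_span[of x 1] by (auto simp: ev_pCons[OF crh] intro!: V.span_add span_mult)
qed (simp add: V.span_zero)

text \<open>Only the generators of \<open>K\<close> need checking. For \<open>y\<close>, a relation
  \<open>a * u = p * w + 1\<close> writes \<open>y\<close> as \<open>ev \<iota> x (g ^ u)\<close>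
  divided by the \<open>p\<close>-th power of \<open>y ^ w\<close>.\<close>

lemma span_x: "V.span (powers x) = UNIV"
proof -
  have "z \<in> V.span (powers x)" for z
  proof (rule function_field_induct[OF curve, where S = "\<lambda>z. z \<in> V.span (powers x)"])
    show "\<iota> d \<in> V.span (powers x)" for d using frob_in_span[of "\<iota> d" x] by (simp add: frob_base)
    show "x \<in> V.span (powers x)" using power_in_span[of x 1] by simp
    show "y \<in> V.span (powers x)"
    proof -
      have "\<not> p dvd a" using a by (auto dest: dvd_imp_le)
      then have "coprime p a" by (rule prime_imp_coprime[OF prime_p])
      then obtain u w where uw: "a * u = p * w + 1"
        using bezout_nat[of a p] a coprime_imp_gcd_eq_1[OF \<open>coprime p a\<close>] gcd.commute[of a p] by auto
      have "y ^ (a * u) = y * (y ^ w) ^ p" unfolding uw by (simp add: mult.commute flip: power_mult)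
      moreover have "y ^ (a * u) = ev \<iota> x (g ^ u)" by (simp add: e1.hom_power curve_eq power_mult)
      ultimately have "ev \<iota> x (g ^ u) = y * (y ^ w) ^ p" by simp
      then have "(inverse (y ^ w)) ^ p * ev \<iota> x (g ^ u) = y"
        using y_nonzero by (simp add: power_inverse)
      then show ?thesis using span_mult[OF frob_in_span ev_in_span] by metis
    qed
  qed (auto intro: V.span_add span_mult span_inverse)
  then show ?thesis by blast
qed

text \<open>Differentiating \<open>y ^ a = ev \<iota> x g\<close> determines \<open>D y\<close>,
  because \<open>a\<close> is invertible in \<open>K\<close>; the generators determine the
  rest.\<close>

lemma derivation_unique:
  assumes "is_derivation \<iota> D" "D x = 1" "is_derivation \<iota> E" "E x = 1"
  shows "D = E"
proof
  fix z
  show "D z = E z"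
  proof (rule function_field_induct[OF curve, where S = "\<lambda>z. D z = E z"])
    have "of_nat a * y ^ (a - 1) * D' y = ev \<iota> x (pderiv g)" if "is_derivation \<iota> D'" "D' x = 1" for D'
    proof -
      have "D' (y ^ a) = D' (ev \<iota> x g)" by (simp add: curve_eq)
      then show ?thesis by (simp add: derivation_power[OF that(1)] derivation_ev[OF that(1) crh] that(2))
    qed
    then have "of_nat a * y ^ (a - 1) * D y = of_nat a * y ^ (a - 1) * E y" using assms by metis
    then show "D y = E y" using y_nonzero of_nat_nonzero[of a] a by simp
    fix z assume "D z = E z"
    then show "D (inverse z) = E (inverse z)"
      using derivation_inverse[OF assms(1), of z] derivation_inverse[OF assms(3), of z] derivation_sum[OF assms(1), of "\<lambda>_. 0" "{}"] derivation_sum[OF assms(3), of "\<lambda>_. 0" "{}"]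
      by (cases "z = 0") simp_all
  qed (use assms in \<open>simp_all add: is_derivation_def\<close>)
qed

text \<open>The nonzero derivative of \<open>\<phi> x\<close> allows differentiation with respect to
  \<open>x\<close> to be expressed as differentiation in \<open>t\<close> divided by that
  derivative.\<close>

definition embedding :: "('K \<Rightarrow> 'p mod_ring alg_closure fls) \<Rightarrow> bool" where
  "embedding \<phi> \<longleftrightarrow> field_hom \<phi> \<and> (\<forall>d. \<phi> (\<iota> d) = ac_const d) \<and> fls_deriv (\<phi> x) \<noteq> 0"

lemma embedding_ev: "embedding \<phi> \<Longrightarrow> \<phi> (ev \<iota> x q) = ev ac_const (\<phi> x) q"
  by (rule ev_comp[OF crh _ comm_ring_hom_ac_const]) (auto simp: embedding_def field_hom_comm_ring_hom)

text \<open>Differentiation in \<open>t\<close>, divided by \<open>fls_deriv (\<phi> x)\<close>,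
  maps the image of \<phi> into itself and is pulled back along the injective \<phi>. This yields
  the existence of the derivation.\<close>

lemma embedding_derivation:
  assumes "embedding \<phi>"
  obtains D where "is_derivation \<iota> D" "D x = 1" "\<And>z. \<phi> (D z) * fls_deriv (\<phi> x) = fls_deriv (\<phi> z)"
proof -
  interpret \<phi>: field_hom \<phi> using assms by (simp add: embedding_def)
  have \<phi>\<iota>: "\<phi> (\<iota> d) = ac_const d" for d using assms by (simp add: embedding_def)
  have x': "fls_deriv (\<phi> x) \<noteq> 0" using assms by (simp add: embedding_def)
  have dz: "fls_deriv (z + w) = fls_deriv z + fls_deriv w" "fls_deriv (z * w) = z * fls_deriv w + w * fls_deriv z" for z w :: "'p mod_ring alg_closure fls"
    by (simp_all add: mult.commute)
  have ex: "\<exists>w. \<phi> w * fls_deriv (\<phi> x) = fls_deriv (\<phi> z)" for z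
  proof (rule function_field_induct[OF curve, where S = "\<lambda>z. \<exists>w. \<phi> w * fls_deriv (\<phi> x) = fls_deriv (\<phi> z)"])
    show "\<exists>w. \<phi> w * fls_deriv (\<phi> x) = fls_deriv (\<phi> (\<iota> d))" for d
      by (rule exI[of _ 0]) (simp add: \<phi>\<iota> ac_const_def)
    show "\<exists>w. \<phi> w * fls_deriv (\<phi> x) = fls_deriv (\<phi> x)"
      by (rule exI[of _ 1]) simp
    \<comment> \<open>On \<open>y\<close> the quotient is read off from the differentiated equation
      of the curve: it is the image of \<open>g'(x) / (a y^(a-1))\<close>.\<close>
    have "fls_deriv (\<phi> (y ^ a)) = fls_deriv (\<phi> (ev \<iota> x g))" by (simp add: curve_eq)
    then have "of_nat a * \<phi> y ^ (a - 1) * fls_deriv (\<phi> y) = \<phi> (ev \<iota> x (pderiv g)) * fls_deriv (\<phi> x)"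
      by (simp add: \<phi>.hom_power fls_deriv_power embedding_ev[OF assms] derivation_ev[OF fls_deriv_derivation comm_ring_hom_ac_const])
    moreover have "of_nat a * \<phi> y ^ (a - 1) = \<phi> (of_nat a * y ^ (a - 1))"
      by (simp add: \<phi>.hom_mult \<phi>.hom_power \<phi>.hom_of_nat)
    moreover have "\<phi> (of_nat a * y ^ (a - 1)) \<noteq> 0"
      using of_nat_nonzero[of a] a y_nonzero by simp
    ultimately have "\<phi> (ev \<iota> x (pderiv g) / (of_nat a * y ^ (a - 1))) * fls_deriv (\<phi> x) = fls_deriv (\<phi> y)"
      by (simp add: \<phi>.hom_div divide_simps) (simp add: mult_ac)
    then show "\<exists>w. \<phi> w * fls_deriv (\<phi> x) = fls_deriv (\<phi> y)" by blast
  next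
    fix z w assume "\<exists>u. \<phi> u * fls_deriv (\<phi> x) = fls_deriv (\<phi> z)" "\<exists>u. \<phi> u * fls_deriv (\<phi> x) = fls_deriv (\<phi> w)"
    then obtain z' w' where z': "fls_deriv (\<phi> z) = \<phi> z' * fls_deriv (\<phi> x)" "fls_deriv (\<phi> w) = \<phi> w' * fls_deriv (\<phi> x)" by metis
    show "\<exists>u. \<phi> u * fls_deriv (\<phi> x) = fls_deriv (\<phi> (z + w))"
      by (rule exI[of _ "z' + w'"]) (simp add: z' \<phi>.hom_add algebra_simps)
    show "\<exists>u. \<phi> u * fls_deriv (\<phi> x) = fls_deriv (\<phi> (z * w))"
      by (rule exI[of _ "z * w' + w * z'"]) (simp add: z' \<phi>.hom_add \<phi>.hom_mult algebra_simps)
  next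
    fix z assume "\<exists>u. \<phi> u * fls_deriv (\<phi> x) = fls_deriv (\<phi> z)"
    then obtain z' where z': "fls_deriv (\<phi> z) = \<phi> z' * fls_deriv (\<phi> x)" by metis
    show "\<exists>u. \<phi> u * fls_deriv (\<phi> x) = fls_deriv (\<phi> (inverse z))"
    proof (cases "z = 0")
      case True then show ?thesis by (intro exI[of _ 0]) simp
    next
      case False
      then show ?thesis
        by (intro exI[of _ "- (z' * inverse z ^ 2)"])
          (simp add: \<phi>.hom_inverse derivation_inverse[OF fls_deriv_derivation, of "\<phi> z"] \<phi>.hom_uminus \<phi>.hom_mult \<phi>.hom_power z' mult_ac)
    qed
  qed
  then obtain D where D: "\<And>z. \<phi> (D z) * fls_deriv (\<phi> x) = fls_deriv (\<phi> z)" by metis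
  have D_eqI: "D z = w" if "\<phi> w * fls_deriv (\<phi> x) = fls_deriv (\<phi> z)" for z w
    using that D[of z] x' by (metis mult_right_cancel \<phi>.eq_iff)
  have "D (z + w) = D z + D w" for z w
    by (rule D_eqI) (simp only: \<phi>.hom_add distrib_right D dz)
  moreover have "D (z * w) = z * D w + w * D z" for z w
    by (rule D_eqI) (simp only: \<phi>.hom_add \<phi>.hom_mult distrib_right mult.assoc D dz)
  moreover have "D (\<iota> d) = 0" for d
    by (rule D_eqI) (simp add: \<phi>\<iota> ac_const_def)
  ultimately have "is_derivation \<iota> D" unfolding is_derivation_def by blast
  moreover have "D x = 1" by (rule D_eqI) simp
  ultimately show ?thesis using D that by blast
qed

lemma d_dx_eq: "is_derivation \<iota> D \<Longrightarrow> D x = 1 \<Longrightarrow> d_dx \<iota> x = D"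
  unfolding d_dx_def by (rule the_equality) (auto intro: derivation_unique)

lemma embedding_d_dx:
  assumes "embedding \<phi>"
  shows "\<phi> (d_dx \<iota> x z) * fls_deriv (\<phi> x) = fls_deriv (\<phi> z)"
  using embedding_derivation[OF assms] d_dx_eq by metis

end

section \<open>Local conditions on regular differentials\<close>

abbreviation sd :: "'a::zero fls \<Rightarrow> int" where "sd \<equiv> fls_subdegree"

context superelliptic
begin

lemma of_nat_a_nonzero: "of_nat a \<noteq> (0 :: 'p mod_ring alg_closure)"
  using a p by (auto simp: of_nat_eq_0_iff_char_dvd dest: dvd_imp_le)

text \<open>A transcendental \<open>z\<close> together with an \<open>a\<close>-th root of
  \<open>g(z)\<close> is a point of the curve over the series field, and multiplying the root by
  \<zeta> gives another.\<close>

lemma embedding_exists: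
  assumes tr: "\<And>q. q \<noteq> 0 \<Longrightarrow> ev fls_const z q \<noteq> 0" and d: "fls_deriv z \<noteq> 0"
    and w: "w ^ a = ev ac_const z g" and \<zeta>: "\<zeta> ^ a = 1"
  obtains \<phi> where "embedding \<phi>" "\<phi> x = z" "\<phi> y = fls_const \<zeta> * w"
proof -
  interpret E: comm_ring_hom "eval2 ac_const z (fls_const \<zeta> * w)" by (rule comm_ring_hom_eval2[OF comm_ring_hom_ac_const])
  have "(fls_const \<zeta> * w) ^ a = ev ac_const z g"
    using w \<zeta> by (simp add: power_mult_distrib flip: fls_const_power)
  then have "eval2 ac_const z (fls_const \<zeta> * w) F = 0"
    by (simp add: F_eq E.hom_minus eval2_monom[OF comm_ring_hom_ac_const] eval2_const[OF comm_ring_hom_ac_const] ev_1[OF comm_ring_hom_ac_const])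
  moreover have "ev ac_const z q \<noteq> 0" if "q \<noteq> 0" for q using tr that by (simp add: ev_ac_const)
  moreover have "degree F > 0" using a by (simp add: degree_F)
  ultimately obtain \<phi> where "field_hom \<phi>" "\<phi> x = z" "\<phi> y = fls_const \<zeta> * w" "\<And>d. \<phi> (\<iota> d) = ac_const d"
    using function_field_hom_exists[OF curve irred _ comm_ring_hom_ac_const] by metis
  then have "embedding \<phi>" using d by (simp add: embedding_def)
  then show ?thesis using \<open>\<phi> x = z\<close> \<open>\<phi> y = _\<close> by (rule that)
qed

text \<open>The order of vanishing under an embedding takes values in some \<open>n\<int>\<close>; dividing by \<open>n\<close> gives a place.\<close>

lemma regular_embedding:
  assumes emb: "embedding \<phi>" and z0: "z0 \<noteq> 0" "sd (\<phi> z0) \<noteq> 0" and h: "h \<in> regular_differentials \<iota> x"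
  shows "0 \<le> sd (\<phi> h * fls_deriv (\<phi> x))"
proof -
  interpret \<phi>: field_hom \<phi> using emb by (simp add: embedding_def)
  have \<phi>\<iota>: "\<phi> (\<iota> d) = ac_const d" for d using emb by (simp add: embedding_def)
  have sm: "sd (\<phi> (z * w)) = sd (\<phi> z) + sd (\<phi> w)" if "z \<noteq> 0" "w \<noteq> 0" for z w
    using that by (simp add: \<phi>.hom_mult)
  have si: "sd (\<phi> (inverse z)) = - sd (\<phi> z)" for z by (simp add: \<phi>.hom_inverse)
  have sp: "sd (\<phi> (z ^ n)) = int n * sd (\<phi> z)" for z n by (simp add: \<phi>.hom_power fls_subdegree_pow)
  \<comment> \<open>\<open>S\<close> is the value group; the hypothesis on \<open>z0\<close> makes
    it nontrivial, and \<open>n\<close> is its positive generator.\<close>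
  define S where "S = (\<lambda>z. sd (\<phi> z)) ` (- {0})"
  have S_iff: "s \<in> S \<longleftrightarrow> (\<exists>w. w \<noteq> 0 \<and> sd (\<phi> w) = s)" for s by (auto simp: S_def)
  define n where "n = (LEAST n. 0 < n \<and> int n \<in> S)"
  have "\<exists>n. 0 < n \<and> int n \<in> S"
  proof (cases "sd (\<phi> z0) > 0")
    case True
    then show ?thesis using z0 by (intro exI[of _ "nat (sd (\<phi> z0))"]) (auto simp: S_def)
  next
    case False
    then show ?thesis using z0
      by (intro exI[of _ "nat (- sd (\<phi> z0))"]) (auto simp: S_def image_iff si intro!: bexI[of _ "inverse z0"])
  qed
  then have n: "0 < n" "int n \<in> S" and min: "\<And>m. 0 < m \<Longrightarrow> int m \<in> S \<Longrightarrow> n \<le> m"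
    unfolding n_def by (metis (mono_tags, lifting) LeastI_ex, metis (mono_tags, lifting) LeastI_ex, metis (mono_tags, lifting) Least_le)
  obtain t where t: "t \<noteq> 0" "sd (\<phi> t) = int n" using n(2) S_iff by blast
  have mult: "k * int n \<in> S" for k
  proof (cases k rule: int_cases2)
    case (nonneg m)
    then show ?thesis using t by (auto simp: S_def image_iff sp intro!: bexI[of _ "t ^ m"])
  next
    case (nonpos m)
    then show ?thesis using t by (auto simp: S_def image_iff sp si intro!: bexI[of _ "inverse t ^ m"])
  qed
  \<comment> \<open>The remainder of a value modulo \<open>n\<close> is again a value, so minimality
    of \<open>n\<close> forces it to be \<open>0\<close>.\<close>
  have dvd: "int n dvd sd (\<phi> z)" if "z \<noteq> 0" for z
  proof -
    obtain w where w: "w \<noteq> 0" "sd (\<phi> w) = (- (sd (\<phi> z) div int n)) * int n"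
      using mult[of "- (sd (\<phi> z) div int n)"] S_iff by blast
    have "sd (\<phi> (z * w)) = sd (\<phi> z) mod int n"
      by (simp only: sm[OF that w(1)] w(2)) (simp add: minus_div_mult_eq_mod[symmetric])
    then have "sd (\<phi> z) mod int n \<in> S" using that w(1) S_iff no_zero_divisors by blast
    then have "int (nat (sd (\<phi> z) mod int n)) \<in> S" using n(1) by simp
    moreover have "nat (sd (\<phi> z) mod int n) < n" using n(1) by (simp add: nat_less_iff)
    ultimately have "nat (sd (\<phi> z) mod int n) = 0" using min by (meson gr0I not_le)
    then show ?thesis using n(1) by (simp add: dvd_eq_mod_eq_0 nat_eq_iff)
  qed
  define v where "v z = sd (\<phi> z) div int n" for z
  have "is_place \<iota> v"
    unfolding is_place_def
  proof (intro conjI allI impI)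
    fix z w assume z: "z \<noteq> (0::'K)" "w \<noteq> (0::'K)"
    show "v (z * w) = v z + v w" unfolding v_def sm[OF z] using dvd[OF z(1)] by (simp add: div_plus_div_distrib_dvd_left)
  next
    fix z w assume z: "z \<noteq> (0::'K)" "w \<noteq> (0::'K)" "z + w \<noteq> 0"
    have "\<phi> z + \<phi> w \<noteq> 0" using z(3) by (simp flip: \<phi>.hom_add)
    then have "min (sd (\<phi> z)) (sd (\<phi> w)) \<le> sd (\<phi> (z + w))" by (simp add: \<phi>.hom_add fls_plus_subdegree)
    then show "min (v z) (v w) \<le> v (z + w)"
      using n(1) unfolding v_def min_le_iff_disj by (auto intro: zdiv_mono1)
  next
    fix d :: "'p mod_ring" assume "d \<noteq> 0"
    show "v (\<iota> d) = 0" by (simp add: v_def \<phi>\<iota> ac_const_def)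
  next
    show "\<exists>t. t \<noteq> 0 \<and> v t = 1" using t n(1) by (auto simp: v_def)
  qed
  moreover have "v t = 1" using t n(1) by (simp add: v_def)
  ultimately obtain u where u: "u = 0 \<or> 0 \<le> v u" "h = u * d_dx \<iota> x t"
    using h t(1) by (auto simp: regular_differentials_def)
  have *: "\<phi> h * fls_deriv (\<phi> x) = \<phi> u * fls_deriv (\<phi> t)"
    using embedding_d_dx[OF emb, of t] by (simp add: u(2) \<phi>.hom_mult mult.assoc)
  have "0 \<le> sd (\<phi> u)"
  proof (cases "u = 0")
    case False
    then have "0 \<le> v u * int n" using u(1) by simp
    then show ?thesis using dvd[OF False] by (simp add: v_def)
  qed simp
  moreover have "0 \<le> sd (fls_deriv (\<phi> t))"
  proof (rule fls_subdegree_ge0I)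
    fix k :: int assume "k < 0"
    then have "fls_nth (\<phi> t) (k + 1) = 0"
      by (intro fls_eq0_below_subdegree) (use t(2) n(1) in simp)
    then show "fls_nth (fls_deriv (\<phi> t)) k = 0" by simp
  qed
  \<comment> \<open>The order of the zero series is \<open>0\<close> by convention, so a vanishing
    factor respects the bound as well.\<close>
  ultimately show ?thesis unfolding *
    by (cases "\<phi> u = 0 \<or> fls_deriv (\<phi> t) = 0") auto
qed

text \<open>Up to a common constant, the embeddings for the various \<zeta> send \<open>h dx\<close>
  to the sum of the \<open>s j\<close> weighted by \<open>\<zeta> ^ j\<close>. None of these sums
  has a pole, so \<open>roots_of_unity_separate\<close>, applied to each coefficient of negative
  index, excludes a pole of every single \<open>s j\<close>.\<close>

lemma regular_coeff:
  assumes tr: "\<And>q. q \<noteq> 0 \<Longrightarrow> ev fls_const z q \<noteq> 0" and d: "fls_deriv z \<noteq> 0"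
    and w: "w ^ a = ev ac_const z g" and q: "q \<noteq> 0" "sd (ev ac_const z q) \<noteq> 0"
    and h: "h \<in> regular_differentials \<iota> x"
    and P: "h = eval2 \<iota> x y P / (ev \<iota> x r * y ^ (a - 1))" "degree P < a" "r \<noteq> 0"
    and j: "j < a" "coeff P j \<noteq> 0"
  shows "0 \<le> sd (ev ac_const z (coeff P j)) - sd (ev ac_const z r) + (int j - int (a - 1)) * sd w + sd (fls_deriv z)"
proof -
  have nz: "ev ac_const z q \<noteq> 0" if "q \<noteq> 0" for q using tr that by (simp add: ev_ac_const)
  have w0: "w \<noteq> 0" using w nz[OF g_nonzero] a by (auto simp: power_0_left)
  define s where "s j = ev ac_const z (coeff P j) * w ^ j / (ev ac_const z r * w ^ (a - 1)) * fls_deriv z" for j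
  have sum: "0 \<le> sd (\<Sum>j<a. fls_const (\<zeta> ^ j) * s j)" if \<zeta>: "\<zeta> ^ a = 1" for \<zeta>
  proof -
    obtain \<phi> where \<phi>: "embedding \<phi>" "\<phi> x = z" "\<phi> y = fls_const \<zeta> * w"
      using embedding_exists[OF tr d w \<zeta>] by blast
    interpret \<phi>: field_hom \<phi> using \<phi>(1) by (simp add: embedding_def)
    have \<zeta>0: "\<zeta> \<noteq> 0" using \<zeta> a by (auto simp: power_0_left)
    have "0 \<le> sd (\<phi> h * fls_deriv (\<phi> x))"
      by (rule regular_embedding[OF \<phi>(1) _ _ h, of "ev \<iota> x q"])
        (use q ev_nonzero in \<open>simp_all add: embedding_ev[OF \<phi>(1)] \<phi>(2)\<close>)
    \<comment> \<open>The denominator \<open>y ^ (a - 1)\<close> contributes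
      \<open>\<zeta> ^ (a - 1)\<close>; multiplying by this constant removes it without changing the
      order.\<close>
    moreover have "fls_const (\<zeta> ^ (a - 1)) * (\<phi> h * fls_deriv (\<phi> x)) = (\<Sum>j<a. fls_const (\<zeta> ^ j) * s j)"
    proof -
      have "eval2 \<iota> x y P = (\<Sum>j<a. ev \<iota> x (coeff P j) * y ^ j)"
        unfolding eval2_ev by (rule ev_altdef'[OF comm_ring_hom_ev[OF crh] P(2)])
      then have "\<phi> h = (\<Sum>j<a. ev ac_const z (coeff P j) * (fls_const \<zeta> * w) ^ j) / (ev ac_const z r * (fls_const \<zeta> * w) ^ (a - 1))"
        by (simp add: P(1) \<phi>.hom_div \<phi>.hom_sum \<phi>.hom_mult \<phi>.hom_power embedding_ev[OF \<phi>(1)] \<phi>(2,3))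
      then have "fls_const (\<zeta> ^ (a - 1)) * \<phi> h = (\<Sum>j<a. ev ac_const z (coeff P j) * (fls_const \<zeta> * w) ^ j) / (ev ac_const z r * w ^ (a - 1))"
        using \<zeta>0 by (simp add: power_mult_distrib fls_const_power)
      then have "fls_const (\<zeta> ^ (a - 1)) * \<phi> h * fls_deriv z = (\<Sum>j<a. ev ac_const z (coeff P j) * (fls_const \<zeta> * w) ^ j) / (ev ac_const z r * w ^ (a - 1)) * fls_deriv z"
        by simp
      also have "\<dots> = (\<Sum>j<a. fls_const (\<zeta> ^ j) * s j)"
        unfolding sum_divide_distrib sum_distrib_right s_def
        by (rule sum.cong[OF refl]) (simp add: power_mult_distrib fls_const_power)
      finally show ?thesis by (simp add: \<phi>(2) mult.assoc)
    qed
    ultimately show ?thesis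
      using \<zeta>0 by (cases "\<phi> h * fls_deriv (\<phi> x) = 0") (auto simp flip: \<open>fls_const (\<zeta> ^ (a - 1)) * (\<phi> h * fls_deriv (\<phi> x)) = _\<close>)
  qed
  have "fls_nth (s j) N = 0" if N: "N < 0" for N
  proof (rule roots_of_unity_separate[OF of_nat_a_nonzero _ j(1), of "\<lambda>j. fls_nth (s j) N"])
    fix \<zeta> :: "'p mod_ring alg_closure" assume \<zeta>: "\<zeta> ^ a = 1"
    have "fls_nth (\<Sum>j<a. fls_const (\<zeta> ^ j) * s j) N = 0"
      using sum[OF \<zeta>] N by simp
    then show "(\<Sum>j<a. fls_nth (s j) N * \<zeta> ^ j) = 0"
      by (simp add: fls_nth_sum mult.commute)
  qed
  then have "0 \<le> sd (s j)" by (rule fls_subdegree_ge0I)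
  moreover have "sd (s j) = sd (ev ac_const z (coeff P j)) - sd (ev ac_const z r) + (int j - int (a - 1)) * sd w + sd (fls_deriv z)"
    unfolding s_def divide_inverse using nz[OF j(2)] nz[OF P(3)] d w0
    by (simp add: fls_subdegree_pow algebra_simps)
  ultimately show ?thesis by simp
qed

text \<open>Under \<open>x = \<rho> + t^a\<close> orders at \<rho> are multiplied by
  \<open>a\<close>, while \<open>dx\<close> contributes \<open>a - 1\<close>; the latter becomes a
  strict inequality with \<open>a\<close>.\<close>

lemma regular_coeff_at_point:
  assumes h: "h \<in> regular_differentials \<iota> x"
    and P: "h = eval2 \<iota> x y P / (ev \<iota> x r * y ^ (a - 1))" "degree P < a" "r \<noteq> 0"
    and j: "j < a" "coeff P j \<noteq> 0"
  shows "int (a * order \<rho> (map_poly to_ac r)) + (int (a - 1) - int j) * int (order \<rho> (map_poly to_ac g))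
    < int (a * order \<rho> (map_poly to_ac (coeff P j))) + int a"
proof -
  let ?z = "fls_const \<rho> + fls_X ^ a"
  have a0: "a > 0" using a by simp
  have ev: "ev fls_const ?z q \<noteq> 0" "sd (ev fls_const ?z q) = int (a * order \<rho> q)" if q: "q \<noteq> 0" for q
  proof -
    obtain U where U: "fps_nth U 0 \<noteq> 0" "ev fls_const ?z q = fps_to_fls U * fls_X ^ (a * order \<rho> q)"
      using ev_fls_at_point[OF q a0] by blast
    then have "U \<noteq> 0" by auto
    then show "ev fls_const ?z q \<noteq> 0" "sd (ev fls_const ?z q) = int (a * order \<rho> q)"
      using U by (simp_all add: fls_subdegree_unit fls_subdegree_pow)
  qed
  have d: "fls_deriv ?z = of_nat a * fls_X ^ (a - 1)" by (simp add: fls_deriv_X_power)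
  have ofa: "of_nat a = (fls_const (of_nat a) :: 'p mod_ring alg_closure fls)" by (simp add: fls_of_nat)
  have d0: "fls_deriv ?z \<noteq> 0" and sdd: "sd (fls_deriv ?z) = int (a - 1)"
    unfolding d ofa using of_nat_a_nonzero by (simp_all add: fls_subdegree_pow)
  obtain U where U: "fps_nth U 0 \<noteq> 0"
    "ev fls_const ?z (map_poly to_ac g) = fps_to_fls U * fls_X ^ (a * order \<rho> (map_poly to_ac g))"
    using ev_fls_at_point[of "map_poly to_ac g" a \<rho>] g_nonzero a0 by auto
  obtain W where W: "W ^ a = U" "fps_nth W 0 \<noteq> 0" using fps_nth_root_exists[OF of_nat_a_nonzero U(1)] by blast
  \<comment> \<open>The order of \<open>g(\<rho> + t^a)\<close> is divisible by \<open>a\<close>, so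
    a root of its unit part times a power of \<open>t\<close> is an \<open>a\<close>-th
    root.\<close>
  define w where "w = fps_to_fls W * fls_X ^ order \<rho> (map_poly to_ac g)"
  have wa: "w ^ a = ev ac_const ?z g"
    by (simp add: w_def ev_ac_const U(2) power_mult_distrib fps_to_fls_power mult.commute flip: W(1) power_mult)
  have "W \<noteq> 0" using W by auto
  then have sw: "sd w = int (order \<rho> (map_poly to_ac g))"
    by (simp add: w_def fls_subdegree_unit W(2) fls_subdegree_pow)
  \<comment> \<open>Every \<rho> is algebraic over the base field; a polynomial vanishing there
    supplies the element of nonzero order.\<close>
  obtain q where q: "q \<noteq> 0" "poly (map_poly to_ac q) \<rho> = 0" by (rule alg_closure_algebraic)
  then have sq: "sd (ev ac_const ?z q) \<noteq> 0"
    using a0 order_root[of "map_poly to_ac q" \<rho>] by (simp add: ev_ac_const ev(2))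
  have "0 \<le> sd (ev ac_const ?z (coeff P j)) - sd (ev ac_const ?z r) + (int j - int (a - 1)) * sd w + sd (fls_deriv ?z)"
    by (rule regular_coeff[OF ev(1) d0 wa q(1) sq h P j])
  then have "int (a * order \<rho> (map_poly to_ac r)) + (int (a - 1) - int j) * int (order \<rho> (map_poly to_ac g))
    \<le> int (a * order \<rho> (map_poly to_ac (coeff P j))) + int (a - 1)"
    using P(3) j(2) unfolding sdd sw by (simp add: ev_ac_const ev(2) left_diff_distrib)
  then show ?thesis using a0 by (simp add: of_nat_diff)
qed

lemma degree_map_poly_to_ac: "degree (map_poly to_ac q) = degree q"
  by (simp add: degree_map_poly)

text \<open>The substitution is \<open>x = t^(-a)\<close>, under which \<open>dx\<close> becomes
  \<open>-a t^(-a-1) dt\<close>; the pole order of \<open>g\<close> is again divisible by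
  \<open>a\<close>.\<close>

lemma infinity_data:
  obtains z w where "\<And>q. q \<noteq> 0 \<Longrightarrow> ev fls_const z q \<noteq> 0"
    "\<And>q. q \<noteq> 0 \<Longrightarrow> sd (ev fls_const z q) = - int (a * degree q)"
    "fls_deriv z \<noteq> 0" "sd (fls_deriv z) = - int (Suc a)"
    "w ^ a = ev ac_const z g" "sd w = - int (degree g)"
proof -
  let ?z = "fls_X_inv ^ a :: 'p mod_ring alg_closure fls"
  have a0: "a > 0" using a by simp
  have ev: "ev fls_const ?z q \<noteq> 0" "sd (ev fls_const ?z q) = - int (a * degree q)" if q: "q \<noteq> 0" for q
  proof -
    obtain U where U: "fps_nth U 0 \<noteq> 0" "ev fls_const ?z q = fps_to_fls U * fls_X_inv ^ (a * degree q)"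
      using ev_fls_at_infinity[OF q a0] by blast
    then have "U \<noteq> 0" by auto
    then show "ev fls_const ?z q \<noteq> 0" "sd (ev fls_const ?z q) = - int (a * degree q)"
      using U by (simp_all add: fls_subdegree_unit fls_subdegree_pow)
  qed
  have d: "fls_deriv ?z = - of_nat a * fls_X_inv ^ Suc a" by (rule fls_deriv_X_inv_power)
  have ofa: "- of_nat a = (fls_const (- of_nat a) :: 'p mod_ring alg_closure fls)" by (simp add: fls_of_nat)
  have d0: "fls_deriv ?z \<noteq> 0" and sdd: "sd (fls_deriv ?z) = - int (Suc a)"
    unfolding d ofa using of_nat_a_nonzero by (simp_all add: fls_subdegree_pow del: power_Suc fls_const_uminus)
  obtain U where U: "fps_nth U 0 \<noteq> 0"
    "ev fls_const ?z (map_poly to_ac g) = fps_to_fls U * fls_X_inv ^ (a * degree g)"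
    using ev_fls_at_infinity[of "map_poly to_ac g" a] g_nonzero a0 by (auto simp: degree_map_poly_to_ac)
  obtain W where W: "W ^ a = U" "fps_nth W 0 \<noteq> 0" using fps_nth_root_exists[OF of_nat_a_nonzero U(1)] by blast
  define w where "w = fps_to_fls W * fls_X_inv ^ degree g"
  have wa: "w ^ a = ev ac_const ?z g"
    by (simp add: w_def ev_ac_const U(2) power_mult_distrib fps_to_fls_power mult.commute flip: W(1) power_mult)
  have "W \<noteq> 0" using W by auto
  then have sw: "sd w = - int (degree g)"
    by (simp add: w_def fls_subdegree_unit W(2) fls_subdegree_pow)
  show ?thesis using that[OF ev d0 sdd wa sw] by blast
qed

text \<open>Existence follows from a single embedding, and the one at infinity with
  \<open>\<zeta> = 1\<close> serves.\<close>

lemma d_dx_derivation: "is_derivation \<iota> (d_dx \<iota> x)" "d_dx \<iota> x x = 1"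
proof -
  obtain z w where zw: "\<And>q. q \<noteq> 0 \<Longrightarrow> ev fls_const z q \<noteq> 0" "fls_deriv z \<noteq> 0" "w ^ a = ev ac_const z g"
    using infinity_data by metis
  obtain \<phi> where "embedding \<phi>" using embedding_exists[OF zw, of 1] by auto
  then obtain D where "is_derivation \<iota> D" "D x = 1" by (rule embedding_derivation)
  then show "is_derivation \<iota> (d_dx \<iota> x)" "d_dx \<iota> x x = 1" using d_dx_eq by auto
qed

text \<open>The pole of order \<open>a + 1\<close> of \<open>dx\<close> in \<open>t\<close> enters
  as \<open>Suc a\<close>, which gives the strict inequality with \<open>a\<close>.\<close>

lemma regular_coeff_at_infinity:
  assumes h: "h \<in> regular_differentials \<iota> x"
    and P: "h = eval2 \<iota> x y P / (ev \<iota> x r * y ^ (a - 1))" "degree P < a" "r \<noteq> 0"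
    and j: "j < a" "coeff P j \<noteq> 0"
  shows "int (a * degree (coeff P j)) + int a < int (a * degree r) + (int (a - 1) - int j) * int (degree g)"
proof -
  obtain z w where ev: "\<And>q. q \<noteq> 0 \<Longrightarrow> ev fls_const z q \<noteq> 0"
    "\<And>q. q \<noteq> 0 \<Longrightarrow> sd (ev fls_const z q) = - int (a * degree q)"
    and d0: "fls_deriv z \<noteq> 0" and sdd: "sd (fls_deriv z) = - int (Suc a)"
    and wa: "w ^ a = ev ac_const z g" and sw: "sd w = - int (degree g)"
    by (rule infinity_data) blast
  have q1: "[:0, 1:] \<noteq> (0 :: 'p mod_ring poly)" by simp
  have sq: "sd (ev ac_const z [:0, 1:]) \<noteq> 0"
    using a by (simp add: ev_ac_const ev(2) degree_map_poly_to_ac)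
  have "0 \<le> sd (ev ac_const z (coeff P j)) - sd (ev ac_const z r) + (int j - int (a - 1)) * sd w + sd (fls_deriv z)"
    by (rule regular_coeff[OF ev(1) d0 wa q1 sq h P j])
  then have "int (a * degree (coeff P j)) + int (Suc a) \<le> int (a * degree r) + (int (a - 1) - int j) * int (degree g)"
    using P(3) j(2) unfolding sdd sw by (simp add: ev_ac_const ev(2) left_diff_distrib degree_map_poly_to_ac)
  then show ?thesis by simp
qed

end

section \<open>Regularity of the monomial differentials\<close>

text \<open>The roundings turn into strict linear inequalities: these are the lattice points inside
  the triangle with vertices \<open>(b, 0)\<close>, \<open>(b + c, 0)\<close> and
  \<open>(0, a)\<close>. For \<open>i \<le> b\<close> the lower inequality forces
  \<open>j \<ge> 1\<close>; for \<open>i > b\<close> it is automatic.\<close>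

lemma index_set_iff:
  assumes "c > 0"
  shows "(i, j) \<in> index_set a b c \<longleftrightarrow> 1 \<le> i \<and> 1 \<le> j \<and> a * b < a * i + b * j \<and> a * i + (b + c) * j < a * (b + c)"
proof -
  have up: "int j \<le> \<lceil>- (real a / real (b + c)) * real i + real a\<rceil> - 1 \<longleftrightarrow> a * i + (b + c) * j < a * (b + c)"
  proof -
    have "int j \<le> \<lceil>- (real a / real (b + c)) * real i + real a\<rceil> - 1
        \<longleftrightarrow> int j < \<lceil>- (real a / real (b + c)) * real i + real a\<rceil>" by linarith
    also have "\<dots> \<longleftrightarrow> real j < - (real a / real (b + c)) * real i + real a"
      by (simp add: less_ceiling_iff)
    also have "\<dots> \<longleftrightarrow> real a * real i + real (b + c) * real j < real a * real (b + c)"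
      using assms by (simp add: field_simps)
    also have "\<dots> \<longleftrightarrow> real (a * i + (b + c) * j) < real (a * (b + c))" by simp
    finally show ?thesis by (simp only: of_nat_less_iff)
  qed
  have low: "\<lfloor>- (real a / real b) * real i + real a\<rfloor> + 1 \<le> int j \<longleftrightarrow> a * b < a * i + b * j" if "b > 0"
  proof -
    have "\<lfloor>- (real a / real b) * real i + real a\<rfloor> + 1 \<le> int j
        \<longleftrightarrow> \<lfloor>- (real a / real b) * real i + real a\<rfloor> < int j" by linarith
    also have "\<dots> \<longleftrightarrow> - (real a / real b) * real i + real a < real j"
      by (simp add: floor_less_iff)
    also have "\<dots> \<longleftrightarrow> real a * real b < real a * real i + real b * real j"
      using that by (simp add: field_simps)
    also have "\<dots> \<longleftrightarrow> real (a * b) < real (a * i + b * j)" by simp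
    finally show ?thesis by (simp only: of_nat_less_iff)
  qed
  show ?thesis
  proof (cases "i \<le> b")
    case True
    have "j \<ge> 1" if "1 \<le> i" "a * b < a * i + b * j"
    proof (rule ccontr)
      assume "\<not> 1 \<le> j"
      then have "a * b < a * i" using that by (cases j) auto
      then show False using True by simp
    qed
    moreover have "b > 0" if "1 \<le> i" using that True by simp
    ultimately show ?thesis using True up low by (auto simp: index_set_def)
  next
    case False
    have "i \<le> b + c - 1" if "a * i + (b + c) * j < a * (b + c)"
    proof -
      have "a * i < a * (b + c)" using that by linarith
      then have "i < b + c" by simp
      then show ?thesis by linarith
    qed
    moreover have "a * b < a * i + b * j" if "1 \<le> j" "a * i + (b + c) * j < a * (b + c)"
    proof -
      have "a > 0" using that by (cases a) auto
      then have "a * b < a * i" using False by simp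
      then show ?thesis by linarith
    qed
    ultimately show ?thesis using False up by (auto simp: index_set_def)
  qed
qed

lemma index_set_bounds:
  assumes "(i, j) \<in> index_set a b c" "c > 0"
  shows "i < b + c" "j < a"
proof -
  have *: "1 \<le> i" "1 \<le> j" "a * i + (b + c) * j < a * (b + c)" using assms by (auto simp: index_set_iff)
  have "a * i < a * (b + c)" using *(3) by linarith
  then show "i < b + c" by simp
  have "(b + c) * j < (b + c) * a" using *(3) mult.commute[of a "b + c"] by linarith
  then show "j < a" by simp
qed

lemma finite_index_set: "c > 0 \<Longrightarrow> finite (index_set a b c)"
  by (rule finite_subset[of _ "{..<b + c} \<times> {..<a}"]) (auto dest: index_set_bounds)

section \<open>Valuations of polynomials in \<open>x\<close>\<close>

context place
begin

lemma v_ev_ge: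
  assumes "x \<noteq> 0" "0 \<le> v x"
  shows "ev \<iota> x q = 0 \<or> 0 \<le> v (ev \<iota> x q)"
proof -
  interpret h: field_hom \<iota> by (rule hom)
  have crh: "comm_ring_hom \<iota>" by (rule field_hom_comm_ring_hom[OF hom])
  show ?thesis unfolding ev_altdef[OF crh]
  proof (rule v_sum_ge)
    fix i assume "i \<in> {..degree q}"
    show "\<iota> (coeff q i) * x ^ i = 0 \<or> 0 \<le> v (\<iota> (coeff q i) * x ^ i)"
      using assms by (cases "coeff q i = 0") (simp_all add: v_mult v_const v_power)
  qed simp
qed

lemma v_ev_at_zero:
  assumes x: "x \<noteq> 0" "0 < v x" and q: "coeff q 0 \<noteq> 0"
  shows "ev \<iota> x q \<noteq> 0" "v (ev \<iota> x q) = 0"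
proof -
  interpret h: field_hom \<iota> by (rule hom)
  have crh: "comm_ring_hom \<iota>" by (rule field_hom_comm_ring_hom[OF hom])
  obtain d r where dr: "q = pCons d r" by (cases q)
  have d: "d \<noteq> 0" using q dr by simp
  have e: "ev \<iota> x q = \<iota> d + x * ev \<iota> x r" unfolding dr by (rule ev_pCons[OF crh])
  have "ev \<iota> x q \<noteq> 0 \<and> v (ev \<iota> x q) = 0"
  proof (cases "ev \<iota> x r = 0")
    case True
    then show ?thesis using e d v_const[OF d] by simp
  next
    case False
    then have "v (\<iota> d) < v (x * ev \<iota> x r)"
      using v_ev_ge[OF x(1), of r] x v_const[OF d] by (simp add: v_mult)
    from v_add_less[OF _ _ this] show ?thesis
      unfolding e using d x(1) False v_const[OF d] by simp
  qed
  then show "ev \<iota> x q \<noteq> 0" "v (ev \<iota> x q) = 0" by auto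
qed

text \<open>The monomials have the distinct valuations \<open>i * v x\<close>, and the leading one
  has the smallest because \<open>v x < 0\<close>.\<close>

lemma v_ev_at_infinity:
  assumes x: "x \<noteq> 0" "v x < 0" and q: "q \<noteq> 0"
  shows "ev \<iota> x q \<noteq> 0" "v (ev \<iota> x q) = int (degree q) * v x"
proof -
  interpret h: field_hom \<iota> by (rule hom)
  have crh: "comm_ring_hom \<iota>" by (rule field_hom_comm_ring_hom[OF hom])
  have vt: "v (\<iota> (coeff q i) * x ^ i) = int i * v x" if "coeff q i \<noteq> 0" for i
    using that x by (simp add: v_mult v_const v_power)
  have "(\<Sum>i\<le>degree q. \<iota> (coeff q i) * x ^ i) \<noteq> 0
    \<and> (\<exists>n\<in>{..degree q}. \<iota> (coeff q n) * x ^ n \<noteq> 0 \<and> v (\<Sum>i\<le>degree q. \<iota> (coeff q i) * x ^ i) = v (\<iota> (coeff q n) * x ^ n))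
    \<and> (\<forall>n\<in>{..degree q}. \<iota> (coeff q n) * x ^ n \<noteq> 0 \<longrightarrow> v (\<Sum>i\<le>degree q. \<iota> (coeff q i) * x ^ i) \<le> v (\<iota> (coeff q n) * x ^ n))"
  proof (rule v_sum_distinct)
    fix n m assume "n \<noteq> m" "\<iota> (coeff q n) * x ^ n \<noteq> 0" "\<iota> (coeff q m) * x ^ m \<noteq> 0"
    then show "v (\<iota> (coeff q n) * x ^ n) \<noteq> v (\<iota> (coeff q m) * x ^ m)"
      using x by (simp add: vt)
  next
    show "\<exists>n\<in>{..degree q}. \<iota> (coeff q n) * x ^ n \<noteq> 0" using x q by (intro bexI[of _ "degree q"]) auto
  qed simp
  then obtain n where n: "ev \<iota> x q \<noteq> 0" "n \<le> degree q" "coeff q n \<noteq> 0" "v (ev \<iota> x q) = int n * v x"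
    and le: "v (ev \<iota> x q) \<le> int (degree q) * v x"
  proof -
    have nz: "\<iota> (coeff q k) * x ^ k \<noteq> 0 \<longleftrightarrow> coeff q k \<noteq> 0" for k using x by simp
    note * = \<open>_ \<and> _ \<and> _\<close>[folded ev_altdef[OF crh]]
    from * obtain n where "n \<le> degree q" "coeff q n \<noteq> 0" "v (ev \<iota> x q) = v (\<iota> (coeff q n) * x ^ n)"
      unfolding nz by blast
    moreover have "v (ev \<iota> x q) \<le> v (\<iota> (coeff q (degree q)) * x ^ degree q)" using * q unfolding nz by simp
    ultimately show ?thesis using * that vt q by simp
  qed
  show "ev \<iota> x q \<noteq> 0" by (rule n)
  have "int (degree q) * v x \<le> int n * v x" using n(2) x(2) by (intro mult_right_mono_neg) auto
  then show "v (ev \<iota> x q) = int (degree q) * v x" using le n(4) by simp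
qed

end

locale superelliptic_separable = superelliptic f p a b c \<iota> x y
  for f :: "'p::prime_card mod_ring poly" and p a b c :: nat
    and \<iota> :: "'p mod_ring \<Rightarrow> 'K::field" and x y :: 'K +
  assumes coprime_pderiv: "coprime f (pderiv f)" and c_pos: "c > 0"
begin

text \<open>Regularity at \<open>v\<close> amounts to comparing \<open>v (D t)\<close> with the
  valuation of the differential. The upper bound for \<open>v (D t)\<close> comes from
  \<open>derivation_bound\<close> for \<open>x\<close>, or for \<open>y\<close> at zeros of
  \<open>f\<close>.\<close>

lemma omega_regular:
  assumes ij: "(i, j) \<in> index_set a b c"
  shows "omega a x y (i, j) \<in> regular_differentials \<iota> x"
  unfolding regular_differentials_def
proof (intro CollectI allI impI)
  fix v t assume vt: "is_place \<iota> v \<and> t \<noteq> 0 \<and> v t = 1"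
  interpret char_p_place p \<iota> v x t
    by unfold_locales (use vt span_x hom in auto)
  define D where "D = d_dx \<iota> x"
  have D: "is_derivation \<iota> D" "D x = 1" unfolding D_def by (fact d_dx_derivation)+
  have i1: "1 \<le> i" and j1: "1 \<le> j" and low: "a * b < a * i + b * j" and up: "a * i + (b + c) * j < a * (b + c)"
    using ij c_pos by (auto simp: index_set_iff)
  obtain s where s: "D x = D t * s" "s = 0 \<or> v x - 1 \<le> v s \<and> (0 \<le> v x \<longrightarrow> 0 \<le> v s)"
    using derivation_bound[OF D(1) x_nonzero] by blast
  then have st: "s \<noteq> 0" "D t \<noteq> 0" using D(2) by auto
  then have "v s = - v (D t)" using s(1) D(2) v_mult[of "D t" s] by simp
  then have bx: "v (D t) \<le> 1 - v x" "0 \<le> v x \<Longrightarrow> v (D t) \<le> 0" using s(2) st(1) by auto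
  have fnz: "ev \<iota> x f \<noteq> 0" using f by (intro ev_nonzero) auto
  have avy: "int a * v y = int b * v x + v (ev \<iota> x f)"
  proof -
    have "v (y ^ a) = v (x ^ b * ev \<iota> x f)" by (simp add: curve_eq ev_g)
    then show ?thesis using fnz x_nonzero y_nonzero by (simp add: v_mult v_power)
  qed
  have omega: "omega a x y (i, j) \<noteq> 0" "v (omega a x y (i, j)) = (int i - 1) * v x + (int j - int a) * v y"
    using x_nonzero y_nonzero i1 j1 a
    by (simp_all add: omega_def v_divide v_mult v_power of_nat_diff algebra_simps)
  have ja: "j < a" using index_set_bounds(2)[OF ij c_pos] .
  have main: "v (D t) \<le> v (omega a x y (i, j))"
  proof (cases "v x < 0")
    \<comment> \<open>A pole of \<open>x\<close>: the upper inequality of the index set, multiplied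
      by the negative \<open>v x\<close>, gives the bound.\<close>
    case True
    have "v (ev \<iota> x f) = int c * v x" using v_ev_at_infinity(2)[OF x_nonzero True, of f] f by (cases "f = 0") auto
    then have "int a * v y = int (b + c) * v x" using avy by (simp add: algebra_simps)
    then have "int a * (int i * v x + (int j - int a) * v y) = (int a * int i + int (b + c) * int j - int a * int (b + c)) * v x"
      by (simp only: distrib_left mult.left_commute[of "int a"] ) (simp add: algebra_simps)
    also have "\<dots> > 0"
    proof (rule mult_neg_neg[OF _ True])
      have "int (a * i + (b + c) * j) < int (a * (b + c))" using up by (simp only: of_nat_less_iff)
      then show "int a * int i + int (b + c) * int j - int a * int (b + c) < 0" by (simp only: of_nat_mult of_nat_add)
    qed
    finally have "0 < int i * v x + (int j - int a) * v y" using a by (simp add: zero_less_mult_iff)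
    then show ?thesis using bx(1) omega(2) by (simp add: algebra_simps)
  next
    case False
    then have vx: "0 \<le> v x" by simp
    have vf: "0 \<le> v (ev \<iota> x f)" using v_ev_ge[OF x_nonzero vx, of f] fnz by simp
    have "0 \<le> int a * v y" using avy vf vx by simp
    then have vy: "0 \<le> v y" using a by (simp add: zero_le_mult_iff)
    show ?thesis
    proof (cases "v y = 0")
      case True
      have "0 \<le> (int i - 1) * v x" using i1 vx by simp
      then show ?thesis using bx(2)[OF vx] omega(2) True by simp
    next
      case False
      then have vy: "0 < v y" using vy by simp
      show ?thesis
      proof (cases "v x = 0")
        \<comment> \<open>A common zero of \<open>x\<close> and \<open>y\<close>: \<open>f\<close>
          is a unit there, and the lower inequality of the index set, multiplied by
          \<open>v x\<close>, gives the bound.\<close>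
        case False
        then have vx: "0 < v x" using vx by simp
        have "v (ev \<iota> x f) = 0" using v_ev_at_zero(2)[OF x_nonzero vx] f by simp
        then have "int a * v y = int b * v x" using avy by simp
        then have "int a * (int i * v x + (int j - int a) * v y) = (int a * int i + int b * int j - int a * int b) * v x"
          by (simp only: distrib_left mult.left_commute[of "int a"]) (simp add: algebra_simps)
        also have "\<dots> > 0"
        proof (rule mult_pos_pos[OF _ vx])
          have "int (a * b) < int (a * i + b * j)" using low by (simp only: of_nat_less_iff)
          then show "0 < int a * int i + int b * int j - int a * int b" by simp
        qed
        finally have "0 < int i * v x + (int j - int a) * v y" using a by (simp add: zero_less_mult_iff)
        then show ?thesis using bx(1) omega(2) by (simp add: algebra_simps)
      next
        \<comment> \<open>A zero of \<open>f\<close> where \<open>x\<close> is a unit. Such a zero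
          is simple, so \<open>g'\<close> is a unit and the equation of the curve yields
          \<open>v (D y) = - (a - 1) * v y\<close>. The bound through \<open>y\<close> then leaves
          only \<open>j * v y \<ge> 1\<close> to check.\<close>
        case True
        have vf: "0 < v (ev \<iota> x f)" 
        proof -
          have "0 < int a * v y" using vy a by simp
          then show ?thesis using avy True by simp
        qed
        have f': "ev \<iota> x (pderiv f) \<noteq> 0 \<and> v (ev \<iota> x (pderiv f)) = 0"
        proof (rule ccontr)
          assume neg: "\<not> ?thesis"
          obtain q r where qr: "q * f + r * pderiv f = 1"
            using coprime_pderiv bezout_coefficients_fst_snd[of f "pderiv f"] by (metis coprime_imp_gcd_eq_1)
          have e: "ev \<iota> x q * ev \<iota> x f + ev \<iota> x r * ev \<iota> x (pderiv f) = 1"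
            using arg_cong[OF qr, of "ev \<iota> x"] by (simp add: e1.hom_add e1.hom_mult)
          have ge: "ev \<iota> x u = 0 \<or> 0 \<le> v (ev \<iota> x u)" for u by (rule v_ev_ge[OF x_nonzero vx])
          have 1: "ev \<iota> x q * ev \<iota> x f = 0 \<or> 1 \<le> v (ev \<iota> x q * ev \<iota> x f)"
            using ge[of q] vf fnz by (cases "ev \<iota> x q = 0") (auto simp: v_mult)
          have 2: "ev \<iota> x r * ev \<iota> x (pderiv f) = 0 \<or> 1 \<le> v (ev \<iota> x r * ev \<iota> x (pderiv f))"
            using ge[of r] ge[of "pderiv f"] neg
            by (cases "ev \<iota> x r = 0 \<or> ev \<iota> x (pderiv f) = 0") (auto simp: v_mult)
          show False
            using 1 2 e v_add[of "ev \<iota> x q * ev \<iota> x f" "ev \<iota> x r * ev \<iota> x (pderiv f)"]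
            by (cases "ev \<iota> x q * ev \<iota> x f = 0"; cases "ev \<iota> x r * ev \<iota> x (pderiv f) = 0") auto
        qed
        have g': "ev \<iota> x (pderiv g) \<noteq> 0 \<and> v (ev \<iota> x (pderiv g)) = 0"
        proof -
          have e: "ev \<iota> x (pderiv g) = x ^ b * ev \<iota> x (pderiv f) + ev \<iota> x f * ev \<iota> x (pderiv (monom 1 b))"
            by (simp add: g_def pderiv_mult e1.hom_add e1.hom_mult ev_monom[OF crh])
          have v1: "x ^ b * ev \<iota> x (pderiv f) \<noteq> 0" "v (x ^ b * ev \<iota> x (pderiv f)) = 0"
            using f' x_nonzero True by (simp_all add: v_mult v_power)
          show ?thesis
          proof (cases "ev \<iota> x (pderiv (monom 1 b)) = 0")
            case True then show ?thesis using e v1 by simp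
          next
            case False
            then have "v (x ^ b * ev \<iota> x (pderiv f)) < v (ev \<iota> x f * ev \<iota> x (pderiv (monom 1 b)))"
              using v_ev_ge[OF x_nonzero vx, of "pderiv (monom 1 b)"] vf fnz v1 by (simp add: v_mult)
            from v_add_less[OF v1(1) _ this] show ?thesis unfolding e using v1 False fnz by simp
          qed
        qed
        have "of_nat a * y ^ (a - 1) * D y = ev \<iota> x (pderiv g)"
        proof -
          have "D (y ^ a) = D (ev \<iota> x g)" by (simp add: curve_eq)
          then show ?thesis by (simp add: derivation_power[OF D(1)] derivation_ev[OF D(1) crh] D(2))
        qed
        moreover have va: "of_nat a \<noteq> (0::'K)" "v (of_nat a) = 0"
        proof -
          show "of_nat a \<noteq> (0::'K)" using of_nat_nonzero[of a] a by simp
          then have "of_nat a \<noteq> (0::'p mod_ring)" using h.hom_of_nat[of a] by (metis h.hom_zero)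
          then show "v (of_nat a) = 0" using v_const[of "of_nat a"] by (simp add: h.hom_of_nat)
        qed
        ultimately have Dy: "D y \<noteq> 0" using g' by auto
        have "v (of_nat a * y ^ (a - 1) * D y) = 0" using g' \<open>of_nat a * y ^ (a - 1) * D y = _\<close> by simp
        then have vDy: "v (D y) = - ((int a - 1) * v y)"
          using Dy va y_nonzero a by (simp add: v_mult v_power of_nat_diff)
        obtain s' where s': "D y = D t * s'" "s' = 0 \<or> v y - 1 \<le> v s' \<and> (0 \<le> v y \<longrightarrow> 0 \<le> v s')"
          using derivation_bound[OF D(1) y_nonzero] by blast
        have s'0: "s' \<noteq> 0" using Dy s'(1) by auto
        have "v (D y) = v (D t) + v s'" using s'(1) v_mult[OF st(2) s'0] by simp
        then have "v (D t) \<le> - ((int a - 1) * v y) - (v y - 1)" using vDy s'(2) s'0 by simp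
        also have "\<dots> = 1 - int a * v y" by (simp add: algebra_simps)
        also have "\<dots> \<le> (int j - int a) * v y"
        proof -
          have "1 * 1 \<le> int j * v y" using j1 vy by (intro mult_mono) auto
          then show ?thesis by (simp add: algebra_simps)
        qed
        finally show ?thesis using omega(2) True by simp
      qed
    qed
  qed
  show "\<exists>u. (u = 0 \<or> 0 \<le> v u) \<and> omega a x y (i, j) = u * d_dx \<iota> x t"
    using main omega(1) st(2) v_divide[OF omega(1) st(2)]
    by (intro exI[of _ "omega a x y (i, j) / D t"]) (auto simp: D_def)
qed

end

section \<open>The basis of monomial differentials\<close>

context superelliptic_separable
begin

lemma degree_g: "degree g = b + c"
  using f by (cases "f = 0") (simp_all add: g_def degree_mult_eq monom_eq_0_iff degree_monom_eq)

lemma order_0_g: "b \<le> order 0 (map_poly to_ac g)"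
proof -
  interpret ta: field_hom "to_ac :: 'p mod_ring \<Rightarrow> 'p mod_ring alg_closure"
    by unfold_locales simp_all
  have "monom 1 b dvd map_poly to_ac g"
    unfolding monom_1_dvd_iff' by (simp add: coeff_map_poly g_def coeff_monom_mult)
  then have "[:-0, 1:] ^ b dvd map_poly to_ac g" by (simp add: monom_altdef)
  then show ?thesis using g_nonzero order_divides[of 0 b "map_poly to_ac g :: 'p mod_ring alg_closure poly"] by simp
qed

text \<open>After division by the gcd, a root of the cofactor of \<open>r\<close> would not be a
  root of the cofactor of \<open>A\<close>, against the hypothesis on orders; so the cofactor of
  \<open>r\<close> is constant. The gcd is formed over the base field, where the conclusion
  lies.\<close>

lemma dvd_if_order_le:
  assumes "A \<noteq> 0" "r \<noteq> 0" and ord: "\<And>\<rho>. order \<rho> (map_poly to_ac r) \<le> order \<rho> (map_poly to_ac A)"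
  shows "(r :: 'p mod_ring poly) dvd A"
proof -
  interpret ta: field_hom "to_ac :: 'p mod_ring \<Rightarrow> 'p mod_ring alg_closure"
    by unfold_locales simp_all
  interpret mp: map_poly_comm_ring_hom "to_ac :: 'p mod_ring \<Rightarrow> 'p mod_ring alg_closure" ..
  define d where "d = gcd A r"
  have d0: "d \<noteq> 0" using assms(1) by (simp add: d_def)
  obtain A1 r1 where A1: "A = d * A1" and r1: "r = d * r1" and "coprime A1 r1"
    using gcd_coprime_exists[of A r] d0 unfolding d_def by (metis mult.commute)
  then have "gcd A1 r1 = 1" by simp
  then obtain u w where uw: "u * A1 + w * r1 = 1" using bezout_coefficients_fst_snd[of A1 r1] by metis
  have "degree r1 = 0"
  proof (rule ccontr)
    assume deg: "degree r1 \<noteq> 0"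
    then have "degree (map_poly to_ac r1) > 0" by (simp add: degree_map_poly_to_ac)
    then obtain \<rho> where \<rho>: "poly (map_poly to_ac r1) \<rho> = 0" using alg_closed_imp_poly_has_root by blast
    have r10: "r1 \<noteq> 0" using deg by auto
    have A10: "A1 \<noteq> 0" using A1 assms(1) by auto
    have "poly (map_poly to_ac (u * A1 + w * r1)) \<rho> = 1" by (simp add: uw)
    then have "poly (map_poly to_ac A1) \<rho> \<noteq> 0" using \<rho> by (auto simp: mp.hom_add mp.hom_mult)
    then have "order \<rho> (map_poly to_ac A1) = 0" by (simp add: order_root)
    moreover have "order \<rho> (map_poly to_ac r1) > 0" using \<rho> r10 by (simp add: order_root)
    ultimately show False
      using ord[of \<rho>] d0 A10 r10 by (simp add: A1 r1 mp.hom_mult order_mult)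
  qed
  then obtain e where e: "r1 = [:e:]" by (rule degree_eq_zeroE)
  have "e \<noteq> 0" using e r1 assms(2) by auto
  then have "A = r * smult (1 / e) A1" using e r1 A1 by simp
  then show ?thesis by (rule dvdI)
qed

text \<open>The bounds at the affine points show that \<open>r\<close> divides every coefficient of
  \<open>P\<close>. The bounds at \<open>0\<close> and at infinity then become the two inequalities
  of the index set.\<close>

lemma regular_omega_expansion:
  assumes h: "h \<in> regular_differentials \<iota> x"
  obtains B where "h = (\<Sum>j<a. \<Sum>i\<le>degree (B j). \<iota> (coeff (B j) i) * omega a x y (Suc i, Suc j))"
    "\<And>i j. j < a \<Longrightarrow> coeff (B j) i \<noteq> 0 \<Longrightarrow> (Suc i, Suc j) \<in> index_set a b c"
proof -
  have degF: "degree F > 0" using a by (simp add: degree_F)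
  obtain P r where P: "degree P < a" "r \<noteq> 0" "ev \<iota> x r \<noteq> 0" "h * y ^ (a - 1) = eval2 \<iota> x y P / ev \<iota> x r"
    using function_field_repr[OF curve irred degF, of "h * y ^ (a - 1)"] unfolding degree_F by metis
  have hP: "h = eval2 \<iota> x y P / (ev \<iota> x r * y ^ (a - 1))"
    using P(3,4) y_nonzero by (simp add: field_simps)
  have dvd: "r dvd coeff P j" if j: "j < a" for j
  proof (cases "coeff P j = 0")
    case False
    show ?thesis
    proof (rule dvd_if_order_le[OF False P(2)])
      fix \<rho>
      have "0 \<le> (int (a - 1) - int j) * int (order \<rho> (map_poly to_ac g))" using j by simp
      then have "int (a * order \<rho> (map_poly to_ac r)) < int (a * order \<rho> (map_poly to_ac (coeff P j))) + int a"
        using regular_coeff_at_point[OF h hP P(1,2) j False, of \<rho>] by linarith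
      then have "a * order \<rho> (map_poly to_ac r) < a * Suc (order \<rho> (map_poly to_ac (coeff P j)))"
        by (simp only: mult_Suc_right)
      then have "order \<rho> (map_poly to_ac r) < Suc (order \<rho> (map_poly to_ac (coeff P j)))"
        by (simp only: mult_less_cancel1)
      then show "order \<rho> (map_poly to_ac r) \<le> order \<rho> (map_poly to_ac (coeff P j))" by simp
    qed
  qed simp
  define B where "B j = coeff P j div r" for j
  have PB: "coeff P j = r * B j" if "j < a" for j using dvd[OF that] by (simp add: B_def)
  interpret ta: field_hom "to_ac :: 'p mod_ring \<Rightarrow> 'p mod_ring alg_closure"
    by unfold_locales simp_all
  interpret mp: map_poly_comm_ring_hom "to_ac :: 'p mod_ring \<Rightarrow> 'p mod_ring alg_closure" ..
  show ?thesis
  proof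
    have "eval2 \<iota> x y P = (\<Sum>j<a. ev \<iota> x (coeff P j) * y ^ j)"
      unfolding eval2_ev by (rule ev_altdef'[OF comm_ring_hom_ev[OF crh] P(1)])
    also have "\<dots> = ev \<iota> x r * (\<Sum>j<a. ev \<iota> x (B j) * y ^ j)"
      unfolding sum_distrib_left by (rule sum.cong[OF refl]) (simp add: PB e1.hom_mult)
    finally have "h = (\<Sum>j<a. ev \<iota> x (B j) * y ^ j) / y ^ (a - 1)" unfolding hP using P(3) by simp
    also have "\<dots> = (\<Sum>j<a. \<Sum>i\<le>degree (B j). \<iota> (coeff (B j) i) * omega a x y (Suc i, Suc j))"
      unfolding sum_divide_distrib ev_altdef[OF crh] sum_distrib_right omega_def by (simp add: mult.assoc)
    finally show "h = (\<Sum>j<a. \<Sum>i\<le>degree (B j). \<iota> (coeff (B j) i) * omega a x y (Suc i, Suc j))" .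
  next
    fix i j assume j: "j < a" and nz: "coeff (B j) i \<noteq> 0"
    have Bj: "B j \<noteq> 0" using nz by auto
    then have Pj: "coeff P j \<noteq> 0" using PB[OF j] P(2) by simp
    \<comment> \<open>A nonzero coefficient at \<open>x^i\<close> forces the order at
      \<open>0\<close> to be at most \<open>i\<close>; this links the single monomial to the local
      bound.\<close>
    have i_ord: "order 0 (map_poly to_ac (B j)) \<le> i"
    proof (rule ccontr)
      assume "\<not> ?thesis"
      then have "[:-0, 1:] ^ Suc i dvd map_poly to_ac (B j)" by (intro order_divides[THEN iffD2]) simp
      then have "monom 1 (Suc i) dvd map_poly to_ac (B j)" by (simp add: monom_altdef del: power_Suc)
      then have "coeff (map_poly to_ac (B j)) i = 0" unfolding monom_1_dvd_iff' by simp
      then show False using nz by (simp add: coeff_map_poly)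
    qed
    have "int (a * order 0 (map_poly to_ac r)) + (int (a - 1) - int j) * int (order 0 (map_poly to_ac g))
      < int (a * (order 0 (map_poly to_ac r) + order 0 (map_poly to_ac (B j)))) + int a"
      using regular_coeff_at_point[OF h hP P(1,2) j Pj, of 0] P(2) Bj
      by (simp add: PB[OF j] mp.hom_mult order_mult)
    moreover have "(int (a - 1) - int j) * int b \<le> (int (a - 1) - int j) * int (order 0 (map_poly to_ac g))"
      using order_0_g j by (intro mult_left_mono) auto
    moreover have "int (a * order 0 (map_poly to_ac (B j))) \<le> int (a * i)"
      unfolding of_nat_le_iff using i_ord by (rule mult_le_mono2)
    ultimately have 1: "(int (a - 1) - int j) * int b < int (a * i) + int a"
      unfolding of_nat_mult of_nat_add distrib_left by linarith
    have "int (a * (degree r + degree (B j))) + int a < int (a * degree r) + (int (a - 1) - int j) * int (b + c)"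
      using regular_coeff_at_infinity[OF h hP P(1,2) j Pj] P(2) Bj
      by (simp add: PB[OF j] degree_mult_eq degree_g)
    moreover have "int (a * i) \<le> int (a * degree (B j))"
      unfolding of_nat_le_iff using le_degree[OF nz] by (rule mult_le_mono2)
    ultimately have 2: "int (a * i) + int a < (int (a - 1) - int j) * int (b + c)"
      unfolding of_nat_mult of_nat_add distrib_left by linarith
    have e: "int (a - 1) - int j = int a - int (Suc j)" using a by simp
    have "int (a * b) < int (a * Suc i + b * Suc j)" using 1 unfolding e by (simp add: algebra_simps)
    moreover have "int (a * Suc i + (b + c) * Suc j) < int (a * (b + c))" using 2 unfolding e by (simp add: algebra_simps)
    ultimately show "(Suc i, Suc j) \<in> index_set a b c"
      unfolding index_set_iff[OF c_pos] of_nat_less_iff by simp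
  qed
qed

text \<open>Multiplied by \<open>y ^ (a - 1)\<close>, a linear relation becomes a polynomial of
  degree below \<open>a\<close> in \<open>y\<close> that vanishes on the curve, hence the zero
  polynomial.\<close>

lemma omega_independent:
  assumes "(\<Sum>r\<in>index_set a b c. \<iota> (u r) * omega a x y r) = 0" "r \<in> index_set a b c"
  shows "u r = 0"
proof -
  let ?I = "index_set a b c"
  have fin: "finite ?I" by (rule finite_index_set[OF c_pos])
  define Q where "Q = (\<Sum>(i, j)\<in>?I. monom (monom (u (i, j)) (i - 1)) (j - 1))"
  have "eval2 \<iota> x y Q = (\<Sum>r\<in>?I. \<iota> (u r) * omega a x y r) * y ^ (a - 1)"
    unfolding Q_def e2.hom_sum sum_distrib_right
    by (rule sum.cong[OF refl]) (use y_nonzero in \<open>auto simp: omega_def eval2_monom[OF crh] ev_monom[OF crh]\<close>)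
  then have "eval2 \<iota> x y Q = 0" using assms(1) by simp
  moreover have "degree Q < a"
  proof -
    have "degree Q \<le> a - 1" unfolding Q_def
    proof (rule degree_sum_le[OF fin])
      fix q assume "q \<in> ?I"
      then obtain i j where q: "q = (i, j)" "j < a" using index_set_bounds(2)[OF _ c_pos] by (cases q) blast
      have "degree (monom (monom (u (i, j)) (i - 1)) (j - 1)) \<le> j - 1" by (rule degree_monom_le)
      then show "degree (case q of (i, j) \<Rightarrow> monom (monom (u (i, j)) (i - 1)) (j - 1)) \<le> a - 1" using q by simp
    qed
    then show ?thesis using a by simp
  qed
  ultimately have Q0: "Q = 0" using eval2_nonzero by blast
  obtain i j where r: "r = (i, j)" by (cases r)
  have ij: "1 \<le> i" "1 \<le> j" using assms(2) c_pos by (auto simp: r index_set_iff)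
  have "coeff (coeff Q (j - 1)) (i - 1) = (\<Sum>q\<in>?I. if q = (i, j) then u q else 0)"
    unfolding Q_def coeff_sum
  proof (rule sum.cong[OF refl])
    fix q assume "q \<in> ?I"
    then obtain i' j' where q: "q = (i', j')" "1 \<le> i'" "1 \<le> j'" using c_pos by (cases q) (auto simp: index_set_iff)
    then have "i' - 1 = i - 1 \<longleftrightarrow> i' = i" "j' - 1 = j - 1 \<longleftrightarrow> j' = j" using ij by auto
    then show "coeff (coeff (case q of (i, j) \<Rightarrow> monom (monom (u (i, j)) (i - 1)) (j - 1)) (j - 1)) (i - 1) = (if q = (i, j) then u q else 0)"
      using q(1) by simp
  qed
  also have "\<dots> = u (i, j)" using fin assms(2) r by simp
  finally show ?thesis by (simp add: Q0 r)
qed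

lemma omega_basis: "is_basis_family \<iota> (regular_differentials \<iota> x) (index_set a b c) (omega a x y)"
proof -
  let ?I = "index_set a b c" and ?w = "omega a x y"
  have fin: "finite ?I" by (rule finite_index_set[OF c_pos])
  interpret W: vector_space "\<lambda>d z. \<iota> d * z"
    by unfold_locales (simp_all add: h.hom_add h.hom_mult algebra_simps)
  have inj: "inj_on ?w ?I"
  proof (rule inj_onI, rule ccontr)
    fix r s assume rs: "r \<in> ?I" "s \<in> ?I" "?w r = ?w s" "r \<noteq> s"
    define u where "u q = (if q = r then 1 else if q = s then -1 else (0 :: 'p mod_ring))" for q
    have "(\<Sum>q\<in>?I. \<iota> (u q) * ?w q) = (\<Sum>q\<in>?I. (if q = r then ?w r else 0) - (if q = s then ?w s else 0))"
      by (rule sum.cong[OF refl]) (use rs(4) in \<open>auto simp: u_def h.hom_uminus\<close>)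
    also have "\<dots> = 0" using fin rs by (simp add: sum_subtractf)
    finally have "u r = 0" using omega_independent rs(1) by blast
    then show False by (simp add: u_def)
  qed
  moreover have "\<not> W.dependent (?w ` ?I)"
  proof
    assume "W.dependent (?w ` ?I)"
    then obtain u where u: "\<exists>z\<in>?w ` ?I. u z \<noteq> 0" "(\<Sum>z\<in>?w ` ?I. \<iota> (u z) * z) = 0"
      using fin by (auto simp: W.dependent_finite)
    then have "(\<Sum>r\<in>?I. \<iota> (u (?w r)) * ?w r) = 0" by (simp add: sum.reindex[OF inj])
    then show False using omega_independent[of "\<lambda>r. u (?w r)"] u(1) by blast
  qed
  moreover have "W.span (?w ` ?I) = regular_differentials \<iota> x"
  proof
    have sub: "W.subspace (regular_differentials \<iota> x)"
    proof (rule W.subspaceI)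
      show "0 \<in> regular_differentials \<iota> x" by (auto simp: regular_differentials_def intro!: exI[of _ 0])
    next
      fix h1 h2 assume h12: "h1 \<in> regular_differentials \<iota> x" "h2 \<in> regular_differentials \<iota> x"
      show "h1 + h2 \<in> regular_differentials \<iota> x" unfolding regular_differentials_def
      proof (intro CollectI allI impI)
        fix v t assume vt: "is_place \<iota> v \<and> t \<noteq> 0 \<and> v t = 1"
        interpret place \<iota> v by unfold_locales (use vt hom in auto)
        obtain u1 u2 where u: "u1 = 0 \<or> 0 \<le> v u1" "h1 = u1 * d_dx \<iota> x t" "u2 = 0 \<or> 0 \<le> v u2" "h2 = u2 * d_dx \<iota> x t"
          using h12 vt by (simp add: regular_differentials_def) metis
        have "u1 + u2 = 0 \<or> 0 \<le> v (u1 + u2)"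
          using u(1,3) v_add[of u1 u2] by (cases "u1 = 0"; cases "u2 = 0"; cases "u1 + u2 = 0") auto
        then show "\<exists>u. (u = 0 \<or> 0 \<le> v u) \<and> h1 + h2 = u * d_dx \<iota> x t"
          using u by (intro exI[of _ "u1 + u2"]) (simp add: algebra_simps)
      qed
    next
      fix d h1 assume h1: "h1 \<in> regular_differentials \<iota> x"
      show "\<iota> d * h1 \<in> regular_differentials \<iota> x" unfolding regular_differentials_def
      proof (intro CollectI allI impI)
        fix v t assume vt: "is_place \<iota> v \<and> t \<noteq> 0 \<and> v t = 1"
        interpret place \<iota> v by unfold_locales (use vt hom in auto)
        obtain u1 where u: "u1 = 0 \<or> 0 \<le> v u1" "h1 = u1 * d_dx \<iota> x t"
          using h1 vt by (auto simp: regular_differentials_def)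
        have "\<iota> d * u1 = 0 \<or> 0 \<le> v (\<iota> d * u1)"
          using u(1) by (cases "d = 0"; cases "u1 = 0") (auto simp: v_mult v_const)
        then show "\<exists>u. (u = 0 \<or> 0 \<le> v u) \<and> \<iota> d * h1 = u * d_dx \<iota> x t"
          using u by (intro exI[of _ "\<iota> d * u1"]) simp
      qed
    qed
    show "W.span (?w ` ?I) \<subseteq> regular_differentials \<iota> x"
      by (rule W.span_minimal[OF _ sub]) (use omega_regular in auto)
    show "regular_differentials \<iota> x \<subseteq> W.span (?w ` ?I)"
    proof
      fix h assume "h \<in> regular_differentials \<iota> x"
      then obtain B where B: "h = (\<Sum>j<a. \<Sum>i\<le>degree (B j). \<iota> (coeff (B j) i) * ?w (Suc i, Suc j))"
        "\<And>i j. j < a \<Longrightarrow> coeff (B j) i \<noteq> 0 \<Longrightarrow> (Suc i, Suc j) \<in> ?I"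
        by (rule regular_omega_expansion) blast
      have "\<iota> (coeff (B j) i) * ?w (Suc i, Suc j) \<in> W.span (?w ` ?I)" if "j < a" for i j
      proof (cases "coeff (B j) i = 0")
        case True then show ?thesis by (simp add: W.span_zero)
      next
        case False
        then show ?thesis by (intro W.span_scale W.span_base imageI B(2)[OF that])
      qed
      then show "h \<in> W.span (?w ` ?I)" unfolding B(1) by (intro W.span_sum) auto
    qed
  qed
  ultimately show ?thesis by (simp add: is_basis_family_def)
qed

end

section \<open>The Cartier operator\<close>

lemma coeff_monom_mult_power:
  fixes f :: "'a::comm_ring_1 poly"
  assumes "degree f \<le> c"
  shows "coeff (monom 1 s * f ^ v) n =
    (\<Sum>k | k \<in> multi_indices {..c} v \<and> s + (\<Sum>l\<le>c. l * k l) = n.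
      of_nat (fact v div (\<Prod>l\<le>c. fact (k l))) * (\<Prod>l\<le>c. coeff f l ^ k l))"
proof -
  have fin: "finite (multi_indices {..c} v)" by (rule finite_multi_indices) simp
  have "f = (\<Sum>l\<le>c. monom (coeff f l) l)"
    by (rule poly_eqI) (use assms in \<open>simp add: coeff_sum coeff_eq_0\<close>)
  then have "f ^ v = (\<Sum>l\<le>c. monom (coeff f l) l) ^ v" by simp
  also have "\<dots> = (\<Sum>k\<in>multi_indices {..c} v.
      of_nat (fact v div (\<Prod>l\<le>c. fact (k l))) * (\<Prod>l\<le>c. monom (coeff f l) l ^ k l))"
    by (rule multinomial_theorem) simp
  also have "\<dots> = (\<Sum>k\<in>multi_indices {..c} v.
      monom (of_nat (fact v div (\<Prod>l\<le>c. fact (k l))) * (\<Prod>l\<le>c. coeff f l ^ k l)) (\<Sum>l\<le>c. l * k l))"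
  proof (rule sum.cong[OF refl])
    fix k
    have "(\<Prod>l\<in>A. monom (coeff f l) l ^ k l) = monom (\<Prod>l\<in>A. coeff f l ^ k l) (\<Sum>l\<in>A. l * k l)" if "finite A" for A
      using that by (induction A) (simp_all add: monom_power mult_monom)
    then show "of_nat (fact v div (\<Prod>l\<le>c. fact (k l))) * (\<Prod>l\<le>c. monom (coeff f l) l ^ k l)
      = monom (of_nat (fact v div (\<Prod>l\<le>c. fact (k l))) * (\<Prod>l\<le>c. coeff f l ^ k l)) (\<Sum>l\<le>c. l * k l)"
      by (simp add: of_nat_poly smult_monom)
  qed
  finally have "monom 1 s * f ^ v = (\<Sum>k\<in>multi_indices {..c} v.
      monom (of_nat (fact v div (\<Prod>l\<le>c. fact (k l))) * (\<Prod>l\<le>c. coeff f l ^ k l)) (s + (\<Sum>l\<le>c. l * k l)))"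
    by (simp add: sum_distrib_left mult_monom)
  then have "coeff (monom 1 s * f ^ v) n = (\<Sum>k\<in>multi_indices {..c} v.
      if s + (\<Sum>l\<le>c. l * k l) = n then of_nat (fact v div (\<Prod>l\<le>c. fact (k l))) * (\<Prod>l\<le>c. coeff f l ^ k l) else 0)"
    by (simp add: coeff_sum)
  also have "\<dots> = (\<Sum>k | k \<in> multi_indices {..c} v \<and> s + (\<Sum>l\<le>c. l * k l) = n.
      of_nat (fact v div (\<Prod>l\<le>c. fact (k l))) * (\<Prod>l\<le>c. coeff f l ^ k l))"
    using fin by (intro sum.inter_filter[symmetric])
  finally show ?thesis .
qed

lemma of_nat_mult_diff: "m \<le> n \<Longrightarrow> of_nat (k * (n - m)) = (of_nat k * (of_nat n - of_nat m) :: 'a::comm_ring_1)"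
  by (simp only: of_nat_mult of_nat_diff)

text \<open>The conditions on the tuples select the terms of degree \<open>p * i' - 1\<close> in the
  multinomial expansion of \<open>x^(i-1) (x^b f)^v\<close>, the degrees from which the Cartier
  operator takes its value. In the equation for \<open>v\<close> the only subtraction is
  \<open>a - j'\<close>, which is safe on natural numbers.\<close>

lemma hasse_witt_entry_coeff:
  fixes f :: "'k::field poly"
  assumes "degree f \<le> c" "a > 0" "j' \<le> a" and v: "a * v + a = j + p * (a - j')"
    and i: "1 \<le> i" "1 \<le> p * i'"
  shows "hasse_witt_entry p a b c f (i, j) (i', j') = coeff (monom 1 (i - 1 + b * v) * f ^ v) (p * i' - 1)"
proof -
  have "(of_nat (a * v + a) :: rat) = of_nat (j + p * (a - j'))" using v by simp
  then have "(of_nat j - of_nat a + of_nat p * (of_nat a - of_nat j')) = (of_nat a * of_nat v :: rat)"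
    unfolding of_nat_add of_nat_mult_diff[OF assms(3)] by (simp add: algebra_simps)
  then have v': "(of_nat j - of_nat a + of_nat p * (of_nat a - of_nat j')) / of_nat a = (of_nat v :: rat)"
    using assms(2) by simp
  have set: "{k. k \<in> ({..c} \<rightarrow>\<^sub>E UNIV) \<and> of_nat (\<Sum>l\<le>c. k l) = (of_nat v :: rat) \<and>
      of_nat (p * i') = of_nat b * (of_nat v :: rat) + of_nat (\<Sum>l\<le>c. l * k l) + of_nat i}
    = {k. k \<in> multi_indices {..c} v \<and> i - 1 + b * v + (\<Sum>l\<le>c. l * k l) = p * i' - 1}"
  proof (rule Collect_cong)
    fix k
    have "of_nat (p * i') = of_nat b * (of_nat v :: rat) + of_nat (\<Sum>l\<le>c. l * k l) + of_nat i
      \<longleftrightarrow> (of_nat (p * i') :: rat) = of_nat (b * v + (\<Sum>l\<le>c. l * k l) + i)" by simp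
    also have "\<dots> \<longleftrightarrow> p * i' = b * v + (\<Sum>l\<le>c. l * k l) + i" by (rule of_nat_eq_iff)
    also have "\<dots> \<longleftrightarrow> i - 1 + b * v + (\<Sum>l\<le>c. l * k l) = p * i' - 1" using i by linarith
    finally show "(k \<in> ({..c} \<rightarrow>\<^sub>E UNIV) \<and> of_nat (\<Sum>l\<le>c. k l) = (of_nat v :: rat) \<and>
      of_nat (p * i') = of_nat b * (of_nat v :: rat) + of_nat (\<Sum>l\<le>c. l * k l) + of_nat i)
      \<longleftrightarrow> (k \<in> multi_indices {..c} v \<and> i - 1 + b * v + (\<Sum>l\<le>c. l * k l) = p * i' - 1)"
      unfolding multi_indices_def mem_Collect_eq of_nat_eq_iff by blast
  qed
  show ?thesis
    unfolding hasse_witt_entry_def prod.case Let_def v' set coeff_monom_mult_power[OF assms(1)]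
    by (rule sum.cong[OF refl]) (auto simp: multinomial_bracket_def multi_indices_def)
qed

lemma hasse_witt_entry_eq_0:
  fixes f :: "'k::field poly"
  assumes "a > 0" "j' \<le> a" and v: "\<And>v. a * v + a \<noteq> j + p * (a - j')"
  shows "hasse_witt_entry p a b c f (i, j) (i', j') = 0"
proof -
  have "of_nat v \<noteq> (of_nat j - of_nat a + of_nat p * (of_nat a - of_nat j')) / (of_nat a :: rat)" for v
  proof
    assume "of_nat v = (of_nat j - of_nat a + of_nat p * (of_nat a - of_nat j')) / (of_nat a :: rat)"
    then have "(of_nat (a * v + a) :: rat) = of_nat (j + p * (a - j'))"
      unfolding of_nat_add of_nat_mult_diff[OF assms(2)] using assms(1) by (simp add: field_simps)
    then show False using v[of v] by (simp only: of_nat_eq_iff)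
  qed
  then show ?thesis unfolding hasse_witt_entry_def prod.case Let_def by (intro sum.neutral) blast
qed

section \<open>The Cartier operator on monomial differentials\<close>

context superelliptic_separable
begin

text \<open>Exponents are grouped by their residue \<open>n\<close> modulo \<open>p\<close>. As
  coefficients are their own \<open>p\<close>-th powers, each group is a \<open>p\<close>-th power
  times \<open>x^n\<close>, and the group with \<open>n = p - 1\<close> gives the value.\<close>

lemma cartier_frob_mult_ev:
  assumes N: "degree G < p * N"
  shows "cartier p x (z ^ p * ev \<iota> x G) = z * (\<Sum>q<N. \<iota> (coeff G (p * q + (p - 1))) * x ^ q)"
proof -
  have "ev \<iota> x G = (\<Sum>m<N * p. \<iota> (coeff G m) * x ^ m)"
    using N by (intro ev_altdef'[OF crh]) (simp add: mult.commute)
  also have "\<dots> = (\<Sum>q<N. \<Sum>m = q * p..<q * p + p. \<iota> (coeff G m) * x ^ m)"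
    by (rule sum.nat_group[symmetric])
  also have "\<dots> = (\<Sum>q<N. \<Sum>n<p. \<iota> (coeff G (p * q + n)) * x ^ (p * q + n))"
    by (intro sum.cong[OF refl], subst sum.atLeastLessThan_shift_0)
      (simp add: lessThan_atLeast0 mult.commute)
  also have "\<dots> = (\<Sum>n<p. \<Sum>q<N. \<iota> (coeff G (p * q + n)) * x ^ (p * q + n))"
    by (rule sum.swap)
  also have "\<dots> = (\<Sum>n<p. (\<Sum>q<N. \<iota> (coeff G (p * q + n)) * x ^ q) ^ p * x ^ n)"
  proof (rule sum.cong[OF refl])
    fix n
    show "(\<Sum>q<N. \<iota> (coeff G (p * q + n)) * x ^ (p * q + n)) = (\<Sum>q<N. \<iota> (coeff G (p * q + n)) * x ^ q) ^ p * x ^ n"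
      unfolding frob_sum sum_distrib_right
      by (rule sum.cong[OF refl]) (simp add: power_mult_distrib frob_base power_add mult.commute flip: power_mult)
  qed
  finally have "z ^ p * ev \<iota> x G = (\<Sum>n<p. (z * (\<Sum>q<N. \<iota> (coeff G (p * q + n)) * x ^ q)) ^ p * x ^ n)"
    by (simp add: sum_distrib_left power_mult_distrib mult.assoc)
  from cartier_eq[OF d_dx_derivation this] show ?thesis .
qed

lemma coprime_p_a: "coprime p a"
proof -
  have "\<not> p dvd a" using a by (auto dest: dvd_imp_le)
  then show ?thesis by (rule prime_imp_coprime[OF prime_p])
qed

text \<open>\<open>j'\<close> is the quotient of \<open>j\<close> by \<open>p\<close> modulo
  \<open>a\<close>. It is the exponent for which \<open>y^(j-a)\<close> is the \<open>p\<close>-th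
  power of \<open>y^(j'-a)\<close> times the power \<open>v\<close> of \<open>g\<close>.\<close>

lemma partner_exists:
  assumes j: "1 \<le> j" "j < a"
  obtains j' v where "1 \<le> j'" "j' < a" "a * v + a = j + p * (a - j')"
proof -
  obtain u where "[p * u = Suc 0] (mod a)" using cong_solve_coprime_nat[OF coprime_p_a] by blast
  then have "[p * u * j = Suc 0 * j] (mod a)" by (rule cong_scalar_right)
  then obtain w where w: "[p * w = j] (mod a)" by (auto simp: mult.assoc)
  define j' where "j' = w mod a"
  have "[p * j' = j] (mod a)" using w by (simp add: j'_def cong_def mod_mult_right_eq)
  then have c: "(p * j') mod a = j" using j by (simp add: cong_def)
  have "j' \<noteq> 0" using c j by (cases "j' = 0") auto
  have "j' < a" using a by (simp add: j'_def)
  have "p * (a - j') \<ge> p * 1" using \<open>j' < a\<close> by (intro mult_le_mono2) simp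
  \<comment> \<open>Here \<open>p > a\<close> ensures that \<open>v\<close> is not negative.\<close>
  then have ge: "j + p * (a - j') \<ge> a" using a unfolding mult_1_right by linarith
  have "a dvd j + p * (a - j')"
  proof -
    have "int (j + p * (a - j')) = int j - int (p * j') + int (p * a)"
      unfolding of_nat_add of_nat_mult_diff[OF less_imp_le[OF \<open>j' < a\<close>]] by (simp add: algebra_simps)
    moreover have "int a dvd int j - int (p * j')"
    proof -
      have "p * j' = a * (p * j' div a) + j" using c by (metis mult_div_mod_eq)
      then have "int (p * j') = int a * int (p * j' div a) + int j" by (metis of_nat_add of_nat_mult)
      then show ?thesis by simp
    qed
    moreover have "int a dvd int (p * a)" by simp
    ultimately have "int a dvd int (j + p * (a - j'))" by (metis dvd_add)
    then show ?thesis by (simp only: int_dvd_int_iff)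
  qed
  then have "a dvd (j + p * (a - j')) - a" using ge by simp
  then obtain v where "(j + p * (a - j')) - a = a * v" by (rule dvdE)
  then have "a * v + a = j + p * (a - j')" using ge by linarith
  with \<open>j' \<noteq> 0\<close> \<open>j' < a\<close> show ?thesis by (intro that[of j' v]) simp_all
qed

text \<open>The equation determines \<open>j'\<close> modulo \<open>a\<close>, because
  \<open>p\<close> is invertible there. Hence each row of the matrix is supported on a single second
  index.\<close>

lemma partner_unique:
  assumes "j1 < a" "j2 < a" "a * v1 + a = j + p * (a - j1)" "a * v2 + a = j + p * (a - j2)"
  shows "j1 = j2"
proof -
  have "int (a * v1 + a) - int (a * v2 + a) = int (j + p * (a - j1)) - int (j + p * (a - j2))"
    by (simp only: assms(3,4))
  then have "int a * (int v1 - int v2) = int p * (int j2 - int j1)"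
    unfolding of_nat_add of_nat_mult_diff[OF less_imp_le[OF assms(1)]] of_nat_mult_diff[OF less_imp_le[OF assms(2)]]
    by (simp add: algebra_simps)
  then have "int a dvd int p * (int j2 - int j1)" by (metis dvd_triv_left)
  moreover have "coprime (int a) (int p)" using coprime_p_a by (simp add: coprime_commute)
  ultimately have "int a dvd int j2 - int j1" by (simp add: coprime_dvd_mult_right_iff)
  then show ?thesis using assms(1,2) dvd_imp_le_int[of "int j2 - int j1" "int a"] by linarith
qed

lemma cartier_omega:
  assumes ij: "(i, j) \<in> index_set a b c"
  shows "cartier p x (omega a x y (i, j))
    = (\<Sum>r\<in>index_set a b c. \<iota> (hasse_witt_entry p a b c f (i, j) r) * omega a x y r)"
proof -
  let ?I = "index_set a b c" and ?A = "hasse_witt_entry p a b c f (i, j)"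
  have i1: "1 \<le> i" and j1: "1 \<le> j" and low: "a * b < a * i + b * j" and up: "a * i + (b + c) * j < a * (b + c)"
    using ij c_pos by (auto simp: index_set_iff)
  have ja: "j < a" using index_set_bounds(2)[OF ij c_pos] .
  have fin: "finite ?I" by (rule finite_index_set[OF c_pos])
  obtain j' v where j': "1 \<le> j'" "j' < a" and v: "a * v + a = j + p * (a - j')"
    by (rule partner_exists[OF j1 ja])
  \<comment> \<open>The differential will be \<open>z ^ p\<close> times the value of
    \<open>G\<close>, where \<open>G\<close> is \<open>x^(i-1) g^v\<close>. The summand
    \<open>b + c\<close> in \<open>N\<close> lets the sum reach every first index in the index
    set.\<close>
  define G where "G = monom 1 (i - 1 + b * v) * f ^ v"
  define N where "N = Suc (degree G) + (b + c)"
  define z where "z = inverse (y ^ (a - j'))"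
  have N: "degree G < p * N"
  proof -
    have "degree G < N" by (simp add: N_def)
    also have "N \<le> p * N" using p_pos by simp
    finally show ?thesis .
  qed
  have A: "?A (i', j') = coeff G (p * i' - 1)" if "1 \<le> i'" for i'
    unfolding G_def by (rule hasse_witt_entry_coeff) (use that f j' v i1 a p_pos in auto)
  have A0: "?A (i', j'') = 0" if "(i', j'') \<in> ?I" "j'' \<noteq> j'" for i' j''
  proof (rule hasse_witt_entry_eq_0)
    have "j'' < a" using index_set_bounds(2)[OF that(1) c_pos] .
    then show "j'' \<le> a" by simp
    fix v' show "a * v' + a \<noteq> j + p * (a - j'')"
      using partner_unique[OF \<open>j'' < a\<close> j'(2) _ v, of v'] that(2) by blast
  qed (use a in simp)
  \<comment> \<open>Exponents in \<open>G\<close> lie between \<open>i - 1 + b * v\<close> and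
    \<open>i - 1 + (b + c) * v\<close>. With the value of \<open>v\<close>, the two inequalities for
    \<open>(i, j)\<close> yield \<open>p\<close> times those for \<open>(i', j')\<close>.\<close>
  have out: "coeff G (p * i' - 1) = 0" if "1 \<le> i'" "(i', j') \<notin> ?I" for i'
  proof (rule ccontr)
    assume "coeff G (p * i' - 1) \<noteq> 0"
    then have nz: "i - 1 + b * v \<le> p * i' - 1" "coeff (f ^ v) (p * i' - 1 - (i - 1 + b * v)) \<noteq> 0"
      by (auto simp: G_def coeff_monom_mult split: if_splits)
    have "p * i' - 1 - (i - 1 + b * v) \<le> degree (f ^ v)" using nz(2) by (rule le_degree)
    also have "\<dots> \<le> c * v" using degree_power_le[of f v] f by simp
    finally have hi: "p * i' \<le> i + b * v + c * v" using i1 by linarith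
    have "1 \<le> p * i'" using p_pos that(1) by (cases "p * i'") auto
    then have lo: "i + b * v \<le> p * i'" using nz(1) i1 by linarith
    have vI: "int a * int v = int j - int a + int p * (int a - int j')"
    proof -
      have "int (a * v + a) = int (j + p * (a - j'))" by (simp only: v)
      then show ?thesis
        unfolding of_nat_add of_nat_mult_diff[OF less_imp_le[OF j'(2)]] by (simp add: algebra_simps)
    qed
    have "int p * (int a * int b) < int p * (int a * int i' + int b * int j')"
    proof -
      have "int a * int b < int a * int i + int b * int j" using low by (simp only: of_nat_less_iff flip: of_nat_mult of_nat_add)
      moreover have "int a * (int i + int b * int v) \<le> int a * (int p * int i')"
        using lo by (intro mult_left_mono) (simp_all only: of_nat_le_iff of_nat_0_le_iff flip: of_nat_mult of_nat_add)
      moreover have "int a * (int i + int b * int v) = int a * int i + int b * (int j - int a + int p * (int a - int j'))"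
        unfolding vI[symmetric] by (simp add: algebra_simps)
      ultimately show ?thesis by (simp add: algebra_simps)
    qed
    then have "int a * int b < int a * int i' + int b * int j'" by (simp add: mult_less_cancel_left)
    moreover have "int p * (int a * int i' + int (b + c) * int j') < int p * (int a * int (b + c))"
    proof -
      have "int a * int i + int (b + c) * int j < int a * int (b + c)" using up by (simp only: of_nat_less_iff flip: of_nat_mult of_nat_add)
      moreover have "int a * (int p * int i') \<le> int a * (int i + int b * int v + int c * int v)"
        using hi by (intro mult_left_mono) (simp_all only: of_nat_le_iff of_nat_0_le_iff flip: of_nat_mult of_nat_add)
      moreover have "int a * (int i + int b * int v + int c * int v) = int a * int i + int (b + c) * (int j - int a + int p * (int a - int j'))"
        unfolding vI[symmetric] by (simp add: algebra_simps)
      ultimately show ?thesis by (simp add: algebra_simps)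
    qed
    then have "int a * int i' + int (b + c) * int j' < int a * int (b + c)" by (simp add: mult_less_cancel_left)
    ultimately have "a * b < a * i' + b * j'" "a * i' + (b + c) * j' < a * (b + c)"
      by (simp_all only: of_nat_less_iff flip: of_nat_mult of_nat_add)
    then show False using that j' by (simp add: index_set_iff[OF c_pos])
  qed
  have "omega a x y (i, j) = z ^ p * ev \<iota> x G"
  proof -
    have "y ^ (j + p * (a - j')) = y ^ a * ev \<iota> x (g ^ v)"
      unfolding v[symmetric] by (simp add: power_add power_mult curve_eq e1.hom_power mult.commute)
    then have "y ^ j * (y ^ (a - j')) ^ p = y ^ a * ev \<iota> x (g ^ v)"
      by (simp add: power_add mult.commute flip: power_mult)
    then have "y ^ j = z ^ p * y ^ a * ev \<iota> x (g ^ v)"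
      using y_nonzero by (simp add: z_def power_inverse field_simps)
    moreover have "y ^ j = y * y ^ (j - 1)" "y ^ a = y * y ^ (a - 1)"
      using j1 a by (simp_all flip: power_Suc)
    ultimately have "y ^ (j - 1) = z ^ p * y ^ (a - 1) * ev \<iota> x (g ^ v)"
      using y_nonzero by simp
    moreover have "G = monom 1 (i - 1) * g ^ v"
    proof -
      have "monom 1 (i - 1 + b * v) = monom 1 (i - 1) * (monom (1 :: 'p mod_ring) b) ^ v" by (simp add: monom_power mult_monom)
      then show ?thesis by (simp only: G_def g_def power_mult_distrib mult.assoc)
    qed
    ultimately show ?thesis
      using y_nonzero by (simp add: omega_def e1.hom_mult ev_monom[OF crh])
  qed
  then have "cartier p x (omega a x y (i, j)) = z * (\<Sum>q<N. \<iota> (coeff G (p * q + (p - 1))) * x ^ q)"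
    by (simp add: cartier_frob_mult_ev[OF N])
  also have "\<dots> = (\<Sum>q<N. \<iota> (?A (Suc q, j')) * omega a x y (Suc q, j'))"
    unfolding sum_distrib_left
  proof (rule sum.cong[OF refl])
    fix q
    have "p * Suc q - 1 = p * q + (p - 1)" using p_pos by simp
    moreover have "z = y ^ (j' - 1) / y ^ (a - 1)"
    proof -
      have "y ^ (a - 1) = y ^ (j' - 1) * y ^ (a - j')" using j' by (simp flip: power_add)
      then show ?thesis using y_nonzero by (simp add: z_def divide_inverse)
    qed
    ultimately show "z * (\<iota> (coeff G (p * q + (p - 1))) * x ^ q) = \<iota> (?A (Suc q, j')) * omega a x y (Suc q, j')"
      by (simp add: A omega_def)
  qed
  also have "\<dots> = (\<Sum>r\<in>(\<lambda>q. (Suc q, j')) ` {..<N}. \<iota> (?A r) * omega a x y r)"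
    by (subst sum.reindex) (auto simp: inj_on_def)
  also have "\<dots> = (\<Sum>r\<in>?I. \<iota> (?A r) * omega a x y r)"
  proof (rule sum.mono_neutral_cong)
    fix r assume r: "r \<in> ?I - (\<lambda>q. (Suc q, j')) ` {..<N}"
    obtain i' j'' where r': "r = (i', j'')" by (cases r)
    have "i' < b + c" "1 \<le> i'" using r r' index_set_bounds(1)[OF _ c_pos, of i' j'' a b] c_pos by (auto simp: index_set_iff)
    then have "i' - 1 < N" "i' = Suc (i' - 1)" by (simp_all add: N_def)
    then have "j'' \<noteq> j'" using r r' by blast
    then show "\<iota> (?A r) * omega a x y r = 0" using A0 r r' by simp
  next
    fix r assume "r \<in> (\<lambda>q. (Suc q, j')) ` {..<N} - ?I"
    then obtain q where q: "r = (Suc q, j')" "(Suc q, j') \<notin> ?I" by auto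
    then have "?A r = 0" using A[of "Suc q"] out[of "Suc q"] by simp
    then show "\<iota> (?A r) * omega a x y r = 0" by simp
  qed (use fin in auto)
  finally show ?thesis .
qed

lemma hasse_witt:
  "is_hasse_witt_matrix p \<iota> x (index_set a b c) (omega a x y) (hasse_witt_entry p a b c f)"
  unfolding is_hasse_witt_matrix_def using omega_basis cartier_omega by auto

end

section \<open>Square-free side polynomials\<close>

text \<open>A common prime factor \<open>q\<close> of \<open>f\<close> and its derivative occurs
  only once in \<open>f\<close>, so it divides its own derivative. As
  \<open>0 < degree q < CARD('p)\<close>, that derivative is nonzero of smaller degree, a
  contradiction.\<close>

lemma coprime_pderiv_if_squarefree:
  fixes f :: "'p::prime_card mod_ring poly"
  assumes f: "f \<noteq> 0" "squarefree f" "degree f < CARD('p)"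
  shows "coprime f (pderiv f)"
proof (rule ccontr)
  assume "\<not> coprime f (pderiv f)"
  then have "\<not> is_unit (gcd f (pderiv f))" by (simp only: is_unit_gcd not_False_eq_True)
  moreover have "gcd f (pderiv f) \<noteq> 0" using f(1) by simp
  ultimately obtain q where q: "prime q" "q dvd gcd f (pderiv f)" using prime_divisor_exists by blast
  have qe: "prime_elem q" using q(1) by simp
  obtain h where h: "f = q * h" using q(2) by (meson dvdE gcd_dvd1 dvd_trans)
  have "q dvd pderiv f" using q(2) by (meson gcd_dvd2 dvd_trans)
  then have "q dvd h * pderiv q" by (simp add: h pderiv_mult dvd_add_right_iff)
  moreover have "\<not> q dvd h"
  proof
    assume "q dvd h"
    then have "q ^ 2 dvd f" by (simp add: h power2_eq_square mult_dvd_mono)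
    then have "is_unit q" using f(2) by (rule squarefreeD[rotated])
    then show False using qe unfolding prime_elem_def by blast
  qed
  ultimately have dvd: "q dvd pderiv q" using qe by (simp add: prime_elem_dvd_mult_iff)
  have q0: "q \<noteq> 0" using qe by auto
  have dq: "degree q > 0"
  proof (rule ccontr)
    assume "\<not> degree q > 0"
    then have "is_unit q" using q0 by (simp add: is_unit_iff_degree)
    then show False using qe unfolding prime_elem_def by blast
  qed
  have "degree q \<le> degree f" using f(1) by (intro dvd_imp_degree_le) (auto simp: h)
  then have "of_nat (degree q) \<noteq> (0 :: 'p mod_ring)"
    using dq f(3) by (auto simp: of_nat_eq_0_iff_char_dvd dest: dvd_imp_le)
  then have "coeff (pderiv q) (degree q - 1) \<noteq> 0" using dq q0 by (simp add: coeff_pderiv)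
  then have "pderiv q \<noteq> 0" by auto
  then have "degree q \<le> degree (pderiv q)" using dvd by (rule dvd_imp_degree_le[rotated])
  moreover have "degree (pderiv q) \<le> degree q - 1" by (rule degree_pderiv_le)
  ultimately show False using dq by simp
qed

text \<open>Three half-planes bound a triangle \<open>S\<close> that contains the polygon. The line
  on which the second coordinate vanishes supports the polygon and cuts out exactly the bottom
  side.\<close>

lemma newton_polygon_edge:
  fixes f :: "'k::field poly"
  assumes a: "a > 0" and f: "degree f > 0" "coeff f 0 \<noteq> 0"
  shows "closed_segment (real b, 0) (real (b + degree f), 0) edge_of newton_polygon (superelliptic_poly a b f)"
proof -
  define P where "P = newton_polygon (superelliptic_poly a b f)"
  let ?F = "superelliptic_poly a b f"
  let ?A = "real a" and ?B = "real b" and ?C = "real (b + degree f)"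
  define T where "T = {(real i, real j) | i j. coeff (coeff ?F j) i \<noteq> 0}"
  have P: "P = convex hull T" by (simp add: P_def newton_polygon_def T_def)
  have coeff_F: "coeff (coeff ?F j) i = (if j = a \<and> i = 0 then 1 else 0) - (if j = 0 \<and> b \<le> i then coeff f (i - b) else 0)" for i j
    by (cases j) (auto simp: superelliptic_poly_def coeff_monom_mult)
  define S where "S = {z. (0, 1) \<bullet> z \<ge> (0::real)} \<inter> {z. (?A, ?B) \<bullet> z \<ge> ?A * ?B} \<inter> {z. (?A, ?C) \<bullet> z \<le> ?A * ?C}"
  have "convex S"
    unfolding S_def by (intro convex_Int convex_halfspace_ge convex_halfspace_le)
  have "T \<subseteq> S"
  proof
    fix z assume "z \<in> T"
    then obtain i j where z: "z = (real i, real j)" "coeff (coeff ?F j) i \<noteq> 0" by (auto simp: T_def)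
    then consider "j = a" "i = 0" | "j = 0" "b \<le> i" "coeff f (i - b) \<noteq> 0"
      unfolding coeff_F by (auto split: if_splits)
    then show "z \<in> S"
    proof cases
      case 1 then show ?thesis by (simp add: z(1) S_def inner_Pair mult.commute)
    next
      case 2
      then have "i \<le> b + degree f" using le_degree[of f "i - b"] by simp
      then have "real i \<le> ?C" by simp
      then have "?A * real i \<le> ?A * ?C" by (intro mult_left_mono) simp_all
      moreover have "?A * ?B \<le> ?A * real i" using 2(2) by (intro mult_left_mono) simp_all
      ultimately show ?thesis using 2(1) by (simp add: z(1) S_def inner_Pair)
    qed
  qed
  then have PS: "P \<subseteq> S" unfolding P using \<open>convex S\<close> by (rule hull_minimal)
  have "(P \<inter> {z. (0, 1) \<bullet> z = (0::real)}) face_of P"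
    by (rule face_of_Int_supporting_hyperplane_ge) (use PS in \<open>auto simp: P S_def convex_convex_hull\<close>)
  moreover have "P \<inter> {z. (0, 1) \<bullet> z = (0::real)} = closed_segment (?B, 0) (?C, 0)"
  proof
    have T_I: "(real i, real j) \<in> T" if "coeff (coeff ?F j) i \<noteq> 0" for i j using that by (auto simp: T_def)
    have "coeff f (degree f) \<noteq> 0" using f(1) by (cases "f = 0") auto
    then have "(?B, 0) \<in> T" "(?C, 0) \<in> T"
      using T_I[of 0 b] T_I[of 0 "b + degree f"] f(2) a by (simp_all add: coeff_F)
    then have "closed_segment (?B, 0) (?C, 0) \<subseteq> P"
      unfolding P by (intro closed_segment_subset_convex_hull hull_inc)
    moreover have "closed_segment (?B, 0) (?C, 0) \<subseteq> {z. (0, 1) \<bullet> z = (0::real)}"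
      by (auto simp: closed_segment_def inner_Pair)
    ultimately show "closed_segment (?B, 0) (?C, 0) \<subseteq> P \<inter> {z. (0, 1) \<bullet> z = (0::real)}" by blast
    show "P \<inter> {z. (0, 1) \<bullet> z = (0::real)} \<subseteq> closed_segment (?B, 0) (?C, 0)"
    proof
      fix z assume z: "z \<in> P \<inter> {z. (0, 1) \<bullet> z = (0::real)}"
      obtain s t where st: "z = (s, t)" by (cases z)
      have "t = 0" using z by (simp add: st inner_Pair)
      moreover have "z \<in> S" using z PS by auto
      ultimately have "?A * ?B \<le> ?A * s" "?A * s \<le> ?A * ?C" by (simp_all add: st S_def inner_Pair)
      then have le: "?B \<le> s" "s \<le> ?C" using a by simp_all
      define u where "u = (s - ?B) / (?C - ?B)"
      have "?C - ?B > 0" using f(1) by simp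
      then have "0 \<le> u" "u \<le> 1" "s = (1 - u) * ?B + u * ?C"
        using le by (simp_all add: u_def field_simps)
      then show "z \<in> closed_segment (?B, 0) (?C, 0)"
        unfolding closed_segment_def st \<open>t = 0\<close> by auto
    qed
  qed
  moreover have "aff_dim (closed_segment (?B, 0::real) (?C, 0)) = 1"
    using f(1) by (simp add: segment_convex_hull aff_dim_convex_hull)
  ultimately show ?thesis by (simp add: edge_of_def P_def)
qed

text \<open>Read from \<open>(b, 0)\<close> in direction \<open>(1, 0)\<close>, the bottom side has
  the side polynomial \<open>- f\<close>, and the sign does not affect square-freeness.\<close>

lemma squarefree_if_side_polys:
  fixes f :: "'k::field poly"
  assumes a: "a > 0" and f: "degree f > 0" "coeff f 0 \<noteq> 0"
    and sides: "squarefree_side_polys (superelliptic_poly a b f)"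
  shows "squarefree f"
proof -
  let ?F = "superelliptic_poly a b f"
  have "squarefree (\<Sum>n\<le>degree f. monom (coeff (coeff ?F (nat (0 + int n * 0))) (nat (int b + int n * 1))) n)"
  proof (rule sides[unfolded squarefree_side_polys_def, rule_format])
    show "closed_segment (real_of_int (int b), real_of_int 0)
      (real_of_int (int b + int (degree f) * 1), real_of_int (0 + int (degree f) * 0)) edge_of newton_polygon ?F"
      using newton_polygon_edge[OF a f] by simp
  qed simp
  also have "(\<Sum>n\<le>degree f. monom (coeff (coeff ?F (nat (0 + int n * 0))) (nat (int b + int n * 1))) n) = - f"
  proof (rule poly_eqI)
    fix m
    have "coeff ?F 0 = - (monom 1 b * f)" using a by (simp add: superelliptic_poly_def)
    then have "coeff (coeff ?F (nat (0 + int n * 0))) (nat (int b + int n * 1)) = - coeff f n" for n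
      by (simp add: coeff_monom_mult nat_int_add)
    then show "coeff (\<Sum>n\<le>degree f. monom (coeff (coeff ?F (nat (0 + int n * 0))) (nat (int b + int n * 1))) n) m = coeff (- f) m"
      by (simp add: coeff_sum coeff_eq_0)
  qed
  finally show ?thesis by (simp add: squarefree_def)
qed

theorem theorem3p8:
  fixes f :: "'p::prime_card mod_ring poly" and f_int :: "int poly"
    and p a b c :: nat
    and \<iota> :: "'p mod_ring \<Rightarrow> 'K::field" and x y :: 'K
    and \<iota>0 :: "rat \<Rightarrow> 'L::field" and x0 y0 :: 'L
  assumes p: "p = CARD('p)" "p \<noteq> 2" "p \<noteq> 3"
    and abc: "a \<ge> 2" "c \<ge> 2" "p > a" "p > b + c"
    and f: "degree f = c" "coeff f 0 \<noteq> 0"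
    and irred: "irreducible (superelliptic_poly a b f)"
    and curve: "is_function_field (superelliptic_poly a b f) \<iota> x y"
    and lift: "degree f_int = c" "map_poly of_int f_int = f"
    and curve0: "is_function_field (superelliptic_poly a b (map_poly of_int f_int)) \<iota>0 x0 y0"
    and same_genus: "genus \<iota>0 x0 = genus \<iota> x"
    and sides: "squarefree_side_polys (superelliptic_poly a b f)"
  shows "is_hasse_witt_matrix p \<iota> x (index_set a b c) (omega a x y)
           (hasse_witt_entry p a b c f)"
proof -
  have "squarefree f"
    using squarefree_if_side_polys[OF _ _ _ sides] abc f by simp
  \<comment> \<open>\<open>p > b + c\<close> puts the degree of \<open>f\<close> below the
    characteristic.\<close>
  then have "coprime f (pderiv f)"
    using coprime_pderiv_if_squarefree[of f] p(1) abc f by force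
  then interpret superelliptic_separable f p a b c \<iota> x y
    by unfold_locales (use p(1) abc f irred curve in auto)
  show ?thesis by (rule hasse_witt)
qed

end
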